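(* Let $E$ be a Banach space and let $A$ be an asymptotically hyperbolic path in $\mathcal{L}(E)$ defined on $\mathbb{R}^+=[0,+\infty)$. Let $A_0=A(+\infty)$ and let $E=E^+\oplus E^-$ be the spectral decomposition of $A_0$. Then the stable space $W_A^s$ is a closed complemented subspace of $E$, and: (i) $W_A^s$ is the only closed subspace $W$ of $E$ such that $X_A(t)W\to E^-$ as $t\to+\infty$; (ii) there are constants $c,\lambda>0$ such that $\|X_A(t)|_{W_A^s}\|\le c\,e^{-\lambda(t-s)}\|X_A(s)|_{W_A^s}\|$ for every $t\ge s\ge 0$; (iii) for every closed complemented subspace $V$ of $E$ such that $V\oplus W_A^s=E$, one has $\rho(X_A(t)V,E^+)\to 0$ as $t\to+\infty$; (iv) for every such $V$, the quantity $\inf_{v\in V,\,|v|=1}|X_A(t)v|$ grows at exponential rate, i.e. there are constants $k,\mu>0$ such that it is at least $k e^{\mu t}$ for all $t\ge 0$; (v) $W_{-A^*}^s=(W_A^s)^\perp$.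
   Context: $\mathcal{L}(E)$ is the space of bounded linear operators on $E$. An operator is hyperbolic if its spectrum does not meet $i\mathbb{R}$ (for real $E$, spectra are those of the complexification). A path $A\colon\mathbb{R}^+\to\mathcal{L}(E)$ is asymptotically hyperbolic if it is norm-continuous and has a norm limit $A(+\infty)$ as $t\to+\infty$ which is a hyperbolic operator. For hyperbolic $A_0$, $E^+$ and $E^-$ are the ranges of the spectral projectors of $A_0$ associated with $\sigma(A_0)\cap\{\operatorname{Re}z>0\}$ and $\sigma(A_0)\cap\{\operatorname{Re}z<0\}$. $X_A\colon\mathbb{R}^+\to\mathcal{L}(E)$ is the solution of $X'(t)=A(t)X(t)$, $X(0)=I$. The stable space is $W_A^s=\{x\in E:\lim_{t\to+\infty}X_A(t)x=0\}$. For closed subspaces $Y,Z$ of $E$ with closed unit balls $D(Y),D(Z)$, put $\rho(Y,Z)=\sup_{y\in D(Y)}\operatorname{dist}(y,D(Z))$ and $\delta(Y,Z)=\max\{\rho(Y,Z),\rho(Z,Y)\}$. Convergence of closed subspaces is convergence in the metric $\delta$. $E^*$ is the topological dual, $-A^*$ is the path $t\mapsto -A(t)^*$ in $\mathcal{L}(E^* )$, and for $S\subset E$, $S^\perp=\{\xi\in E^*:\langle\xi,s\rangle=0\ \forall s\in S\}$. *)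

theory Defs
  imports "HOL-Analysis.Analysis"
begin

subsection \<open>Banach spaces over the reals or the complex numbers\<close>

text \<open>
  The scalar field is the real or the complex field. The axioms make \<open>complex_of_scalar\<close> an
  isometric homomorphism of real algebras, hence injective, so its range is
  \<open>\<real>\<close> or the whole complex plane.
\<close>

class real_or_complex = real_normed_field + banach +
  fixes complex_of_scalar :: "'a \<Rightarrow> complex"
  assumes complex_of_scalar_add: "complex_of_scalar (a + b) = complex_of_scalar a + complex_of_scalar b"
    and complex_of_scalar_mult: "complex_of_scalar (a * b) = complex_of_scalar a * complex_of_scalar b"
    and complex_of_scalar_one: "complex_of_scalar 1 = 1"
    and complex_of_scalar_scaleR: "complex_of_scalar (r *\<^sub>R a) = r *\<^sub>R complex_of_scalar a"
    and norm_complex_of_scalar: "norm (complex_of_scalar a) = norm a"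

instantiation real :: real_or_complex
begin
definition complex_of_scalar_real :: "real \<Rightarrow> complex" where "complex_of_scalar_real = of_real"
instance by standard (simp_all add: complex_of_scalar_real_def scaleR_conv_of_real)
end

instantiation complex :: real_or_complex
begin
definition complex_of_scalar_complex :: "complex \<Rightarrow> complex" where "complex_of_scalar_complex = id"
instance by standard (simp_all add: complex_of_scalar_complex_def)
end

text \<open>
  The library's class \<open>banach\<close> knows real scalars only; scalars from the field \<open>'k\<close> act through
  \<open>smul\<close>.
\<close>

locale banach_over = vector_space smul
  for smul :: "'k::real_or_complex \<Rightarrow> 'a::banach \<Rightarrow> 'a" +
  assumes smul_of_real: "smul (of_real r) x = r *\<^sub>R x"
    and norm_smul: "norm (smul c x) = norm c * norm x"

lemma banach_over_scaleR: "banach_over (scaleR :: real \<Rightarrow> 'a::banach \<Rightarrow> 'a)"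
  by unfold_locales (simp_all add: algebra_simps)

lemma banach_over_complex: "banach_over ((*) :: complex \<Rightarrow> complex \<Rightarrow> complex)"
  by unfold_locales (simp_all add: algebra_simps norm_mult scaleR_conv_of_real)

definition bounded_operators :: "('k::real_or_complex \<Rightarrow> 'a::banach \<Rightarrow> 'a) \<Rightarrow> ('a \<Rightarrow>\<^sub>L 'a) set"
  where "bounded_operators smul = {T :: 'a \<Rightarrow>\<^sub>L 'a. \<forall>c x. T (smul c x) = smul c (T x)}"

definition closed_subspace :: "('k::real_or_complex \<Rightarrow> 'a::banach \<Rightarrow> 'a) \<Rightarrow> 'a set \<Rightarrow> bool"
  where "closed_subspace smul W \<longleftrightarrow> module.subspace smul W \<and> closed W"

definition complementary :: "('k::real_or_complex \<Rightarrow> 'a::banach \<Rightarrow> 'a) \<Rightarrow> 'a set \<Rightarrow> 'a set \<Rightarrow> bool"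
  where "complementary smul V W \<longleftrightarrow> closed_subspace smul V \<and> closed_subspace smul W \<and>
    V \<inter> W = {0} \<and> {v + w |v w. v \<in> V \<and> w \<in> W} = UNIV"

subsection \<open>Spectra and spectral projectors\<close>

text \<open>
  A complex Banach space is treated here as a real one with a bounded operator \<open>J\<close>,
  \<open>J \<circ> J = - id\<close>, standing for multiplication by \<open>\<i>\<close>. An inverse of an operator commuting
  with \<open>J\<close> commutes with \<open>J\<close> as well, so invertibility may be tested among the real-linear
  bounded operators.
\<close>

definition cmul :: "('e::banach \<Rightarrow>\<^sub>L 'e) \<Rightarrow> complex \<Rightarrow> ('e \<Rightarrow>\<^sub>L 'e)"
  where "cmul J z = Re z *\<^sub>R id_blinfun + Im z *\<^sub>R J"

definition is_inverse :: "('e::banach \<Rightarrow>\<^sub>L 'e) \<Rightarrow> ('e \<Rightarrow>\<^sub>L 'e) \<Rightarrow> bool"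
  where "is_inverse T S \<longleftrightarrow> T o\<^sub>L S = id_blinfun \<and> S o\<^sub>L T = id_blinfun"

definition cspectrum :: "('e::banach \<Rightarrow>\<^sub>L 'e) \<Rightarrow> ('e \<Rightarrow>\<^sub>L 'e) \<Rightarrow> complex set"
  where "cspectrum J T = {z. \<not> (\<exists>S. is_inverse (cmul J z - T) S)}"

definition resolvent :: "('e::banach \<Rightarrow>\<^sub>L 'e) \<Rightarrow> ('e \<Rightarrow>\<^sub>L 'e) \<Rightarrow> complex \<Rightarrow> ('e \<Rightarrow>\<^sub>L 'e)"
  where "resolvent J T z = (THE S. is_inverse (cmul J z - T) S)"

definition riesz_projector ::
    "('e::banach \<Rightarrow>\<^sub>L 'e) \<Rightarrow> ('e \<Rightarrow>\<^sub>L 'e) \<Rightarrow> (real \<Rightarrow> complex) \<Rightarrow> ('e \<Rightarrow>\<^sub>L 'e)"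
  where "riesz_projector J T \<gamma> = cmul J (1 / (2 * of_real pi * \<i>)) o\<^sub>L
    integral {0..1} (\<lambda>t. cmul J (vector_derivative \<gamma> (at t within {0..1})) o\<^sub>L resolvent J T (\<gamma> t))"

text \<open>
  The complexification of a real space is \<open>'a \<times> 'a\<close>, the pair \<open>(x, y)\<close> standing for \<open>x + \<i> y\<close>.
  The product norm is not homogeneous for complex scalars, but it is equivalent to the
  complexification norms, and spectrum and projectors depend on the topology only.
\<close>

lift_definition complexification_J :: "('a::banach \<times> 'a) \<Rightarrow>\<^sub>L ('a \<times> 'a)" is "\<lambda>(x, y). (- y, x)"
  unfolding split_beta
  by (intro bounded_linear_Pair bounded_linear_minus bounded_linear_fst bounded_linear_snd)

lift_definition complexify :: "('a::banach \<Rightarrow>\<^sub>L 'a) \<Rightarrow> ('a \<times> 'a) \<Rightarrow>\<^sub>L ('a \<times> 'a)"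
  is "\<lambda>T (x, y). (T x, T y)"
  unfolding split_beta
  by (intro bounded_linear_Pair) (auto intro: bounded_linear_compose bounded_linear_fst bounded_linear_snd)

text \<open>The test \<open>surj complex_of_scalar\<close> below holds exactly when the scalar field is complex.\<close>

definition smul_i :: "('k::real_or_complex \<Rightarrow> 'a::banach \<Rightarrow> 'a) \<Rightarrow> ('a \<Rightarrow>\<^sub>L 'a)"
  where "smul_i smul = Blinfun (smul (inv complex_of_scalar \<i>))"

definition spectrum :: "('k::real_or_complex \<Rightarrow> 'a::banach \<Rightarrow> 'a) \<Rightarrow> ('a \<Rightarrow>\<^sub>L 'a) \<Rightarrow> complex set"
  where "spectrum smul T =
    (if surj (complex_of_scalar :: 'k \<Rightarrow> complex) then cspectrum (smul_i smul) T
     else cspectrum complexification_J (complexify T))"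

definition hyperbolic :: "('k::real_or_complex \<Rightarrow> 'a::banach \<Rightarrow> 'a) \<Rightarrow> ('a \<Rightarrow>\<^sub>L 'a) \<Rightarrow> bool"
  where "hyperbolic smul T \<longleftrightarrow> spectrum smul T \<inter> {z. Re z = 0} = {}"

text \<open>
  The range of the spectral projector defined by \<open>\<gamma>\<close>. In the real case and for a \<open>\<gamma>\<close> enclosing a
  conjugation invariant part of the spectrum, the projector of the complexification is the
  complexification of a projector of the space, whose range is extracted here.
\<close>

definition spectral_subspace ::
    "('k::real_or_complex \<Rightarrow> 'a::banach \<Rightarrow> 'a) \<Rightarrow> ('a \<Rightarrow>\<^sub>L 'a) \<Rightarrow> (real \<Rightarrow> complex) \<Rightarrow> 'a set"
  where "spectral_subspace smul T \<gamma> =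
    (if surj (complex_of_scalar :: 'k \<Rightarrow> complex)
     then range (blinfun_apply (riesz_projector (smul_i smul) T \<gamma>))
     else {x. (x, 0) \<in> range (blinfun_apply (riesz_projector complexification_J (complexify T) \<gamma>))})"

text \<open>
  Every spectral value has modulus at most \<open>norm T\<close>. Hence, for hyperbolic \<open>T\<close>, the rectangles
  below, which have one side on the imaginary axis and are traversed counterclockwise, avoid the
  spectrum and enclose exactly its part in the right, respectively left, open half plane.
\<close>

definition positive_subspace ::
    "('k::real_or_complex \<Rightarrow> 'a::banach \<Rightarrow> 'a) \<Rightarrow> ('a \<Rightarrow>\<^sub>L 'a) \<Rightarrow> 'a set"
  where "positive_subspace smul T =
    (let R = norm T + 1 in spectral_subspace smul T (rectpath (Complex 0 (- R)) (Complex R R)))"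

definition negative_subspace ::
    "('k::real_or_complex \<Rightarrow> 'a::banach \<Rightarrow> 'a) \<Rightarrow> ('a \<Rightarrow>\<^sub>L 'a) \<Rightarrow> 'a set"
  where "negative_subspace smul T =
    (let R = norm T + 1 in spectral_subspace smul T (rectpath (Complex (- R) (- R)) (Complex 0 R)))"

subsection \<open>Asymptotically hyperbolic paths and their stable spaces\<close>

text \<open>Paths are parametrized by all reals; only their values at \<open>t \<ge> 0\<close> matter.\<close>

definition asymptotically_hyperbolic ::
    "('k::real_or_complex \<Rightarrow> 'a::banach \<Rightarrow> 'a) \<Rightarrow> (real \<Rightarrow> ('a \<Rightarrow>\<^sub>L 'a)) \<Rightarrow> ('a \<Rightarrow>\<^sub>L 'a) \<Rightarrow> bool"
  where "asymptotically_hyperbolic smul A A\<^sub>0 \<longleftrightarrow>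
    (\<forall>t\<ge>0. A t \<in> bounded_operators smul) \<and> continuous_on {0..} A \<and>
    (A \<longlongrightarrow> A\<^sub>0) at_top \<and> hyperbolic smul A\<^sub>0"

definition fundamental_solution :: "(real \<Rightarrow> ('a::banach \<Rightarrow>\<^sub>L 'a)) \<Rightarrow> real \<Rightarrow> ('a \<Rightarrow>\<^sub>L 'a)"
  where "fundamental_solution A = (SOME X. X 0 = id_blinfun \<and>
    (\<forall>t\<ge>0. (X has_vector_derivative (A t o\<^sub>L X t)) (at t within {0..})))"

definition stable_space :: "(real \<Rightarrow> ('a::banach \<Rightarrow>\<^sub>L 'a)) \<Rightarrow> 'a set"
  where "stable_space A = {x. ((\<lambda>t. fundamental_solution A t x) \<longlongrightarrow> 0) at_top}"

subsection \<open>Distances between closed subspaces\<close>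

definition \<rho> :: "'a::banach set \<Rightarrow> 'a set \<Rightarrow> real"
  where "\<rho> Y Z = (SUP y\<in>Y \<inter> cball 0 1. infdist y (Z \<inter> cball 0 1))"

definition \<delta> :: "'a::banach set \<Rightarrow> 'a set \<Rightarrow> real"
  where "\<delta> Y Z = max (\<rho> Y Z) (\<rho> Z Y)"

definition norm_restricted :: "('a::banach \<Rightarrow>\<^sub>L 'a) \<Rightarrow> 'a set \<Rightarrow> real"
  where "norm_restricted T W = (SUP w\<in>W \<inter> cball 0 1. norm (T w))"

subsection \<open>Duality\<close>

definition dual :: "('k::real_or_complex \<Rightarrow> 'a::banach \<Rightarrow> 'a) \<Rightarrow> ('a \<Rightarrow>\<^sub>L 'k) set"
  where "dual smul = {\<xi> :: 'a \<Rightarrow>\<^sub>L 'k. \<forall>c x. \<xi> (smul c x) = c * \<xi> x}"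

definition annihilator ::
    "('k::real_or_complex \<Rightarrow> 'a::banach \<Rightarrow> 'a) \<Rightarrow> 'a set \<Rightarrow> ('a \<Rightarrow>\<^sub>L 'k) set"
  where "annihilator smul S = {\<xi> \<in> dual smul. \<forall>s\<in>S. \<xi> s = 0}"

text \<open>
  For complex scalars, \<open>dual smul\<close> is a proper closed subspace of the type of all bounded
  real-linear maps into \<open>'k\<close>. The adjoint is defined on the whole type and leaves \<open>dual smul\<close>
  invariant when \<open>T\<close> is linear over \<open>'k\<close>. Hence the fundamental solution of a path of
  such adjoints on the whole type restricts to the one on \<open>dual smul\<close>.
\<close>

lift_definition adjoint_blinfun ::
    "('a::banach \<Rightarrow>\<^sub>L 'a) \<Rightarrow> ('a \<Rightarrow>\<^sub>L 'k::real_or_complex) \<Rightarrow>\<^sub>L ('a \<Rightarrow>\<^sub>L 'k)" is "\<lambda>T \<xi>. \<xi> o\<^sub>L T"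
  by (rule bounded_bilinear.bounded_linear_left[OF bounded_bilinear_blinfun_compose])

definition dual_stable_space ::
    "('k::real_or_complex \<Rightarrow> 'a::banach \<Rightarrow> 'a) \<Rightarrow> (real \<Rightarrow> ('a \<Rightarrow>\<^sub>L 'a)) \<Rightarrow> ('a \<Rightarrow>\<^sub>L 'k) set"
  where "dual_stable_space smul A =
    dual smul \<inter> stable_space (\<lambda>t. - adjoint_blinfun (A t) :: ('a \<Rightarrow>\<^sub>L 'k) \<Rightarrow>\<^sub>L ('a \<Rightarrow>\<^sub>L 'k))"

end

theory Submission
  imports Defs
begin

text \<open>
  Why the theorem holds. Write \<open>T\<close> for the limit operator, \<open>R(z)\<close> for its resolvent, and \<open>p\<close>, \<open>q\<close> for its
  spectral projectors with ranges \<open>E\<^sup>-\<close>, \<open>E\<^sup>+\<close>.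

  The splitting. For the rectangle in the left half plane, \<open>S(t) = (2 \<pi> \<i>)\<^sup>-\<^sup>1 \<integral> e\<^sup>t\<^sup>z R(z) dz\<close> solves
  \<open>S' = T S\<close> and \<open>S(0) = p\<close>, so that \<open>S(t) = e\<^sup>t\<^sup>T p\<close>. One side of the rectangle lies on the imaginary axis,
  where \<open>e\<^sup>t\<^sup>z\<close> does not decay, but an integration by parts gives
  \<open>t S(t) = (2 \<pi> \<i>)\<^sup>-\<^sup>1 \<integral> e\<^sup>t\<^sup>z R(z)\<^sup>2 dz\<close>, which is bounded for \<open>t \<ge> 0\<close>. Hence \<open>e\<^sup>t\<^sup>T p = O(1/t)\<close>, and in the same
  way \<open>e\<^sup>-\<^sup>t\<^sup>T q = O(1/t)\<close> (\<open>riesz_decay\<close>). The Neumann series gives \<open>p + q = 1\<close> (\<open>P_plus_Q\<close>), and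
  \<open>p q = (e\<^sup>t\<^sup>T p) (e\<^sup>-\<^sup>t\<^sup>T q) \<rightarrow> 0\<close> gives \<open>p q = 0\<close>. For real scalars these facts descend from the
  complexification (\<open>hyperbolic_splitting\<close>). In particular there is a step \<open>h\<close> for which \<open>e\<^sup>h\<^sup>T\<close>
  contracts \<open>E\<^sup>-\<close> and \<open>e\<^sup>-\<^sup>h\<^sup>T\<close> contracts \<open>E\<^sup>+\<close>, both at least by the factor \<open>1/4\<close>.

  Invariant graphs. The transition operators \<open>X(t + h) X(t)\<^sup>-\<^sup>1\<close> tend to \<open>e\<^sup>h\<^sup>T\<close>. For late
  times a contraction argument therefore yields small operators \<open>L(t)\<close> from \<open>E\<^sup>-\<close> to \<open>E\<^sup>+\<close> whose graphs
  are mapped into each other by these transition operators (\<open>invariant_graph_exists\<close>). Let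
  \<open>E(t) = p + L(t)\<close> be the projector onto the graph along \<open>E\<^sup>+\<close>. A step at least halves the
  \<open>p\<close>-component of a vector on the graph, and at least doubles \<open>x - E(t) x\<close> for every \<open>x\<close>. So an
  orbit on the graphs decays exponentially, an orbit off them grows exponentially, and \<open>x\<close> is
  stable if and only if \<open>X(t) x\<close> lies on the graph (\<open>mem_Ws_iff\<close>).

  The conclusions. The images \<open>X(t) W\<^sup>s\<close> of the stable space are the graphs, and these converge to
  \<open>E\<^sup>-\<close> because \<open>L(t) \<rightarrow> 0\<close>. If \<open>X(t) W\<close> converges to \<open>E\<^sup>-\<close>, then its elements end up in narrow cones
  around \<open>E\<^sup>-\<close>, whereas orbits off the graphs leave such cones. Hence \<open>W \<subseteq> W\<^sup>s\<close>, and equality follows since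
  nested closed subspaces at a small distance are equal (\<open>Ws_unique\<close>). On a complement \<open>V\<close> of \<open>W\<^sup>s\<close>
  the open mapping principle (\<open>complementary_projection_bounded\<close>) bounds \<open>v\<close> by its component off
  the graph. That component grows exponentially, and in the limit it dominates the
  \<open>p\<close>-component; this gives the growth on \<open>V\<close> and the attraction of \<open>X(t) V\<close> by \<open>E\<^sup>+\<close>. Finally, the fundamental
  solution of the dual path is \<open>\<xi> \<mapsto> \<xi> X(t)\<^sup>-\<^sup>1\<close>. If \<open>\<xi>\<close> vanishes on \<open>W\<^sup>s\<close>, then \<open>\<xi> X(t)\<^sup>-\<^sup>1\<close> vanishes on the graph
  and only sees the component that expands from an earlier time, hence tends to \<open>0\<close> (\<open>annihilator_Ws\<close>).
\<close>

section \<open>Composition of bounded operators\<close>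

lemmas blinfun_compose_bilinear =
  bounded_bilinear.add_left[OF bounded_bilinear_blinfun_compose]
  bounded_bilinear.add_right[OF bounded_bilinear_blinfun_compose]
  bounded_bilinear.diff_left[OF bounded_bilinear_blinfun_compose]
  bounded_bilinear.diff_right[OF bounded_bilinear_blinfun_compose]
  bounded_bilinear.minus_left[OF bounded_bilinear_blinfun_compose]
  bounded_bilinear.minus_right[OF bounded_bilinear_blinfun_compose]
  bounded_bilinear.scaleR_left[OF bounded_bilinear_blinfun_compose]
  bounded_bilinear.scaleR_right[OF bounded_bilinear_blinfun_compose]
  bounded_bilinear.zero_left[OF bounded_bilinear_blinfun_compose]
  bounded_bilinear.zero_right[OF bounded_bilinear_blinfun_compose]

lemmas bounded_linear_compose_left =
  bounded_bilinear.bounded_linear_left[OF bounded_bilinear_blinfun_compose]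

lemmas bounded_linear_compose_right =
  bounded_bilinear.bounded_linear_right[OF bounded_bilinear_blinfun_compose]

lemma blinfun_compose_assoc: "(A o\<^sub>L B) o\<^sub>L C = A o\<^sub>L (B o\<^sub>L C)"
  by (rule blinfun_eqI) simp

lemma blinfun_compose_id [simp]: "A o\<^sub>L id_blinfun = A" "id_blinfun o\<^sub>L A = A"
  by (rule blinfun_eqI, simp)+

lemma norm_blinfun_compose_le:
  assumes "norm A \<le> a" "norm B \<le> b"
  shows "norm (A o\<^sub>L B) \<le> a * b"
  using norm_blinfun_compose[of A B] mult_mono[OF assms] order_trans[OF norm_ge_zero assms(1)]
  by (meson norm_ge_zero order_trans)

lemma norm_blinfun_apply_le:
  assumes "norm A \<le> a" "norm x \<le> b"
  shows "norm (blinfun_apply A x) \<le> a * b"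
  using norm_blinfun[of A x] mult_mono[OF assms] order_trans[OF norm_ge_zero assms(1)]
  by (meson norm_ge_zero order_trans)

section \<open>Linear differential equations on a half line\<close>

lemma at_within_atLeast_Icc:
  fixes t :: real
  assumes "0 \<le> t" "t < T"
  shows "at t within {0..} = at t within {0..T}"
  by (rule at_within_nhd[of t "{..<T}"]) (use assms in auto)

lemma has_vector_derivative_Icc_subset:
  fixes x :: "real \<Rightarrow> 'b::real_normed_vector"
  assumes "(x has_vector_derivative d) (at t within {0..})"
  shows "(x has_vector_derivative d) (at t within {0..T})"
  by (rule has_vector_derivative_within_subset[OF assms]) auto

text \<open>
  A substitute for Gronwall's lemma. Let \<open>m\<close> be the maximum of the norm weighted by \<open>exp (- 2 a t)\<close>,
  attained at \<open>s\<close>. Integrating the bound on the derivative up to \<open>s\<close> gives at most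
  \<open>m / 2 * exp (2 a s)\<close> plus the data, and the first term is absorbed by the left hand side.
\<close>

lemma linear_growth_bound:
  fixes x x' :: "real \<Rightarrow> 'b::real_normed_vector"
  assumes "0 < a" "0 \<le> \<gamma>" "0 \<le> T"
    and deriv: "\<And>t. t \<in> {0..T} \<Longrightarrow> (x has_vector_derivative x' t) (at t within {0..T})"
    and bnd: "\<And>t. t \<in> {0..T} \<Longrightarrow> norm (x' t) \<le> a * norm (x t) + \<gamma>"
  shows "norm (x T) \<le> 2 * exp (2 * a * T) * (norm (x 0) + \<gamma> * T)"
proof -
  have cont: "continuous_on {0..T} x"
    using deriv by (rule continuous_on_vector_derivative)
  define g where "g t = exp (- 2 * a * t) * norm (x t)" for t
  have "continuous_on {0..T} g"
    unfolding g_def by (intro continuous_intros cont)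
  then obtain s where s: "s \<in> {0..T}" and max: "\<And>t. t \<in> {0..T} \<Longrightarrow> g t \<le> g s"
    using continuous_attains_sup[of "{0..T}" g] \<open>0 \<le> T\<close> by auto
  define m where "m = g s"
  have m0: "0 \<le> m" by (simp add: m_def g_def)
  have le: "norm (x t) \<le> m * exp (2 * a * t)" if "t \<in> {0..T}" for t
  proof -
    have "norm (x t) = g t * exp (2 * a * t)" by (simp add: g_def exp_minus)
    also have "\<dots> \<le> m * exp (2 * a * t)" using max[OF that] by (simp add: m_def)
    finally show ?thesis .
  qed
  have xs: "norm (x s) = m * exp (2 * a * s)"
    by (simp add: m_def g_def exp_minus field_simps)
  have "m / 2 * exp (2 * a * s) \<le> norm (x 0) + \<gamma> * s"
  proof (cases "s = 0")
    case True
    then show ?thesis using xs m0 by simp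
  next
    case False
    then have s0: "0 < s" using s by simp
    define \<phi> where "\<phi> t = m / 2 * exp (2 * a * t) + \<gamma> * t" for t
    have "norm (x s - x 0) \<le> \<phi> s - \<phi> 0"
    proof (rule differentiable_bound_general[OF s0, where f' = x' and \<phi>' = "\<lambda>t. a * m * exp (2 * a * t) + \<gamma>"])
      show "continuous_on {0..s} x" using cont s by (auto intro: continuous_on_subset)
      show "continuous_on {0..s} \<phi>" unfolding \<phi>_def by (intro continuous_intros)
      fix t assume t: "0 < t" "t < s"
      then have tT: "t \<in> {0..T}" "t \<in> interior {0..T}" using s by auto
      show "(x has_vector_derivative x' t) (at t)"
        using deriv[OF tT(1)] at_within_interior[OF tT(2)] by simp
      show "(\<phi> has_vector_derivative a * m * exp (2 * a * t) + \<gamma>) (at t)"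
        unfolding \<phi>_def has_real_derivative_iff_has_vector_derivative[symmetric]
        by (auto intro!: derivative_eq_intros)
      have "a * norm (x t) \<le> a * (m * exp (2 * a * t))"
        using le[OF tT(1)] \<open>0 < a\<close> by simp
      then show "norm (x' t) \<le> a * m * exp (2 * a * t) + \<gamma>"
        using bnd[OF tT(1)] by (simp add: mult.assoc)
    qed
    moreover have "norm (x s) \<le> norm (x 0) + norm (x s - x 0)" by norm
    ultimately show ?thesis using xs m0 by (simp add: \<phi>_def)
  qed
  moreover have "\<gamma> * s \<le> \<gamma> * T" using s \<open>0 \<le> \<gamma>\<close> by (simp add: mult_left_mono)
  moreover have "m / 2 * 1 \<le> m / 2 * exp (2 * a * s)"
    using m0 s \<open>0 < a\<close> by (intro mult_left_mono) auto
  ultimately have "m / 2 \<le> norm (x 0) + \<gamma> * T" by simp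
  then have "m \<le> 2 * (norm (x 0) + \<gamma> * T)" by simp
  have "norm (x T) \<le> m * exp (2 * a * T)" using le[of T] \<open>0 \<le> T\<close> by simp
  also have "\<dots> \<le> 2 * (norm (x 0) + \<gamma> * T) * exp (2 * a * T)"
    using \<open>m \<le> 2 * (norm (x 0) + \<gamma> * T)\<close> by (rule mult_right_mono) simp
  finally show ?thesis by (simp only: mult_ac)
qed

lemma integral_has_vector_derivative_atLeast:
  fixes f :: "real \<Rightarrow> 'b::banach"
  assumes "continuous_on {0..} f" "0 \<le> t"
  shows "((\<lambda>u. integral {0..u} f) has_vector_derivative f t) (at t within {0..})"
proof -
  have "continuous_on {0..t + 1} f" using assms(1) by (rule continuous_on_subset) auto
  then have "((\<lambda>u. integral {0..u} f) has_vector_derivative f t) (at t within {0..t + 1})"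
    by (rule integral_has_vector_derivative) (use assms in auto)
  then show ?thesis using at_within_atLeast_Icc[of t "t + 1"] assms by simp
qed

text \<open>
  The factor \<open>1 / 2\<close>, due to the weight, is the contraction constant of the Picard operator below.
\<close>

lemma integral_exp_weight_bound:
  fixes f :: "real \<Rightarrow> 'b::banach"
  assumes "continuous_on {0..} f" "0 < a" "0 \<le> m" "0 \<le> t"
    and bnd: "\<And>s. 0 \<le> s \<Longrightarrow> norm (f s) \<le> a * m * exp (2 * a * s)"
  shows "exp (- 2 * a * t) * norm (integral {0..t} f) \<le> m / 2"
proof (cases "t = 0")
  case True
  then show ?thesis using assms by simp
next
  case False
  then have t0: "0 < t" using assms by simp
  define \<phi> where "\<phi> s = m / 2 * exp (2 * a * s)" for s
  have d: "((\<lambda>u. integral {0..u} f) has_vector_derivative f s) (at s within {0..})" if "0 \<le> s" for s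
    using integral_has_vector_derivative_atLeast[OF assms(1) that] .
  have "norm (integral {0..t} f - integral {0..0} f) \<le> \<phi> t - \<phi> 0"
  proof (rule differentiable_bound_general[OF t0, where f' = f and \<phi>' = "\<lambda>s. a * m * exp (2 * a * s)"])
    have "continuous_on {0..} (\<lambda>u. integral {0..u} f)"
      using d by (intro continuous_on_vector_derivative) auto
    then show "continuous_on {0..t} (\<lambda>u. integral {0..u} f)"
      by (rule continuous_on_subset) auto
    show "continuous_on {0..t} \<phi>" unfolding \<phi>_def by (intro continuous_intros)
    fix s assume s: "0 < s" "s < t"
    then have "s \<in> interior {0..}" by simp
    then show "((\<lambda>u. integral {0..u} f) has_vector_derivative f s) (at s)"
      using d[of s] s at_within_interior by fastforce
    show "(\<phi> has_vector_derivative a * m * exp (2 * a * s)) (at s)"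
      unfolding \<phi>_def has_real_derivative_iff_has_vector_derivative[symmetric]
      by (auto intro!: derivative_eq_intros)
    show "norm (f s) \<le> a * m * exp (2 * a * s)" using bnd s by simp
  qed
  then have "norm (integral {0..t} f) \<le> m / 2 * exp (2 * a * t)"
    using \<open>0 \<le> m\<close> by (simp add: \<phi>_def)
  then show ?thesis by (simp add: exp_minus field_simps)
qed

text \<open>
  Picard iteration on the whole half line at once: after multiplication by \<open>exp (- 2 a t)\<close> a
  solution is a fixed point in the space of bounded continuous functions. Functions there are
  defined for all real times, whence the occurrences of \<open>max 0 t\<close>.
\<close>

lemma linear_ode_solution:
  fixes F :: "real \<Rightarrow> ('b::banach \<Rightarrow>\<^sub>L 'b)"
  assumes cont: "continuous_on {0..} F" and a: "0 < a"
    and bnd: "\<And>t. 0 \<le> t \<Longrightarrow> norm (F t) \<le> a"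
  shows "\<exists>x. x 0 = x0 \<and> (\<forall>t\<ge>0. (x has_vector_derivative F t (x t)) (at t within {0..}))"
proof -
  define f where "f y s = exp (2 * a * s) *\<^sub>R F s (apply_bcontfun y s)"
    for y :: "real \<Rightarrow>\<^sub>C 'b" and s
  define \<Phi> where "\<Phi> y t = exp (- 2 * a * max 0 t) *\<^sub>R (x0 + integral {0..max 0 t} (f y))"
    for y :: "real \<Rightarrow>\<^sub>C 'b" and t
  have cf: "continuous_on {0..} (f y)" for y
    unfolding f_def by (intro continuous_intros cont) auto
  have fb: "norm (f y s - f z s) \<le> a * dist y z * exp (2 * a * s)" if "0 \<le> s" for y z s
  proof -
    have "norm (F s (apply_bcontfun y s - apply_bcontfun z s)) \<le> a * dist y z"
      using norm_blinfun[of "F s" "apply_bcontfun y s - apply_bcontfun z s"] bnd[OF that]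
        dist_bounded[of y s z] a
      by (smt (verit) dist_norm mult_mono norm_ge_zero)
    then show ?thesis
      by (simp add: f_def blinfun.diff_right scaleR_diff_right[symmetric] mult.commute)
  qed
  have ci: "continuous_on UNIV (\<lambda>t. integral {0..max 0 t} (f y))" for y
  proof -
    have "continuous_on {0..} (\<lambda>u. integral {0..u} (f y))"
      by (rule continuous_on_vector_derivative, rule integral_has_vector_derivative_atLeast[OF cf]) auto
    then show ?thesis
      by (rule continuous_on_compose2[where g = "\<lambda>u. integral {0..u} (f y)"])
        (auto intro!: continuous_intros)
  qed
  have mem: "\<Phi> y \<in> bcontfun" for y
  proof (rule bcontfun_normI)
    show "continuous_on UNIV (\<Phi> y)"
      unfolding \<Phi>_def by (intro continuous_intros ci)
    fix t :: real
    have "exp (- 2 * a * max 0 t) * norm (integral {0..max 0 t} (f y)) \<le> norm y / 2"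
    proof (rule integral_exp_weight_bound[OF cf a])
      fix s :: real assume "0 \<le> s"
      then show "norm (f y s) \<le> a * norm y * exp (2 * a * s)"
        using fb[of s y 0] by (simp add: f_def blinfun.zero_right)
    qed auto
    moreover have "exp (- 2 * a * max 0 t) * norm x0 \<le> 1 * norm x0"
      using a by (intro mult_right_mono) auto
    moreover have "norm (\<Phi> y t) \<le> exp (- 2 * a * max 0 t) * norm x0
        + exp (- 2 * a * max 0 t) * norm (integral {0..max 0 t} (f y))"
      unfolding \<Phi>_def norm_scaleR abs_exp_cancel distrib_left[symmetric]
      by (intro mult_left_mono norm_triangle_ineq) auto
    ultimately show "norm (\<Phi> y t) \<le> norm x0 + norm y / 2" by linarith
  qed
  have "\<exists>!y. Bcontfun (\<Phi> y) = y"
  proof (rule banach_fix_type[of "1 / 2"]; (intro allI)?)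
    fix y z
    show "dist (Bcontfun (\<Phi> y)) (Bcontfun (\<Phi> z)) \<le> 1 / 2 * dist y z"
    proof (rule dist_bound)
      fix t :: real
      have int: "f y integrable_on {0..max 0 t}" for y
        by (intro integrable_continuous_real continuous_on_subset[OF cf]) auto
      have "\<Phi> y t - \<Phi> z t
          = exp (- 2 * a * max 0 t) *\<^sub>R integral {0..max 0 t} (\<lambda>s. f y s - f z s)"
        unfolding \<Phi>_def Henstock_Kurzweil_Integration.integral_diff[OF int int]
        by (simp add: scaleR_diff_right[symmetric])
      moreover have "exp (- 2 * a * max 0 t) * norm (integral {0..max 0 t} (\<lambda>s. f y s - f z s))
          \<le> dist y z / 2"
        by (rule integral_exp_weight_bound[OF _ a])
          (use fb in \<open>auto intro!: continuous_intros cf\<close>)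
      ultimately show "dist (apply_bcontfun (Bcontfun (\<Phi> y)) t) (apply_bcontfun (Bcontfun (\<Phi> z)) t)
          \<le> 1 / 2 * dist y z"
        by (simp add: Bcontfun_inverse mem dist_norm)
    qed
  qed auto
  then obtain y where "Bcontfun (\<Phi> y) = y" by blast
  then have y: "apply_bcontfun y = \<Phi> y" using Bcontfun_inverse[OF mem] by metis
  \<comment> \<open>Undoing the weight.\<close>
  define x where "x t = x0 + integral {0..t} (f y)" for t
  have fx: "f y t = F t (x t)" if "0 \<le> t" for t
    using that by (simp add: f_def y \<Phi>_def x_def blinfun.scaleR_right exp_minus)
  have "(x has_vector_derivative F t (x t)) (at t within {0..})" if "0 \<le> t" for t
    unfolding x_def[abs_def] using integral_has_vector_derivative_atLeast[OF cf that, of y]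
    by (auto intro!: derivative_eq_intros simp: fx[OF that, unfolded x_def])
  moreover have "x 0 = x0" by (simp add: x_def)
  ultimately show ?thesis by blast
qed


subsection \<open>Fundamental solutions\<close>

text \<open>
  A continuous path with a limit at infinity is bounded; the bound \<open>a\<close> controls all growth.
\<close>

locale bounded_path =
  fixes A :: "real \<Rightarrow> ('a::banach \<Rightarrow>\<^sub>L 'a)" and a :: real
  assumes continuous_path: "continuous_on {0..} A"
    and bound_pos: "0 < a"
    and norm_path_le: "\<And>t. 0 \<le> t \<Longrightarrow> norm (A t) \<le> a"
begin

definition solution :: "(real \<Rightarrow> ('a \<Rightarrow>\<^sub>L 'a)) \<Rightarrow> bool"
  where "solution Z \<longleftrightarrow> (\<forall>t\<ge>0. (Z has_vector_derivative (A t o\<^sub>L Z t)) (at t within {0..}))"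

abbreviation X where "X \<equiv> fundamental_solution A"

text \<open>
  For \<open>B = 0\<close> this is uniqueness for \<open>Z' = A Z\<close>. For \<open>B = A\<close> it shows below that a product \<open>X Y\<close> of a
  solution and a candidate for its inverse is constant, because both \<open>X Y\<close> and the identity
  solve \<open>Z' = A Z - Z A\<close>.
\<close>

lemma sylvester_solution_unique:
  fixes B :: "real \<Rightarrow> ('a \<Rightarrow>\<^sub>L 'a)"
  assumes B: "\<And>t. 0 \<le> t \<Longrightarrow> norm (B t) \<le> b"
    and Z: "\<And>t. 0 \<le> t \<Longrightarrow> (Z has_vector_derivative (A t o\<^sub>L Z t) - (Z t o\<^sub>L B t)) (at t within {0..})"
    and Z': "\<And>t. 0 \<le> t \<Longrightarrow> (Z' has_vector_derivative (A t o\<^sub>L Z' t) - (Z' t o\<^sub>L B t)) (at t within {0..})"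
    and "Z 0 = Z' 0" "0 \<le> t"
  shows "Z t = Z' t"
proof -
  define D where "D t = Z t - Z' t" for t
  have "0 \<le> b" using B[of 0] norm_ge_zero[of "B 0"] by linarith
  have "norm (D t) \<le> 2 * exp (2 * (a + b) * t) * (norm (D 0) + 0 * t)"
  proof (rule linear_growth_bound)
    fix s assume s: "s \<in> {0..t}"
    show "(D has_vector_derivative (A s o\<^sub>L D s) - (D s o\<^sub>L B s)) (at s within {0..t})"
      unfolding D_def
      by (rule has_vector_derivative_Icc_subset,
          rule has_vector_derivative_eq_rhs[OF has_vector_derivative_diff[OF Z Z']])
        (use s in \<open>auto simp: blinfun_compose_bilinear\<close>)
    have "norm (A s o\<^sub>L D s) \<le> a * norm (D s)"
      using norm_path_le s by (intro norm_blinfun_compose_le) auto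
    moreover have "norm (D s o\<^sub>L B s) \<le> norm (D s) * b"
      using B s by (intro norm_blinfun_compose_le) auto
    ultimately show "norm ((A s o\<^sub>L D s) - (D s o\<^sub>L B s)) \<le> (a + b) * norm (D s) + 0"
      using norm_triangle_ineq4[of "A s o\<^sub>L D s" "D s o\<^sub>L B s"] by (simp add: algebra_simps)
  qed (use bound_pos \<open>0 \<le> b\<close> \<open>0 \<le> t\<close> in auto)
  then show ?thesis using \<open>Z 0 = Z' 0\<close> by (simp add: D_def)
qed

lemma solution_unique:
  assumes "solution Z" "solution Z'" "Z 0 = Z' 0" "0 \<le> t"
  shows "Z t = Z' t"
  using sylvester_solution_unique[of "\<lambda>_. 0" 0 Z Z' t] assms
  by (simp add: solution_def blinfun_compose_bilinear)

lemma fundamental_solution: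
  shows X_0: "X 0 = id_blinfun" and solution_X: "solution X"
proof -
  interpret comp: bounded_bilinear "(o\<^sub>L) :: ('a \<Rightarrow>\<^sub>L 'a) \<Rightarrow> ('a \<Rightarrow>\<^sub>L 'a) \<Rightarrow> ('a \<Rightarrow>\<^sub>L 'a)"
    by (rule bounded_bilinear_blinfun_compose)
  define F where "F t = comp.prod_right (A t)" for t
  have "continuous_on {0..} F"
    unfolding F_def by (intro bounded_linear.continuous_on[OF comp.bounded_linear_prod_right] continuous_path)
  moreover have "norm (F t) \<le> a" if "0 \<le> t" for t
  proof (rule norm_blinfun_bound)
    fix B
    show "norm (F t B) \<le> a * norm B"
      unfolding F_def comp.prod_right.rep_eq
      using norm_path_le[OF that] by (intro norm_blinfun_compose_le) auto
  qed (use bound_pos in simp)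
  ultimately obtain Z where "Z 0 = id_blinfun"
    "\<forall>t\<ge>0. (Z has_vector_derivative F t (Z t)) (at t within {0..})"
    using linear_ode_solution[of F a id_blinfun] bound_pos by blast
  then have "\<exists>Z. Z 0 = id_blinfun \<and>
    (\<forall>t\<ge>0. (Z has_vector_derivative (A t o\<^sub>L Z t)) (at t within {0..}))"
    by (auto simp: F_def comp.prod_right.rep_eq)
  from someI_ex[OF this] show "X 0 = id_blinfun" "solution X"
    by (auto simp: fundamental_solution_def solution_def)
qed

lemma fundamental_solution_unique:
  assumes "solution Z" "Z 0 = id_blinfun" "0 \<le> t"
  shows "X t = Z t"
  using solution_unique[OF solution_X assms(1)] assms X_0 by simp

lemma solution_compose_right:
  assumes "solution Z" shows "solution (\<lambda>t. Z t o\<^sub>L B)"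
  unfolding solution_def
proof (intro allI impI)
  fix t :: real assume t: "0 \<le> t"
  have "((\<lambda>t. Z t o\<^sub>L B) has_vector_derivative ((A t o\<^sub>L Z t) o\<^sub>L B)) (at t within {0..})"
    using assms t unfolding solution_def
    by (intro bounded_linear.has_vector_derivative[OF bounded_linear_compose_left]) auto
  then show "((\<lambda>t. Z t o\<^sub>L B) has_vector_derivative A t o\<^sub>L (Z t o\<^sub>L B)) (at t within {0..})"
    by (simp add: blinfun_compose_assoc)
qed

text \<open>
  Both sides solve \<open>Z' = A Z\<close> with \<open>Z 0 = B\<close>.
\<close>

lemma fundamental_solution_commute:
  assumes "\<And>t. 0 \<le> t \<Longrightarrow> A t o\<^sub>L B = B o\<^sub>L A t" "0 \<le> t"
  shows "X t o\<^sub>L B = B o\<^sub>L X t"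
proof (rule solution_unique[OF solution_compose_right[OF solution_X] _ _ \<open>0 \<le> t\<close>])
  show "solution (\<lambda>t. B o\<^sub>L X t)"
    unfolding solution_def
  proof (intro allI impI)
    fix t :: real assume t: "0 \<le> t"
    have "((\<lambda>t. B o\<^sub>L X t) has_vector_derivative (B o\<^sub>L (A t o\<^sub>L X t))) (at t within {0..})"
      using solution_X t unfolding solution_def
      by (intro bounded_linear.has_vector_derivative[OF bounded_linear_compose_right]) auto
    then show "((\<lambda>t. B o\<^sub>L X t) has_vector_derivative A t o\<^sub>L (B o\<^sub>L X t)) (at t within {0..})"
      by (simp add: assms(1)[OF t] blinfun_compose_assoc[symmetric])
  qed
qed (simp add: X_0)

text \<open>
  The inverse of \<open>X t\<close>, obtained as the solution of the equation that an inverse has to satisfy.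
\<close>

definition Y :: "real \<Rightarrow> ('a \<Rightarrow>\<^sub>L 'a)"
  where "Y = (SOME Y. Y 0 = id_blinfun \<and>
    (\<forall>t\<ge>0. (Y has_vector_derivative - (Y t o\<^sub>L A t)) (at t within {0..})))"

lemma Y_0: "Y 0 = id_blinfun"
  and Y_derivative: "0 \<le> t \<Longrightarrow> (Y has_vector_derivative - (Y t o\<^sub>L A t)) (at t within {0..})"
proof -
  interpret comp: bounded_bilinear "(o\<^sub>L) :: ('a \<Rightarrow>\<^sub>L 'a) \<Rightarrow> ('a \<Rightarrow>\<^sub>L 'a) \<Rightarrow> ('a \<Rightarrow>\<^sub>L 'a)"
    by (rule bounded_bilinear_blinfun_compose)
  define F where "F t = - comp.prod_left (A t)" for t
  have "continuous_on {0..} F"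
    unfolding F_def by (intro continuous_intros bounded_linear.continuous_on[OF comp.bounded_linear_prod_left] continuous_path)
  moreover have "norm (F t) \<le> a" if "0 \<le> t" for t
    unfolding F_def norm_minus_cancel
  proof (rule norm_blinfun_bound)
    fix B
    show "norm (comp.prod_left (A t) B) \<le> a * norm B"
      unfolding comp.prod_left.rep_eq
      using norm_blinfun_compose_le[OF order_refl norm_path_le[OF that], of B] by (simp add: mult.commute)
  qed (use bound_pos in simp)
  ultimately obtain Z where "Z 0 = id_blinfun"
    "\<forall>t\<ge>0. (Z has_vector_derivative F t (Z t)) (at t within {0..})"
    using linear_ode_solution[of F a id_blinfun] bound_pos by blast
  then have "\<exists>Z. Z 0 = id_blinfun \<and>
    (\<forall>t\<ge>0. (Z has_vector_derivative - (Z t o\<^sub>L A t)) (at t within {0..}))"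
    by (auto simp: F_def comp.prod_left.rep_eq blinfun.minus_left)
  from someI_ex[OF this] show "Y 0 = id_blinfun"
    and "0 \<le> t \<Longrightarrow> (Y has_vector_derivative - (Y t o\<^sub>L A t)) (at t within {0..})"
    by (auto simp: Y_def)
qed

lemma Y_X: assumes "0 \<le> t" shows "Y t o\<^sub>L X t = id_blinfun"
proof -
  have "(\<lambda>t. Y t o\<^sub>L X t) t = (\<lambda>t. Y t o\<^sub>L X t) 0"
  proof (rule has_vector_derivative_zero_constant[of "{0..t}", THEN exE])
    fix s assume "s \<in> {0..t}"
    then have "((\<lambda>t. Y t o\<^sub>L X t) has_vector_derivative
      (Y s o\<^sub>L (A s o\<^sub>L X s)) + (- (Y s o\<^sub>L A s) o\<^sub>L X s)) (at s within {0..})"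
      using solution_X Y_derivative unfolding solution_def
      by (intro bounded_bilinear.has_vector_derivative[OF bounded_bilinear_blinfun_compose]) auto
    then show "((\<lambda>t. Y t o\<^sub>L X t) has_vector_derivative 0) (at s within {0..t})"
      by (intro has_vector_derivative_Icc_subset) (simp add: blinfun_compose_bilinear blinfun_compose_assoc)
  qed (use assms in auto)
  then show ?thesis using X_0 Y_0 by simp
qed

lemma X_Y: assumes "0 \<le> t" shows "X t o\<^sub>L Y t = id_blinfun"
proof -
  have "(\<lambda>t. X t o\<^sub>L Y t) t = (\<lambda>_. id_blinfun) t"
  proof (rule sylvester_solution_unique[of A a])
    fix s :: real assume "0 \<le> s"
    then have "((\<lambda>t. X t o\<^sub>L Y t) has_vector_derivative
      (X s o\<^sub>L - (Y s o\<^sub>L A s)) + ((A s o\<^sub>L X s) o\<^sub>L Y s)) (at s within {0..})"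
      using solution_X Y_derivative unfolding solution_def
      by (intro bounded_bilinear.has_vector_derivative[OF bounded_bilinear_blinfun_compose]) auto
    then show "((\<lambda>t. X t o\<^sub>L Y t) has_vector_derivative
      (A s o\<^sub>L (X s o\<^sub>L Y s)) - ((X s o\<^sub>L Y s) o\<^sub>L A s)) (at s within {0..})"
      by (simp add: blinfun_compose_bilinear blinfun_compose_assoc)
  qed (use assms X_0 Y_0 norm_path_le in auto)
  then show ?thesis by simp
qed

lemma X_apply_Y [simp]: "0 \<le> t \<Longrightarrow> X t (Y t x) = x"
  and Y_apply_X [simp]: "0 \<le> t \<Longrightarrow> Y t (X t x) = x"
  using X_Y Y_X by (metis blinfun_apply_blinfun_compose blinfun_apply_id_blinfun)+

lemma transition_derivative:
  assumes "0 \<le> s" "0 \<le> r"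
  shows "((\<lambda>r. X (s + r) o\<^sub>L Y s) has_vector_derivative (A (s + r) o\<^sub>L (X (s + r) o\<^sub>L Y s))) (at r within {0..})"
proof -
  have "(X has_vector_derivative (A (s + r) o\<^sub>L X (s + r))) (at (s + r) within {0..})"
    using solution_X assms by (simp add: solution_def)
  then have "(X has_vector_derivative (A (s + r) o\<^sub>L X (s + r))) (at (s + r) within (\<lambda>r. s + r) ` {0..})"
    by (rule has_vector_derivative_within_subset) (use assms in auto)
  then have "(X \<circ> (\<lambda>r. s + r) has_vector_derivative 1 *\<^sub>R (A (s + r) o\<^sub>L X (s + r))) (at r within {0..})"
    by (intro vector_diff_chain_within) (auto intro!: derivative_eq_intros)
  then have "((\<lambda>r. X (s + r)) has_vector_derivative (A (s + r) o\<^sub>L X (s + r))) (at r within {0..})"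
    by (simp add: o_def)
  then have "((\<lambda>r. X (s + r) o\<^sub>L Y s) has_vector_derivative ((A (s + r) o\<^sub>L X (s + r)) o\<^sub>L Y s)) (at r within {0..})"
    by (rule bounded_linear.has_vector_derivative[OF bounded_linear_compose_left])
  then show ?thesis by (simp add: blinfun_compose_assoc)
qed

lemma norm_transition_le:
  assumes "0 \<le> s" "s \<le> t"
  shows "norm (X t o\<^sub>L Y s) \<le> 2 * exp (2 * a * (t - s))"
proof -
  define Z where "Z r = X (s + r) o\<^sub>L Y s" for r
  have "norm (Z (t - s)) \<le> 2 * exp (2 * a * (t - s)) * (norm (Z 0) + 0 * (t - s))"
  proof (rule linear_growth_bound)
    fix r assume r: "r \<in> {0..t - s}"
    show "(Z has_vector_derivative (A (s + r) o\<^sub>L Z r)) (at r within {0..t - s})"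
      using has_vector_derivative_Icc_subset[OF transition_derivative] r assms
      by (simp add: Z_def[abs_def])
    show "norm (A (s + r) o\<^sub>L Z r) \<le> a * norm (Z r) + 0"
      using norm_path_le[of "s + r"] r assms norm_blinfun_compose_le[of "A (s + r)" a "Z r"] by simp
  qed (use bound_pos assms in auto)
  also have "\<dots> \<le> 2 * exp (2 * a * (t - s)) * 1"
    using X_Y[OF assms(1)] norm_blinfun_id_le by (intro mult_left_mono) (auto simp: Z_def)
  finally show ?thesis by (simp add: Z_def)
qed

lemma norm_X_le: "0 \<le> t \<Longrightarrow> norm (X t) \<le> 2 * exp (2 * a * t)"
  using norm_transition_le[of 0 t] Y_0 by simp

lemma norm_Y_le:
  assumes "0 \<le> t" shows "norm (Y t) \<le> 2 * exp (2 * a * t)"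
proof -
  have "norm (Y t) \<le> 2 * exp (2 * a * t) * (norm (Y 0) + 0 * t)"
  proof (rule linear_growth_bound)
    fix r assume r: "r \<in> {0..t}"
    show "(Y has_vector_derivative - (Y r o\<^sub>L A r)) (at r within {0..t})"
      using has_vector_derivative_Icc_subset[OF Y_derivative] r by simp
    show "norm (- (Y r o\<^sub>L A r)) \<le> a * norm (Y r) + 0"
      using norm_blinfun_compose_le[OF order_refl norm_path_le, of r "Y r"] r by (simp add: mult.commute)
  qed (use bound_pos assms in auto)
  also have "\<dots> \<le> 2 * exp (2 * a * t) * 1"
    unfolding Y_0 using norm_blinfun_id_le by (intro mult_left_mono) auto
  finally show ?thesis by simp
qed

end

section \<open>Operator valued contour integrals\<close>

lemma bounded_linear_cmul: "bounded_linear (cmul J)"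
  unfolding cmul_def[abs_def]
  by (intro bounded_linear_add bounded_linear_scaleR_left[THEN bounded_linear_compose]
      bounded_linear_Re bounded_linear_Im)

lemmas cmul_linear =
  linear_add[OF bounded_linear.linear[OF bounded_linear_cmul]]
  linear_diff[OF bounded_linear.linear[OF bounded_linear_cmul]]
  linear_neg[OF bounded_linear.linear[OF bounded_linear_cmul]]
  linear_0[OF bounded_linear.linear[OF bounded_linear_cmul]]

lemma cmul_1 [simp]: "cmul J 1 = id_blinfun"
  by (simp add: cmul_def)

lemma norm_cmul_le: "norm (cmul J z) \<le> (1 + norm J) * norm z"
proof -
  have "norm (cmul J z) \<le> \<bar>Re z\<bar> * 1 + \<bar>Im z\<bar> * norm J"
    unfolding cmul_def
    by (rule norm_triangle_le, intro add_mono) (auto intro: mult_left_le norm_blinfun_id_le)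
  also have "\<dots> \<le> norm z * 1 + norm z * norm J"
    using abs_Re_le_cmod[of z] abs_Im_le_cmod[of z] by (intro add_mono mult_right_mono) auto
  finally show ?thesis by (simp add: algebra_simps)
qed

lemma continuous_on_cmul [continuous_intros]:
  "continuous_on S f \<Longrightarrow> continuous_on S (\<lambda>x. cmul J (f x))"
  by (rule bounded_linear.continuous_on[OF bounded_linear_cmul])

lemma cmul_commute:
  assumes "B o\<^sub>L J = J o\<^sub>L B" shows "B o\<^sub>L cmul J z = cmul J z o\<^sub>L B"
  using assms by (simp add: cmul_def blinfun_compose_bilinear)

text \<open>
  Contours are lists of directed edges, so that statements about them are proved by induction
  and the values of a primitive at the vertices telescope.
\<close>

definition segment_integral :: "('e::banach \<Rightarrow>\<^sub>L 'e) \<Rightarrow> (complex \<Rightarrow> ('e \<Rightarrow>\<^sub>L 'e)) \<Rightarrow> complex \<times> complex \<Rightarrow> ('e \<Rightarrow>\<^sub>L 'e)"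
  where "segment_integral J f = (\<lambda>(a, b). integral {0..1} (\<lambda>s. cmul J (b - a) o\<^sub>L f (linepath a b s)))"

definition chain_integral :: "('e::banach \<Rightarrow>\<^sub>L 'e) \<Rightarrow> (complex \<Rightarrow> ('e \<Rightarrow>\<^sub>L 'e)) \<Rightarrow> (complex \<times> complex) list \<Rightarrow> ('e \<Rightarrow>\<^sub>L 'e)"
  where "chain_integral J f C = (\<Sum>e\<leftarrow>C. segment_integral J f e)"

definition chain_support :: "(complex \<times> complex) list \<Rightarrow> complex set"
  where "chain_support C = (\<Union>(a, b)\<in>set C. closed_segment a b)"

lemma chain_simps [simp]:
  "chain_integral J f [] = 0"
  "chain_integral J f (e # C) = segment_integral J f e + chain_integral J f C"
  "chain_support [] = {}"
  "chain_support (e # C) = closed_segment (fst e) (snd e) \<union> chain_support C"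
  by (auto simp: chain_integral_def chain_support_def split: prod.splits)

lemma compact_chain_support: "compact (chain_support C)"
  by (induction C) auto

lemma continuous_on_segment_integrand:
  assumes "continuous_on (closed_segment a b) f"
  shows "continuous_on {0..1} (\<lambda>s. cmul J (b - a) o\<^sub>L f (linepath a b s))"
  by (intro continuous_intros continuous_on_compose2[OF assms])
    (auto simp: linepath_in_path)

lemma segment_integrable:
  assumes "continuous_on (closed_segment a b) f"
  shows "(\<lambda>s. cmul J (b - a) o\<^sub>L f (linepath a b s)) integrable_on {0..1}"
  by (intro integrable_continuous_real continuous_on_segment_integrand assms)

lemma chain_integral_add:
  assumes "continuous_on (chain_support C) f" "continuous_on (chain_support C) g"
  shows "chain_integral J (\<lambda>z. f z + g z) C = chain_integral J f C + chain_integral J g C"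
  using assms
proof (induction C)
  case (Cons e C)
  obtain a b where e: "e = (a, b)" by force
  have "continuous_on (closed_segment a b) f" "continuous_on (closed_segment a b) g"
    using Cons.prems by (auto simp: e elim: continuous_on_subset)
  then have "segment_integral J (\<lambda>z. f z + g z) e = segment_integral J f e + segment_integral J g e"
    by (simp add: segment_integral_def e blinfun_compose_bilinear
        Henstock_Kurzweil_Integration.integral_add segment_integrable)
  moreover have "continuous_on (chain_support C) f" "continuous_on (chain_support C) g"
    using Cons.prems by (auto elim: continuous_on_subset)
  ultimately show ?case using Cons.IH by simp
qed simp

text \<open>
  The maps in question are left and right composition, negation and real multiples.
\<close>

lemma chain_integral_linear:
  assumes "bounded_linear h" "\<And>z B. h (cmul J z o\<^sub>L B) = cmul J z o\<^sub>L h B"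
    and "continuous_on (chain_support C) f"
  shows "chain_integral J (\<lambda>z. h (f z)) C = h (chain_integral J f C)"
  using assms(3)
proof (induction C)
  case Nil
  then show ?case using assms(1) by (simp add: linear_0 bounded_linear.linear)
next
  case (Cons e C)
  obtain a b where e: "e = (a, b)" by force
  have c: "continuous_on (closed_segment a b) f" "continuous_on (chain_support C) f"
    using Cons.prems by (auto simp: e elim: continuous_on_subset)
  have "segment_integral J (\<lambda>z. h (f z)) e = h (segment_integral J f e)"
    using integral_linear[OF segment_integrable[OF c(1)] assms(1)]
    by (simp add: segment_integral_def e o_def assms(2)[symmetric])
  then show ?case using Cons.IH[OF c(2)] assms(1) by (simp add: linear_add bounded_linear.linear)
qed

lemma chain_integral_compose_right:
  assumes "continuous_on (chain_support C) f"
  shows "chain_integral J (\<lambda>z. f z o\<^sub>L B) C = chain_integral J f C o\<^sub>L B"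
  by (rule chain_integral_linear[OF bounded_linear_compose_left _ assms])
    (simp add: blinfun_compose_assoc)

lemma chain_integral_compose_left:
  assumes "continuous_on (chain_support C) f" "B o\<^sub>L J = J o\<^sub>L B"
  shows "chain_integral J (\<lambda>z. B o\<^sub>L f z) C = B o\<^sub>L chain_integral J f C"
  by (rule chain_integral_linear[OF bounded_linear_compose_right _ assms(1)])
    (metis blinfun_compose_assoc cmul_commute[OF assms(2)])

lemma chain_integral_cong:
  assumes "\<And>z. z \<in> chain_support C \<Longrightarrow> f z = g z"
  shows "chain_integral J f C = chain_integral J g C"
  using assms
proof (induction C)
  case (Cons e C)
  obtain a b where e: "e = (a, b)" by force
  have "segment_integral J f e = segment_integral J g e"
    unfolding segment_integral_def e prod.case
    by (rule Henstock_Kurzweil_Integration.integral_cong) (use Cons.prems in \<open>auto simp: e linepath_in_path\<close>)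
  then show ?case using Cons by simp
qed simp

definition chain_length :: "(complex \<times> complex) list \<Rightarrow> real"
  where "chain_length C = (\<Sum>(a, b)\<leftarrow>C. norm (b - a))"

lemma chain_length_nonneg: "0 \<le> chain_length C"
  by (auto simp: chain_length_def intro!: sum_list_nonneg)

lemma norm_chain_integral_le:
  assumes "continuous_on (chain_support C) f" "\<And>z. z \<in> chain_support C \<Longrightarrow> norm (f z) \<le> M"
  shows "norm (chain_integral J f C) \<le> (1 + norm J) * M * chain_length C"
  using assms
proof (induction C)
  case (Cons e C)
  obtain a b where e: "e = (a, b)" by force
  have c: "continuous_on (closed_segment a b) f" "continuous_on (chain_support C) f"
    using Cons.prems by (auto simp: e elim: continuous_on_subset)
  have "norm (segment_integral J f e) \<le> (1 + norm J) * norm (b - a) * M * (1 - 0)"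
    unfolding segment_integral_def e prod.case
  proof (rule integral_bound[OF _ continuous_on_segment_integrand[OF c(1)]])
    fix s :: real assume "s \<in> {0..1}"
    then show "norm (cmul J (b - a) o\<^sub>L f (linepath a b s)) \<le> (1 + norm J) * norm (b - a) * M"
      using Cons.prems(2) by (intro norm_blinfun_compose_le norm_cmul_le) (auto simp: e linepath_in_path)
  qed simp
  moreover have "norm (chain_integral J f C) \<le> (1 + norm J) * M * chain_length C"
    using Cons.IH[OF c(2)] Cons.prems(2) by simp
  ultimately have "norm (chain_integral J f (e # C)) \<le>
      (1 + norm J) * norm (b - a) * M + (1 + norm J) * M * chain_length C"
    unfolding chain_simps by (intro norm_triangle_le) simp
  then show ?case by (simp add: chain_length_def e algebra_simps)
qed (simp add: chain_length_def)

text \<open>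
  Complex differentiability where \<open>\<i>\<close> acts as \<open>J\<close>: the derivative acts on increments through \<open>cmul J\<close>.
\<close>

definition has_cderivative ::
    "('e::banach \<Rightarrow>\<^sub>L 'e) \<Rightarrow> (complex \<Rightarrow> ('e \<Rightarrow>\<^sub>L 'e)) \<Rightarrow> ('e \<Rightarrow>\<^sub>L 'e) \<Rightarrow> complex \<Rightarrow> complex set \<Rightarrow> bool"
  where "has_cderivative J F D z S \<longleftrightarrow> (F has_derivative (\<lambda>h. cmul J h o\<^sub>L D)) (at z within S)"

lemma has_cderivative_subset:
  "has_cderivative J F D z S \<Longrightarrow> S' \<subseteq> S \<Longrightarrow> has_cderivative J F D z S'"
  unfolding has_cderivative_def by (rule has_derivative_subset)

lemma segment_integral_derivative:
  assumes "\<And>z. z \<in> closed_segment a b \<Longrightarrow> has_cderivative J F (f z) z (closed_segment a b)"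
  shows "segment_integral J f (a, b) = F b - F a"
proof -
  have "((\<lambda>s. cmul J (b - a) o\<^sub>L f (linepath a b s)) has_integral
      (F \<circ> linepath a b) 1 - (F \<circ> linepath a b) 0) {0..1}"
  proof (rule fundamental_theorem_of_calculus)
    fix s :: real assume s: "s \<in> {0..1}"
    show "((F \<circ> linepath a b) has_vector_derivative cmul J (b - a) o\<^sub>L f (linepath a b s)) (at s within {0..1})"
      by (rule vector_derivative_diff_chain_within[OF has_vector_derivative_linepath_within])
        (use assms[of "linepath a b s"] s in
          \<open>auto simp: has_cderivative_def linepath_image_01 linepath_in_path\<close>)
  qed simp
  then show ?thesis by (auto simp: segment_integral_def linepath_def dest: integral_unique)
qed

lemma chain_integral_derivative:
  assumes "\<And>z. z \<in> chain_support C \<Longrightarrow> has_cderivative J F (f z) z (chain_support C)"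
  shows "chain_integral J f C = (\<Sum>(a, b)\<leftarrow>C. F b - F a)"
  using assms
proof (induction C)
  case (Cons e C)
  obtain a b where e: "e = (a, b)" by force
  have "segment_integral J f e = F b - F a"
    unfolding e
    by (rule segment_integral_derivative, rule has_cderivative_subset[OF Cons.prems]) (auto simp: e)
  moreover have "chain_integral J f C = (\<Sum>(a, b)\<leftarrow>C. F b - F a)"
    by (rule Cons.IH, rule has_cderivative_subset[OF Cons.prems]) auto
  ultimately show ?case by (simp add: e)
qed simp

lemma segment_integral_reverse:
  assumes "continuous_on (closed_segment a b) f"
  shows "segment_integral J f (b, a) = - segment_integral J f (a, b)"
proof -
  define I where "I = segment_integral J f (a, b)"
  have "((\<lambda>s. cmul J (b - a) o\<^sub>L f (linepath a b s)) has_integral I) (cbox 0 1)"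
    using segment_integrable[OF assms, of J] by (auto simp: I_def segment_integral_def)
  from has_integral_affinity[OF this, of "-1" 1]
  have "((\<lambda>s. cmul J (b - a) o\<^sub>L f (linepath a b (1 - s))) has_integral I) ((\<lambda>s. 1 - s) ` {0..1})"
    by (simp add: add.commute)
  moreover have "(\<lambda>s. 1 - s) ` {0..1} = {0..1::real}"
    using image_diff_atLeastAtMost[of "1::real" 0 1] by simp
  moreover have "linepath a b (1 - s) = linepath b a s" for s
    by (simp add: linepath_def)
  ultimately have "((\<lambda>s. cmul J (b - a) o\<^sub>L f (linepath b a s)) has_integral I) {0..1}" by simp
  then have "((\<lambda>s. - (cmul J (b - a) o\<^sub>L f (linepath b a s))) has_integral - I) {0..1}"
    by (rule has_integral_neg)
  moreover have "- (cmul J (b - a) o\<^sub>L f (linepath b a s)) = cmul J (a - b) o\<^sub>L f (linepath b a s)" for s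
    by (simp add: cmul_linear blinfun_compose_bilinear)
  ultimately have "((\<lambda>s. cmul J (a - b) o\<^sub>L f (linepath b a s)) has_integral - I) {0..1}" by (simp only:)
  then have "integral {0..1} (\<lambda>s. cmul J (a - b) o\<^sub>L f (linepath b a s)) = - I"
    by (rule integral_unique)
  then show ?thesis unfolding I_def[symmetric] by (simp add: segment_integral_def)
qed

lemma chain_integral_has_vector_derivative:
  assumes "\<And>t z. t \<in> U \<Longrightarrow> z \<in> chain_support C \<Longrightarrow>
      ((\<lambda>t. f t z) has_vector_derivative f' t z) (at t within U)"
    and "\<And>t. t \<in> U \<Longrightarrow> continuous_on (chain_support C) (f t)"
    and "continuous_on (U \<times> chain_support C) (\<lambda>(t, z). f' t z)"
    and "convex U" "t \<in> U"
  shows "((\<lambda>t. chain_integral J (f t) C) has_vector_derivative chain_integral J (f' t) C) (at t within U)"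
  using assms(1-3)
proof (induction C)
  case (Cons e C)
  obtain a b where e: "e = (a, b)" by force
  have "((\<lambda>t. integral (cbox 0 1) (\<lambda>s. cmul J (b - a) o\<^sub>L f t (linepath a b s)))
    has_vector_derivative integral (cbox 0 1) (\<lambda>s. cmul J (b - a) o\<^sub>L f' t (linepath a b s))) (at t within U)"
  proof (rule leibniz_rule_vector_derivative[OF _ _ _ \<open>t \<in> U\<close> \<open>convex U\<close>])
    fix t and s :: real assume ts: "t \<in> U" "s \<in> cbox 0 1"
    show "((\<lambda>t. cmul J (b - a) o\<^sub>L f t (linepath a b s)) has_vector_derivative
      cmul J (b - a) o\<^sub>L f' t (linepath a b s)) (at t within U)"
      using Cons.prems(1)[OF ts(1), of "linepath a b s"] ts(2)
      by (intro bounded_linear.has_vector_derivative[OF bounded_linear_compose_right])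
        (auto simp: e linepath_in_path)
  next
    fix t assume "t \<in> U"
    then have "continuous_on (closed_segment a b) (f t)"
      by (intro continuous_on_subset[OF Cons.prems(2)]) (auto simp: e)
    then show "(\<lambda>s. cmul J (b - a) o\<^sub>L f t (linepath a b s)) integrable_on cbox 0 1"
      using segment_integrable by simp
  next
    have "continuous_on (U \<times> cbox 0 1) (\<lambda>x. (\<lambda>(t, z). f' t z) (fst x, linepath a b (snd x)))"
    proof (rule continuous_on_compose2[OF Cons.prems(3)])
      show "continuous_on (U \<times> cbox 0 1) (\<lambda>x. (fst x, linepath a b (snd x)))"
        unfolding linepath_def by (intro continuous_intros)
    qed (auto simp: e linepath_in_path)
    then show "continuous_on (U \<times> cbox 0 1) (\<lambda>(t, s). cmul J (b - a) o\<^sub>L f' t (linepath a b s))"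
      by (auto intro!: continuous_intros simp: split_beta)
  qed
  then have "((\<lambda>t. segment_integral J (f t) e) has_vector_derivative segment_integral J (f' t) e) (at t within U)"
    by (simp add: segment_integral_def e)
  moreover have "((\<lambda>t. chain_integral J (f t) C) has_vector_derivative chain_integral J (f' t) C) (at t within U)"
    by (rule Cons.IH) (use Cons.prems(1) in \<open>auto intro!: continuous_on_subset[OF Cons.prems(2)]
        continuous_on_subset[OF Cons.prems(3)]\<close>)
  ultimately show ?case
    unfolding chain_simps by (rule has_vector_derivative_add)
qed simp

subsection \<open>Rectangles\<close>

text \<open>
  The derivative \<open>D\<close> is required off a finite set only, so that the corners of a joined path and
  the value of \<^const>\<open>vector_derivative\<close> there do not matter.
\<close>

definition has_path_integral ::
    "('e::banach \<Rightarrow>\<^sub>L 'e) \<Rightarrow> (complex \<Rightarrow> ('e \<Rightarrow>\<^sub>L 'e)) \<Rightarrow> (real \<Rightarrow> complex) \<Rightarrow> ('e \<Rightarrow>\<^sub>L 'e) \<Rightarrow> bool"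
  where "has_path_integral J f \<gamma> I \<longleftrightarrow> (\<exists>D S. finite S \<and>
    (\<forall>t\<in>{0<..<1} - S. (\<gamma> has_vector_derivative D t) (at t)) \<and>
    ((\<lambda>t. cmul J (D t) o\<^sub>L f (\<gamma> t)) has_integral I) {0..1})"

lemma has_path_integral_unique:
  assumes "has_path_integral J f \<gamma> I"
  shows "integral {0..1} (\<lambda>t. cmul J (vector_derivative \<gamma> (at t within {0..1})) o\<^sub>L f (\<gamma> t)) = I"
proof -
  obtain D S where DS: "finite S" "\<And>t. t \<in> {0<..<1} - S \<Longrightarrow> (\<gamma> has_vector_derivative D t) (at t)"
    "((\<lambda>t. cmul J (D t) o\<^sub>L f (\<gamma> t)) has_integral I) {0..1}"
    using assms unfolding has_path_integral_def by blast
  have "vector_derivative \<gamma> (at t within {0..1}) = D t" if "t \<in> {0..1} - (S \<union> {0, 1})" for t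
    using that DS(2)[of t] by (intro vector_derivative_at_within_ivl) auto
  then have "((\<lambda>t. cmul J (vector_derivative \<gamma> (at t within {0..1})) o\<^sub>L f (\<gamma> t)) has_integral I) {0..1}"
    using has_integral_spike_finite[OF _ _ DS(3), of "S \<union> {0, 1}"] DS(1) by simp
  then show ?thesis by (rule integral_unique)
qed

lemma has_path_integral_linepath:
  assumes "continuous_on (closed_segment a b) f"
  shows "has_path_integral J f (linepath a b) (segment_integral J f (a, b))"
  unfolding has_path_integral_def
proof (intro exI conjI ballI)
  show "((\<lambda>t. cmul J (b - a) o\<^sub>L f (linepath a b t)) has_integral segment_integral J f (a, b)) {0..1}"
    using segment_integrable[OF assms, of J] by (auto simp: segment_integral_def)
  show "(linepath a b has_vector_derivative b - a) (at t)" for t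
    by (rule has_vector_derivative_linepath_within)
qed (rule finite.emptyI)

text \<open>
  Each half of \<open>[0, 1]\<close> carries one of the paths at double speed; \<open>1 / 2\<close> joins the exceptional set.
\<close>

lemma has_path_integral_join:
  assumes "has_path_integral J f \<gamma>1 I1" "has_path_integral J f \<gamma>2 I2"
    "pathfinish \<gamma>1 = pathstart \<gamma>2"
  shows "has_path_integral J f (\<gamma>1 +++ \<gamma>2) (I1 + I2)"
proof -
  obtain D1 S1 where 1: "finite S1" "\<And>t. t \<in> {0<..<1} - S1 \<Longrightarrow> (\<gamma>1 has_vector_derivative D1 t) (at t)"
    "((\<lambda>t. cmul J (D1 t) o\<^sub>L f (\<gamma>1 t)) has_integral I1) {0..1}"
    using assms(1) unfolding has_path_integral_def by blast
  obtain D2 S2 where 2: "finite S2" "\<And>t. t \<in> {0<..<1} - S2 \<Longrightarrow> (\<gamma>2 has_vector_derivative D2 t) (at t)"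
    "((\<lambda>t. cmul J (D2 t) o\<^sub>L f (\<gamma>2 t)) has_integral I2) {0..1}"
    using assms(2) unfolding has_path_integral_def by blast
  define \<gamma> where "\<gamma> = \<gamma>1 +++ \<gamma>2"
  define D where "D t = (if t \<le> 1 / 2 then 2 * D1 (2 * t) else 2 * D2 (2 * t - 1))" for t
  define S where "S = insert (1 / 2) ((\<lambda>t. t / 2) ` S1 \<union> (\<lambda>t. (t + 1) / 2) ` S2)"
  have sc: "cmul J (2 * z) = 2 *\<^sub>R cmul J z" for z
    by (simp add: cmul_def scaleR_add_right)
  have "finite S" using 1(1) 2(1) by (simp add: S_def)
  moreover have "(\<gamma> has_vector_derivative D t) (at t)" if t: "t \<in> {0<..<1} - S" for t
  proof (cases "t < 1 / 2")
    case True
    have "2 * t \<notin> S1" using t image_eqI[of t "\<lambda>t. t / 2" "2 * t" S1] by (auto simp: S_def)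
    then have "(\<gamma>1 has_vector_derivative D1 (2 * t)) (at (2 * t))" using 1(2) True t by auto
    then have "((\<gamma>1 \<circ> (\<lambda>t. 2 * t)) has_vector_derivative 2 *\<^sub>R D1 (2 * t)) (at t)"
      by (intro vector_diff_chain_at) (auto intro!: derivative_eq_intros)
    then have "(\<gamma> has_vector_derivative 2 *\<^sub>R D1 (2 * t)) (at t)"
      by (rule has_vector_derivative_transform_within_open[of _ _ _ "{..<1/2}"])
        (use True in \<open>auto simp: \<gamma>_def joinpaths_def\<close>)
    then show ?thesis using True by (simp add: D_def scaleR_conv_of_real)
  next
    case False
    then have h: "1 / 2 < t" using t by (auto simp: S_def)
    have "2 * t - 1 \<notin> S2"
      using t image_eqI[of t "\<lambda>t. (t + 1) / 2" "2 * t - 1" S2] by (auto simp: S_def)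
    then have "(\<gamma>2 has_vector_derivative D2 (2 * t - 1)) (at (2 * t - 1))" using 2(2) h t by auto
    then have "((\<gamma>2 \<circ> (\<lambda>t. 2 * t - 1)) has_vector_derivative 2 *\<^sub>R D2 (2 * t - 1)) (at t)"
      by (intro vector_diff_chain_at) (auto intro!: derivative_eq_intros)
    then have "(\<gamma> has_vector_derivative 2 *\<^sub>R D2 (2 * t - 1)) (at t)"
      by (rule has_vector_derivative_transform_within_open[of _ _ _ "{1/2<..}"])
        (use h in \<open>auto simp: \<gamma>_def joinpaths_def\<close>)
    then show ?thesis using h by (simp add: D_def scaleR_conv_of_real)
  qed
  moreover have "((\<lambda>t. cmul J (D t) o\<^sub>L f (\<gamma> t)) has_integral (I1 + I2)) {0..1}"
  proof (rule has_integral_combine[of 0 "1/2" 1])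
    have "((\<lambda>t. cmul J (D1 (2 * t)) o\<^sub>L f (\<gamma>1 (2 * t))) has_integral (1 / 2) *\<^sub>R I1)
      ((\<lambda>x. x / 2) ` {0..1})"
      using has_integral_affinity[of "\<lambda>t. cmul J (D1 t) o\<^sub>L f (\<gamma>1 t)" I1 0 1 2 0] 1(3) by simp
    then have "((\<lambda>t. 2 *\<^sub>R (cmul J (D1 (2 * t)) o\<^sub>L f (\<gamma>1 (2 * t)))) has_integral 2 *\<^sub>R (1 / 2) *\<^sub>R I1) {0..1/2}"
      by (intro has_integral_cmul) (simp add: image_divide_atLeastAtMost)
    then show "((\<lambda>t. cmul J (D t) o\<^sub>L f (\<gamma> t)) has_integral I1) {0..1/2}"
      by (rule has_integral_eq_rhs[OF has_integral_eq, rotated])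
        (auto simp: D_def \<gamma>_def joinpaths_def sc blinfun_compose_bilinear)
    have "((\<lambda>t. cmul J (D2 (2 * t - 1)) o\<^sub>L f (\<gamma>2 (2 * t - 1))) has_integral (1 / 2) *\<^sub>R I2)
      ((\<lambda>x. x / 2 + 1 / 2) ` {0..1})"
      using has_integral_affinity[of "\<lambda>t. cmul J (D2 t) o\<^sub>L f (\<gamma>2 t)" I2 0 1 2 "-1"] 2(3) by simp
    moreover have "(\<lambda>x. x / 2 + 1 / 2) ` {0..1} = {1/2..1::real}"
      using image_affinity_atLeastAtMost_div[of 2 "1/2" 0 "1::real"] by simp
    ultimately have "((\<lambda>t. 2 *\<^sub>R (cmul J (D2 (2 * t - 1)) o\<^sub>L f (\<gamma>2 (2 * t - 1)))) has_integral 2 *\<^sub>R (1 / 2) *\<^sub>R I2) {1/2..1}"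
      by (intro has_integral_cmul) simp
    then have "((\<lambda>t. 2 *\<^sub>R (cmul J (D2 (2 * t - 1)) o\<^sub>L f (\<gamma>2 (2 * t - 1)))) has_integral I2) {1/2..1}"
      by simp
    then show "((\<lambda>t. cmul J (D t) o\<^sub>L f (\<gamma> t)) has_integral I2) {1/2..1}"
      by (rule has_integral_spike_finite[of "{1/2}", rotated 2])
        (auto simp: D_def \<gamma>_def joinpaths_def sc blinfun_compose_bilinear)
  qed auto
  ultimately show ?thesis unfolding has_path_integral_def \<gamma>_def by blast
qed

definition rectangle_edges :: "complex \<Rightarrow> complex \<Rightarrow> (complex \<times> complex) list"
  where "rectangle_edges a c = (let b = Complex (Re c) (Im a); d = Complex (Re a) (Im c) in
    [(a, b), (b, c), (c, d), (d, a)])"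

lemma has_path_integral_rectpath:
  assumes "continuous_on (chain_support (rectangle_edges a c)) f"
  shows "has_path_integral J f (rectpath a c) (chain_integral J f (rectangle_edges a c))"
  using assms
  by (auto simp: rectangle_edges_def rectpath_def Let_def simp del: chain_simps(3)
      intro!: has_path_integral_join has_path_integral_linepath elim!: continuous_on_subset)

section \<open>The Riesz projectors of a hyperbolic operator\<close>

lemma is_inverse_unique:
  assumes "is_inverse T S" "is_inverse T S'" shows "S = S'"
  using assms unfolding is_inverse_def by (metis blinfun_compose_assoc blinfun_compose_id)

primrec blinfun_power :: "('e::real_normed_vector \<Rightarrow>\<^sub>L 'e) \<Rightarrow> nat \<Rightarrow> ('e \<Rightarrow>\<^sub>L 'e)"
  where "blinfun_power T 0 = id_blinfun"
  | "blinfun_power T (Suc n) = T o\<^sub>L blinfun_power T n"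

lemma norm_blinfun_power: "norm (blinfun_power T n) \<le> norm T ^ n"
proof (induction n)
  case (Suc n)
  then show ?case using norm_blinfun_compose_le[OF order_refl] by fastforce
qed (simp add: norm_blinfun_id_le)

lemma blinfun_power_commute: "T o\<^sub>L B = B o\<^sub>L T \<Longrightarrow> blinfun_power T n o\<^sub>L B = B o\<^sub>L blinfun_power T n"
  by (induction n) (simp_all, metis blinfun_compose_assoc)

locale complex_operator =
  fixes J T :: "'e::banach \<Rightarrow>\<^sub>L 'e"
  assumes J_J: "J o\<^sub>L J = - id_blinfun"
    and T_J: "T o\<^sub>L J = J o\<^sub>L T"
begin

abbreviation \<Omega> where "\<Omega> \<equiv> - cspectrum J T"
abbreviation \<R> where "\<R> \<equiv> resolvent J T"
abbreviation \<kappa> where "\<kappa> \<equiv> 1 + norm J"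

lemma cmul_mult: "cmul J (z * w) = cmul J z o\<^sub>L cmul J w"
  by (simp add: cmul_def blinfun_compose_bilinear J_J algebra_simps)

lemma cmul_compose: "cmul J z o\<^sub>L (cmul J w o\<^sub>L B) = cmul J (z * w) o\<^sub>L B"
  by (simp add: cmul_mult blinfun_compose_assoc)

lemma T_cmul: "T o\<^sub>L cmul J z = cmul J z o\<^sub>L T"
  by (rule cmul_commute[OF T_J])

lemma resolvent_inverse:
  assumes "z \<in> \<Omega>" shows "is_inverse (cmul J z - T) (\<R> z)"
proof -
  obtain S where S: "is_inverse (cmul J z - T) S" using assms by (auto simp: cspectrum_def)
  have "\<R> z = S"
    unfolding resolvent_def by (rule the_equality, rule S, rule is_inverse_unique[OF _ S])
  with S show ?thesis by simp
qed

lemma resolvent_left: "z \<in> \<Omega> \<Longrightarrow> \<R> z o\<^sub>L (cmul J z - T) = id_blinfun"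
  and resolvent_right: "z \<in> \<Omega> \<Longrightarrow> (cmul J z - T) o\<^sub>L \<R> z = id_blinfun"
  using resolvent_inverse by (auto simp: is_inverse_def)

lemma resolvent_commute:
  assumes "T o\<^sub>L B = B o\<^sub>L T" "B o\<^sub>L J = J o\<^sub>L B" "z \<in> \<Omega>"
  shows "\<R> z o\<^sub>L B = B o\<^sub>L \<R> z"
proof -
  have B: "(cmul J z - T) o\<^sub>L B = B o\<^sub>L (cmul J z - T)"
    using assms cmul_commute[OF assms(2), of z] by (simp add: blinfun_compose_bilinear)
  have "\<R> z o\<^sub>L B = \<R> z o\<^sub>L (B o\<^sub>L ((cmul J z - T) o\<^sub>L \<R> z))"
    by (simp add: resolvent_right[OF assms(3)])
  also have "\<dots> = (\<R> z o\<^sub>L (cmul J z - T)) o\<^sub>L (B o\<^sub>L \<R> z)"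
    by (metis B blinfun_compose_assoc)
  finally show ?thesis by (simp add: resolvent_left[OF assms(3)])
qed

lemma resolvent_J: "z \<in> \<Omega> \<Longrightarrow> J o\<^sub>L \<R> z = \<R> z o\<^sub>L J"
  using resolvent_commute[of J z] T_J by simp

lemma resolvent_cmul: "z \<in> \<Omega> \<Longrightarrow> \<R> z o\<^sub>L cmul J w = cmul J w o\<^sub>L \<R> z"
  by (rule cmul_commute) (simp add: resolvent_J)

lemma resolvent_equation:
  assumes "z \<in> \<Omega>" "w \<in> \<Omega>"
  shows "\<R> w - \<R> z = cmul J (z - w) o\<^sub>L (\<R> w o\<^sub>L \<R> z)"
proof -
  have "cmul J (z - w) o\<^sub>L (\<R> w o\<^sub>L \<R> z) = \<R> w o\<^sub>L (((cmul J z - T) - (cmul J w - T)) o\<^sub>L \<R> z)"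
  proof -
    have "(cmul J z - T) - (cmul J w - T) = cmul J (z - w)" by (simp add: cmul_linear)
    then show ?thesis by (metis resolvent_cmul[OF assms(2)] blinfun_compose_assoc)
  qed
  also have "\<dots> = (\<R> w o\<^sub>L ((cmul J z - T) o\<^sub>L \<R> z)) - ((\<R> w o\<^sub>L (cmul J w - T)) o\<^sub>L \<R> z)"
    by (simp only: blinfun_compose_bilinear blinfun_compose_assoc)
  finally show ?thesis by (simp add: resolvent_right[OF assms(1)] resolvent_left[OF assms(2)])
qed

text \<open>
  By the resolvent equation \<open>\<R> w - \<R> z\<close> is at most a multiple of \<open>\<bar>w - z\<bar> * norm (\<R> w) * norm (\<R> z)\<close>.
  For \<open>w\<close> close to \<open>z\<close> this forces \<open>norm (\<R> w) \<le> 2 * norm (\<R> z)\<close>, and the estimate becomes a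
  Lipschitz estimate.
\<close>

lemma continuous_on_resolvent: "continuous_on \<Omega> \<R>"
  unfolding continuous_on_def
proof
  fix z assume z: "z \<in> \<Omega>"
  define r where "r = norm (\<R> z)"
  have k: "0 < \<kappa>" by (simp add: add_pos_nonneg)
  have le: "norm (\<R> w - \<R> z) \<le> \<kappa> * norm (w - z) * (2 * r * r)"
    if w: "w \<in> \<Omega>" "norm (w - z) * (2 * \<kappa> * r) < 1" for w
  proof -
    have 1: "norm (\<R> w - \<R> z) \<le> \<kappa> * norm (w - z) * (norm (\<R> w) * r)"
      unfolding resolvent_equation[OF z w(1)] r_def norm_minus_commute[of w z]
      by (intro norm_blinfun_compose_le norm_cmul_le order_refl)
    have "norm (\<R> w) \<le> r + norm (\<R> w - \<R> z)" unfolding r_def by norm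
    also have "\<dots> \<le> r + (norm (w - z) * (2 * \<kappa> * r)) * (norm (\<R> w) / 2)"
    proof -
      have "\<kappa> * norm (w - z) * (norm (\<R> w) * r) = norm (w - z) * (2 * \<kappa> * r) * (norm (\<R> w) / 2)"
        by (simp add: field_simps)
      with 1 show ?thesis by linarith
    qed
    also have "\<dots> \<le> r + 1 * (norm (\<R> w) / 2)"
      using w(2) by (intro add_left_mono mult_right_mono) auto
    finally have "norm (\<R> w) \<le> 2 * r" by simp
    then have "\<kappa> * norm (w - z) * (norm (\<R> w) * r) \<le> \<kappa> * norm (w - z) * (2 * r * r)"
      by (intro mult_left_mono mult_right_mono) (use k in \<open>auto simp: r_def\<close>)
    with 1 show ?thesis by linarith
  qed
  have nz: "((\<lambda>w. norm (w - z)) \<longlongrightarrow> 0) (at z within \<Omega>)"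
    by (rule tendsto_eq_intros | simp)+
  have "((\<lambda>w. norm (w - z) * (2 * \<kappa> * r)) \<longlongrightarrow> 0 * (2 * \<kappa> * r)) (at z within \<Omega>)"
    by (intro tendsto_mult tendsto_const nz)
  then have "\<forall>\<^sub>F w in at z within \<Omega>. norm (w - z) * (2 * \<kappa> * r) < 1"
    by (intro order_tendstoD) auto
  moreover have "\<forall>\<^sub>F w in at z within \<Omega>. w \<in> \<Omega>"
    by (simp add: eventually_at_filter)
  ultimately have ev: "\<forall>\<^sub>F w in at z within \<Omega>. norm (\<R> w - \<R> z) \<le> \<kappa> * norm (w - z) * (2 * r * r)"
    by eventually_elim (rule le)
  have "((\<lambda>w. \<kappa> * norm (w - z) * (2 * r * r)) \<longlongrightarrow> \<kappa> * 0 * (2 * r * r)) (at z within \<Omega>)"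
    by (intro tendsto_mult tendsto_const nz)
  then have "((\<lambda>w. \<kappa> * norm (w - z) * (2 * r * r)) \<longlongrightarrow> 0) (at z within \<Omega>)" by simp
  from Lim_null_comparison[OF ev this] show "(\<R> \<longlongrightarrow> \<R> z) (at z within \<Omega>)"
    by (simp add: LIM_zero_iff)
qed

lemma resolvent_has_cderivative:
  assumes "z \<in> \<Omega>" shows "has_cderivative J \<R> (- (\<R> z o\<^sub>L \<R> z)) z \<Omega>"
  unfolding has_cderivative_def has_derivative_within
proof
  show "bounded_linear (\<lambda>h. cmul J h o\<^sub>L - (\<R> z o\<^sub>L \<R> z))"
    by (intro bounded_linear_compose[OF bounded_linear_compose_left]
        bounded_linear_cmul)
  have id: "\<R> w - (\<R> z + (cmul J (w - z) o\<^sub>L - (\<R> z o\<^sub>L \<R> z))) = - (cmul J (w - z) o\<^sub>L ((\<R> w - \<R> z) o\<^sub>L \<R> z))"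
    if "w \<in> \<Omega>" for w
  proof -
    have "\<R> w - \<R> z = - (cmul J (w - z) o\<^sub>L (\<R> w o\<^sub>L \<R> z))"
      unfolding resolvent_equation[OF assms that]
      by (simp add: cmul_linear blinfun_compose_bilinear)
    then show ?thesis by (simp add: blinfun_compose_bilinear algebra_simps)
  qed
  have "((\<lambda>w. \<kappa> * (norm (\<R> w - \<R> z) * norm (\<R> z))) \<longlongrightarrow> \<kappa> * (0 * norm (\<R> z))) (at z within \<Omega>)"
    using continuous_on_resolvent assms
    by (intro tendsto_mult tendsto_const tendsto_norm_zero) (simp add: continuous_on_def LIM_zero_iff)
  then have l: "((\<lambda>w. \<kappa> * (norm (\<R> w - \<R> z) * norm (\<R> z))) \<longlongrightarrow> 0) (at z within \<Omega>)" by simp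
  show "((\<lambda>w. (1 / norm (w - z)) *\<^sub>R (\<R> w - (\<R> z + (cmul J (w - z) o\<^sub>L - (\<R> z o\<^sub>L \<R> z))))) \<longlongrightarrow> 0) (at z within \<Omega>)"
  proof (rule Lim_null_comparison[OF _ l])
    have "norm ((1 / norm (w - z)) *\<^sub>R (\<R> w - (\<R> z + (cmul J (w - z) o\<^sub>L - (\<R> z o\<^sub>L \<R> z)))))
      \<le> \<kappa> * (norm (\<R> w - \<R> z) * norm (\<R> z))" if "w \<noteq> z" "w \<in> \<Omega>" for w
    proof -
      have "norm (cmul J (w - z) o\<^sub>L ((\<R> w - \<R> z) o\<^sub>L \<R> z))
          \<le> (\<kappa> * norm (w - z)) * (norm (\<R> w - \<R> z) * norm (\<R> z))"
        by (intro norm_blinfun_compose_le norm_cmul_le order_refl)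
      then show ?thesis
        unfolding id[OF that(2)] using that(1) by (simp add: divide_simps mult_ac)
    qed
    then show "\<forall>\<^sub>F w in at z within \<Omega>. norm ((1 / norm (w - z)) *\<^sub>R (\<R> w - (\<R> z + (cmul J (w - z) o\<^sub>L - (\<R> z o\<^sub>L \<R> z)))))
      \<le> \<kappa> * (norm (\<R> w - \<R> z) * norm (\<R> z))"
      by (simp add: eventually_at_filter)
  qed
qed

lemma has_cderivative_cmul:
  assumes "(g has_field_derivative g') (at z within S)"
  shows "has_cderivative J (\<lambda>z. cmul J (g z)) (cmul J g') z S"
proof -
  have "((\<lambda>z. cmul J (g z)) has_derivative (\<lambda>h. cmul J (g' * h))) (at z within S)"
    using assms unfolding has_field_derivative_def
    by (rule bounded_linear.has_derivative[OF bounded_linear_cmul])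
  then show ?thesis unfolding has_cderivative_def by (simp add: cmul_mult[symmetric] mult.commute)
qed

lemma has_cderivative_cmul_compose:
  assumes "(g has_field_derivative g') (at z within S)" "has_cderivative J F F' z S"
  shows "has_cderivative J (\<lambda>z. cmul J (g z) o\<^sub>L F z) ((cmul J g' o\<^sub>L F z) + (cmul J (g z) o\<^sub>L F')) z S"
proof -
  have "((\<lambda>z. cmul J (g z) o\<^sub>L F z) has_derivative
      (\<lambda>h. (cmul J (g z) o\<^sub>L (cmul J h o\<^sub>L F')) + ((cmul J h o\<^sub>L cmul J g') o\<^sub>L F z))) (at z within S)"
    using has_cderivative_cmul[OF assms(1)] assms(2) unfolding has_cderivative_def
    by (rule bounded_bilinear.FDERIV[OF bounded_bilinear_blinfun_compose])
  moreover have "(cmul J (g z) o\<^sub>L (cmul J h o\<^sub>L F')) + ((cmul J h o\<^sub>L cmul J g') o\<^sub>L F z)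
      = cmul J h o\<^sub>L ((cmul J g' o\<^sub>L F z) + (cmul J (g z) o\<^sub>L F'))" for h
    by (simp add: blinfun_compose_bilinear blinfun_compose_assoc cmul_compose mult.commute)
  ultimately show ?thesis unfolding has_cderivative_def by simp
qed

lemma continuous_on_cmul_resolvent:
  assumes "S \<subseteq> \<Omega>" "continuous_on S g" shows "continuous_on S (\<lambda>z. cmul J (g z) o\<^sub>L \<R> z)"
  by (intro continuous_intros continuous_on_cmul assms continuous_on_subset[OF continuous_on_resolvent])

lemma resolvent_identity: "z \<in> \<Omega> \<Longrightarrow> cmul J z o\<^sub>L \<R> z = id_blinfun + (T o\<^sub>L \<R> z)"
  using resolvent_right[of z] by (simp add: blinfun_compose_bilinear algebra_simps)

subsection \<open>Neumann series\<close>

text \<open>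
  The Neumann series \<open>\<Sum>n. z\<^sup>-\<^sup>n\<^sup>-\<^sup>1 T\<^sup>n\<close>. The norm of \<open>cmul J w\<close> is only bounded by \<open>\<kappa>\<close> times the modulus
  of \<open>w\<close>; this costs a constant factor in each term and leaves the radius of convergence alone.
\<close>

lemma resolvent_set_outside_ball:
  assumes "norm T < norm z" shows "z \<in> \<Omega>"
proof -
  have z: "z \<noteq> 0" using assms by (metis norm_ge_zero norm_zero not_less)
  define a where "a n = cmul J (inverse z ^ Suc n) o\<^sub>L blinfun_power T n" for n
  define q where "q = norm T / norm z"
  have q: "0 \<le> q" "q < 1" using assms z by (auto simp: q_def)
  have "norm (a n) \<le> (\<kappa> / norm z) * q ^ n" for n
  proof -
    have "norm (a n) \<le> (\<kappa> * norm (inverse z ^ Suc n)) * norm T ^ n"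
      unfolding a_def by (intro norm_blinfun_compose_le norm_cmul_le norm_blinfun_power)
    also have "\<dots> = (\<kappa> / norm z) * q ^ n"
      by (simp add: q_def norm_power norm_inverse norm_mult field_simps power_divide norm_divide)
    finally show ?thesis .
  qed
  moreover have "summable (\<lambda>n. (\<kappa> / norm z) * q ^ n)"
    using q by (intro summable_mult summable_geometric) simp
  ultimately have s: "summable a" by (rule summable_comparison_test'[rotated])
  have Ta: "T o\<^sub>L a n = a n o\<^sub>L T" for n
  proof -
    have "blinfun_power T n o\<^sub>L T = T o\<^sub>L blinfun_power T n" by (rule blinfun_power_commute) simp
    then show ?thesis unfolding a_def by (metis T_cmul blinfun_compose_assoc)
  qed
  have za: "cmul J z o\<^sub>L a (Suc n) = T o\<^sub>L a n" "cmul J z o\<^sub>L a 0 = id_blinfun" for n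
  proof -
    have "z * inverse z ^ Suc (Suc n) = inverse z ^ Suc n" "z * inverse z ^ Suc 0 = 1"
      using z by (simp_all add: field_simps)
    then show "cmul J z o\<^sub>L a (Suc n) = T o\<^sub>L a n" "cmul J z o\<^sub>L a 0 = id_blinfun"
      unfolding a_def cmul_compose
      by (simp_all only: blinfun_power.simps cmul_1 blinfun_compose_id) (metis T_cmul blinfun_compose_assoc)
  qed
  have bl: "bounded_linear (\<lambda>x. B o\<^sub>L x)" "bounded_linear (\<lambda>x. x o\<^sub>L B)" for B :: "'e \<Rightarrow>\<^sub>L 'e"
    by (rule bounded_bilinear.bounded_linear_right bounded_bilinear.bounded_linear_left, rule bounded_bilinear_blinfun_compose)+
  have TS: "T o\<^sub>L suminf a = suminf a o\<^sub>L T"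
    by (simp add: bounded_linear.suminf[OF bl(1) s] bounded_linear.suminf[OF bl(2) s] Ta)
  have zS: "cmul J z o\<^sub>L suminf a = suminf a o\<^sub>L cmul J z"
  proof -
    have "cmul J z o\<^sub>L a n = a n o\<^sub>L cmul J z" for n
    proof -
      have "blinfun_power T n o\<^sub>L cmul J z = cmul J z o\<^sub>L blinfun_power T n"
        by (rule blinfun_power_commute[OF T_cmul])
      then have "a n o\<^sub>L cmul J z = cmul J (inverse z ^ Suc n) o\<^sub>L (cmul J z o\<^sub>L blinfun_power T n)"
        by (simp only: a_def blinfun_compose_assoc)
      then show ?thesis
        by (simp only: a_def cmul_compose mult.commute)
    qed
    then show ?thesis
      by (simp add: bounded_linear.suminf[OF bl(1) s] bounded_linear.suminf[OF bl(2) s])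
  qed
  have "cmul J z o\<^sub>L suminf a = (\<Sum>n. cmul J z o\<^sub>L a n)" by (rule bounded_linear.suminf[OF bl(1) s])
  also have "\<dots> = (\<Sum>n. cmul J z o\<^sub>L a (Suc n)) + (cmul J z o\<^sub>L a 0)"
    using suminf_split_head[OF bounded_linear.summable[OF bl(1) s, of "cmul J z"]] by simp
  also have "\<dots> = (T o\<^sub>L suminf a) + id_blinfun"
    by (simp add: za bounded_linear.suminf[OF bl(1) s])
  finally have "(cmul J z - T) o\<^sub>L suminf a = id_blinfun"
    by (simp only: blinfun_compose_bilinear) simp
  moreover have "suminf a o\<^sub>L (cmul J z - T) = (cmul J z - T) o\<^sub>L suminf a"
    by (simp only: blinfun_compose_bilinear zS TS)
  ultimately have "is_inverse (cmul J z - T) (suminf a)"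
    by (simp add: is_inverse_def)
  then show ?thesis by (auto simp: cspectrum_def)
qed

end

subsection \<open>Exponentials\<close>

abbreviation op_exp :: "('e::banach \<Rightarrow>\<^sub>L 'e) \<Rightarrow> real \<Rightarrow> ('e \<Rightarrow>\<^sub>L 'e)"
  where "op_exp T \<equiv> fundamental_solution (\<lambda>_. T)"

lemma bounded_path_const: "bounded_path (\<lambda>_. T) (norm T + 1)"
  by unfold_locales (auto simp: add_nonneg_pos)

lemma op_exp_derivative:
  "0 \<le> t \<Longrightarrow> (op_exp T has_vector_derivative (T o\<^sub>L op_exp T t)) (at t within {0..})"
  using bounded_path.solution_X[OF bounded_path_const] bounded_path.solution_def[OF bounded_path_const] by blast

lemma op_exp_0: "op_exp T 0 = id_blinfun"
  by (rule bounded_path.X_0[OF bounded_path_const])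

lemma op_exp_commute: "T o\<^sub>L B = B o\<^sub>L T \<Longrightarrow> 0 \<le> t \<Longrightarrow> op_exp T t o\<^sub>L B = B o\<^sub>L op_exp T t"
  by (rule bounded_path.fundamental_solution_commute[OF bounded_path_const])

lemma op_exp_unique:
  fixes Z :: "real \<Rightarrow> ('e::banach \<Rightarrow>\<^sub>L 'e)"
  assumes "\<And>t. 0 \<le> t \<Longrightarrow> (Z has_vector_derivative (T o\<^sub>L Z t)) (at t within {0..})" "0 \<le> t"
  shows "Z t = op_exp T t o\<^sub>L Z 0"
proof -
  interpret bounded_path "\<lambda>_. T" "norm T + 1" by (rule bounded_path_const)
  show ?thesis
    using solution_unique[OF _ solution_compose_right[OF solution_X], of Z "Z 0" t] assms
    by (auto simp: solution_def X_0)
qed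

text \<open>
  The derivative of the product vanishes, since \<open>T\<close> commutes with its exponential.
\<close>

lemma op_exp_minus:
  assumes "0 \<le> t" shows "op_exp T t o\<^sub>L op_exp (- T) t = id_blinfun"
proof -
  have "(\<lambda>t. op_exp T t o\<^sub>L op_exp (- T) t) t = (\<lambda>t. op_exp T t o\<^sub>L op_exp (- T) t) 0"
  proof (rule has_vector_derivative_zero_constant[of "{0..t}", THEN exE])
    fix s assume s: "s \<in> {0..t}"
    have "((\<lambda>t. op_exp T t o\<^sub>L op_exp (- T) t) has_vector_derivative
      (op_exp T s o\<^sub>L (- T o\<^sub>L op_exp (- T) s)) + ((T o\<^sub>L op_exp T s) o\<^sub>L op_exp (- T) s)) (at s within {0..})"
      using s by (intro bounded_bilinear.has_vector_derivative[OF bounded_bilinear_blinfun_compose] op_exp_derivative) auto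
    moreover have "(op_exp T s o\<^sub>L (- T o\<^sub>L op_exp (- T) s)) + ((T o\<^sub>L op_exp T s) o\<^sub>L op_exp (- T) s) = 0"
      using op_exp_commute[of T T s] s by (simp add: blinfun_compose_bilinear flip: blinfun_compose_assoc)
    ultimately show "((\<lambda>t. op_exp T t o\<^sub>L op_exp (- T) t) has_vector_derivative 0) (at s within {0..t})"
      by (intro has_vector_derivative_Icc_subset) simp
  qed (use assms in auto)
  then show ?thesis by (simp add: op_exp_0)
qed

text \<open>
  As \<open>T\<close> commutes with \<open>M\<close>, the product \<open>M N\<close> equals \<open>(e\<^sup>t\<^sup>T M) (e\<^sup>-\<^sup>t\<^sup>T N)\<close> for every \<open>t \<ge> 0\<close>.
\<close>

lemma stable_compose_unstable:
  fixes T M N :: "'e::banach \<Rightarrow>\<^sub>L 'e"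
  assumes "T o\<^sub>L M = M o\<^sub>L T"
    and M: "((\<lambda>t. op_exp T t o\<^sub>L M) \<longlongrightarrow> 0) at_top" and N: "((\<lambda>t. op_exp (- T) t o\<^sub>L N) \<longlongrightarrow> 0) at_top"
  shows "M o\<^sub>L N = 0"
proof -
  have "((\<lambda>t. (op_exp T t o\<^sub>L M) o\<^sub>L (op_exp (- T) t o\<^sub>L N)) \<longlongrightarrow> 0) at_top"
    using bounded_bilinear.tendsto_zero[OF bounded_bilinear_blinfun_compose M N] .
  moreover have "\<forall>\<^sub>F t in at_top. (op_exp T t o\<^sub>L M) o\<^sub>L (op_exp (- T) t o\<^sub>L N) = M o\<^sub>L N"
    using eventually_ge_at_top[of 0]
  proof eventually_elim
    case (elim t)
    have "op_exp (- T) t o\<^sub>L M = M o\<^sub>L op_exp (- T) t"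
      using assms(1) elim by (intro op_exp_commute) (auto simp: blinfun_compose_bilinear)
    then have "(op_exp T t o\<^sub>L M) o\<^sub>L (op_exp (- T) t o\<^sub>L N) = (op_exp T t o\<^sub>L op_exp (- T) t) o\<^sub>L (M o\<^sub>L N)"
      by (simp add: blinfun_compose_assoc) (simp flip: blinfun_compose_assoc)
    then show ?case by (simp add: op_exp_minus[OF elim])
  qed
  ultimately have "((\<lambda>t::real. M o\<^sub>L N) \<longlongrightarrow> 0) at_top"
    by (rule Lim_transform_eventually)
  then show ?thesis by (simp add: tendsto_const_iff)
qed

lemma tendsto_0_of_inverse_time_bound:
  fixes f :: "real \<Rightarrow> 'b::real_normed_vector"
  assumes "\<And>t. 0 < t \<Longrightarrow> norm (f t) \<le> K / t"
  shows "(f \<longlongrightarrow> 0) at_top"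
proof (rule Lim_null_comparison)
  show "\<forall>\<^sub>F t in at_top. norm (f t) \<le> K / t"
    using eventually_gt_at_top[of 0] by eventually_elim (rule assms)
  show "((\<lambda>t. K / t) \<longlongrightarrow> 0) at_top"
    by (rule tendsto_divide_0[OF tendsto_const filterlim_at_top_imp_at_infinity[OF filterlim_ident]])
qed

subsection \<open>Exponentials as contour integrals\<close>

context complex_operator
begin

definition closed_chain :: "(complex \<times> complex) list \<Rightarrow> bool"
  where "closed_chain C \<longleftrightarrow> (\<forall>F :: complex \<Rightarrow> ('e \<Rightarrow>\<^sub>L 'e). (\<Sum>(a, b)\<leftarrow>C. F b - F a) = 0)"

lemma closed_chain_integral_derivative:
  assumes "closed_chain C" "\<And>z. z \<in> chain_support C \<Longrightarrow> has_cderivative J F (f z) z (chain_support C)"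
  shows "chain_integral J f C = 0"
  using chain_integral_derivative[OF assms(2)] assms(1) by (simp add: closed_chain_def)

text \<open>
  For a closed chain this is \<open>e\<^sup>t\<^sup>T\<close> times the Riesz projector of \<open>C\<close>, up to the factor \<open>2 \<pi> \<i>\<close>.
\<close>

definition exp_integral :: "(complex \<times> complex) list \<Rightarrow> real \<Rightarrow> ('e \<Rightarrow>\<^sub>L 'e)"
  where "exp_integral C t = chain_integral J (\<lambda>z. cmul J (exp (of_real t * z)) o\<^sub>L \<R> z) C"

lemma closed_chain_integral_exp:
  assumes "closed_chain C"
  shows "chain_integral J (\<lambda>z. cmul J (exp (of_real t * z))) C = 0"
proof (cases "t = 0")
  case True
  show ?thesis
    by (rule closed_chain_integral_derivative[OF assms, where F = "\<lambda>z. cmul J z"],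
        rule has_cderivative_cmul) (use True in \<open>auto intro!: derivative_eq_intros\<close>)
next
  case False
  show ?thesis
    by (rule closed_chain_integral_derivative[OF assms, where F = "\<lambda>z. cmul J (exp (of_real t * z) / of_real t)"],
        rule has_cderivative_cmul) (use False in \<open>auto intro!: derivative_eq_intros\<close>)
qed

text \<open>
  By the resolvent identity \<open>z e\<^sup>t\<^sup>z \<R> z = e\<^sup>t\<^sup>z + T e\<^sup>t\<^sup>z \<R> z\<close>, and \<open>e\<^sup>t\<^sup>z\<close> has a primitive.
\<close>

lemma exp_integral_derivative:
  assumes C: "chain_support C \<subseteq> \<Omega>" "closed_chain C"
  shows "(exp_integral C has_vector_derivative (T o\<^sub>L exp_integral C t)) (at t within U)"
proof -
  have cont: "continuous_on (chain_support C) (\<lambda>z. cmul J (exp (of_real t * z)) o\<^sub>L \<R> z)" for t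
    by (intro continuous_on_cmul_resolvent C continuous_intros)
  have "(exp_integral C has_vector_derivative
      chain_integral J (\<lambda>z. cmul J (z * exp (of_real t * z)) o\<^sub>L \<R> z) C) (at t)"
    unfolding exp_integral_def[abs_def]
  proof (rule chain_integral_has_vector_derivative)
    fix t z assume "z \<in> chain_support C"
    have "((\<lambda>t. exp (of_real t * z)) has_vector_derivative z * exp (of_real t * z)) (at t)"
      by (rule has_vector_derivative_real_field[of "\<lambda>w. exp (w * z)"])
        (auto intro!: derivative_eq_intros)
    then show "((\<lambda>t. cmul J (exp (of_real t * z)) o\<^sub>L \<R> z) has_vector_derivative
        cmul J (z * exp (of_real t * z)) o\<^sub>L \<R> z) (at t)"
      by (intro bounded_linear.has_vector_derivative[OF bounded_linear_compose[OF
            bounded_linear_compose_left bounded_linear_cmul]])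
  next
    have "continuous_on (UNIV \<times> chain_support C) (\<lambda>x. \<R> (snd x))"
      by (rule continuous_on_compose2[OF continuous_on_resolvent])
        (use C in \<open>auto intro!: continuous_intros\<close>)
    then show "continuous_on (UNIV \<times> chain_support C) (\<lambda>(t, z). cmul J (z * exp (of_real t * z)) o\<^sub>L \<R> z)"
      unfolding split_beta by (intro continuous_intros)
  qed (use cont in auto)
  moreover have "chain_integral J (\<lambda>z. cmul J (z * exp (of_real t * z)) o\<^sub>L \<R> z) C
      = chain_integral J (\<lambda>z. cmul J (exp (of_real t * z)) + (T o\<^sub>L (cmul J (exp (of_real t * z)) o\<^sub>L \<R> z))) C"
  proof (rule chain_integral_cong)
    fix z assume "z \<in> chain_support C"
    then have "cmul J (exp (of_real t * z)) o\<^sub>L (cmul J z o\<^sub>L \<R> z)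
        = cmul J (exp (of_real t * z)) o\<^sub>L (id_blinfun + (T o\<^sub>L \<R> z))"
      using resolvent_identity C by auto
    then show "cmul J (z * exp (of_real t * z)) o\<^sub>L \<R> z
        = cmul J (exp (of_real t * z)) + (T o\<^sub>L (cmul J (exp (of_real t * z)) o\<^sub>L \<R> z))"
      unfolding cmul_compose blinfun_compose_bilinear
      by (metis T_cmul blinfun_compose_assoc blinfun_compose_id(1) mult.commute)
  qed
  moreover have "\<dots> = 0 + (T o\<^sub>L exp_integral C t)"
    unfolding exp_integral_def
    by (subst chain_integral_add, (intro continuous_intros cont)+,
        subst chain_integral_compose_left[OF cont T_J], subst closed_chain_integral_exp[OF C(2)]) simp
  ultimately show ?thesis by (simp add: has_vector_derivative_at_within)
qed

text \<open>
  Integration by parts: the derivative \<open>t e\<^sup>t\<^sup>z \<R> z - e\<^sup>t\<^sup>z (\<R> z)\<^sup>2\<close> of \<open>e\<^sup>t\<^sup>z \<R> z\<close> integrates to zero over a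
  closed chain. The term \<open>e\<^sup>t\<^sup>z (\<R> z)\<^sup>2\<close> is bounded where \<open>\<bar>e\<^sup>t\<^sup>z\<bar> \<le> 1\<close>. This is what yields decay
  although the chain meets the imaginary axis.
\<close>

lemma exp_integral_bound:
  assumes C: "chain_support C \<subseteq> \<Omega>" "closed_chain C"
  shows "\<exists>K\<ge>0. \<forall>t. (\<forall>z\<in>chain_support C. t * Re z \<le> 0) \<longrightarrow> norm (t *\<^sub>R exp_integral C t) \<le> K"
proof -
  have cR: "continuous_on (chain_support C) \<R>"
    by (rule continuous_on_subset[OF continuous_on_resolvent C(1)])
  have "bounded (\<R> ` chain_support C)"
    by (intro compact_imp_bounded compact_continuous_image cR compact_chain_support)
  then obtain M where M: "\<And>z. z \<in> chain_support C \<Longrightarrow> norm (\<R> z) \<le> M" "0 < M"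
    by (auto simp: bounded_pos)
  define K where "K = \<kappa> * ((\<kappa> * 1) * (M * M)) * chain_length C"
  have "norm (t *\<^sub>R exp_integral C t) \<le> K" if t: "\<forall>z\<in>chain_support C. t * Re z \<le> 0" for t
  proof -
    define e where "e z = exp (of_real t * z)" for z :: complex
    have e: "continuous_on S e" for S unfolding e_def by (intro continuous_intros)
    have cont: "continuous_on (chain_support C) (\<lambda>z. cmul J (e z) o\<^sub>L \<R> z)"
      by (intro continuous_on_cmul_resolvent C e)
    have c2: "continuous_on (chain_support C) (\<lambda>z. cmul J (e z) o\<^sub>L (\<R> z o\<^sub>L \<R> z))"
      by (intro continuous_intros cR e)
    have "0 = chain_integral J (\<lambda>z. (cmul J (of_real t * e z) o\<^sub>L \<R> z) + (cmul J (e z) o\<^sub>L - (\<R> z o\<^sub>L \<R> z))) C"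
    proof (rule closed_chain_integral_derivative[OF C(2), symmetric])
      fix z assume z: "z \<in> chain_support C"
      show "has_cderivative J (\<lambda>z. cmul J (e z) o\<^sub>L \<R> z)
        ((cmul J (of_real t * e z) o\<^sub>L \<R> z) + (cmul J (e z) o\<^sub>L - (\<R> z o\<^sub>L \<R> z))) z (chain_support C)"
        using z C by (intro has_cderivative_cmul_compose has_cderivative_subset[OF resolvent_has_cderivative])
          (auto simp: e_def intro!: derivative_eq_intros)
    qed
    also have "\<dots> = chain_integral J (\<lambda>z. t *\<^sub>R (cmul J (e z) o\<^sub>L \<R> z) + - (cmul J (e z) o\<^sub>L (\<R> z o\<^sub>L \<R> z))) C"
      by (rule chain_integral_cong) (simp add: cmul_def blinfun_compose_bilinear algebra_simps)
    also have "\<dots> = t *\<^sub>R exp_integral C t - chain_integral J (\<lambda>z. cmul J (e z) o\<^sub>L (\<R> z o\<^sub>L \<R> z)) C"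
      unfolding exp_integral_def e_def[symmetric]
      by (subst chain_integral_add, (intro continuous_intros cont c2)+,
          subst chain_integral_linear[OF bounded_linear_scaleR_right _ cont],
          simp add: blinfun_compose_bilinear,
          subst chain_integral_linear[OF bounded_linear_minus[OF bounded_linear_ident] _ c2])
        (simp_all add: blinfun_compose_bilinear)
    finally have "t *\<^sub>R exp_integral C t = chain_integral J (\<lambda>z. cmul J (e z) o\<^sub>L (\<R> z o\<^sub>L \<R> z)) C" by simp
    also have "norm \<dots> \<le> K" unfolding K_def
    proof (rule norm_chain_integral_le[OF c2])
      fix z assume z: "z \<in> chain_support C"
      have "norm (cmul J (e z)) \<le> \<kappa> * norm (e z)" by (rule norm_cmul_le)
      also have "\<dots> \<le> \<kappa> * 1"
        using t z by (intro mult_left_mono) (auto simp: e_def)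
      finally show "norm (cmul J (e z) o\<^sub>L (\<R> z o\<^sub>L \<R> z)) \<le> (\<kappa> * 1) * (M * M)"
        using M z by (intro norm_blinfun_compose_le) auto
    qed
    finally show ?thesis .
  qed
  moreover have "0 \<le> K" using M(2) chain_length_nonneg by (simp add: K_def)
  ultimately show ?thesis by blast
qed

end

subsection \<open>The spectral splitting\<close>

text \<open>
  The rectangles have width \<open>r\<close> and height \<open>2 * r\<close>; all spectral values have modulus at most \<open>norm T\<close>.
\<close>

locale hyperbolic_operator = complex_operator J T for J T :: "'e::banach \<Rightarrow>\<^sub>L 'e" +
  fixes r :: real
  assumes norm_T: "norm T < r"
    and imaginary_axis: "\<And>z. Re z = 0 \<Longrightarrow> z \<in> - cspectrum J T"
begin

lemma r_pos: "0 < r" using norm_T norm_ge_zero[of T] by linarith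

definition left_edges where "left_edges = rectangle_edges (Complex (- r) (- r)) (Complex 0 r)"
definition right_edges where "right_edges = rectangle_edges (Complex 0 (- r)) (Complex r r)"
text \<open>
  The six edges of the two rectangles that remain when the common edge on the imaginary axis
  cancels.
\<close>

definition outer_edges where "outer_edges =
  [(Complex 0 (- r), Complex r (- r)), (Complex r (- r), Complex r r), (Complex r r, Complex 0 r),
   (Complex 0 r, Complex (- r) r), (Complex (- r) r, Complex (- r) (- r)),
   (Complex (- r) (- r), Complex 0 (- r))]"

lemma mem_closed_segment_same_Re:
  "z \<in> closed_segment (Complex x y) (Complex x y') \<longleftrightarrow> Re z = x \<and> Im z \<in> closed_segment y y'"
  by (subst closed_segment_same_Re) auto

lemma mem_closed_segment_same_Im:
  "z \<in> closed_segment (Complex x y) (Complex x' y) \<longleftrightarrow> Im z = y \<and> Re z \<in> closed_segment x x'"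
  by (subst closed_segment_same_Im) auto

lemmas edge_simps = mem_closed_segment_same_Re mem_closed_segment_same_Im closed_segment_eq_real_ivl

lemma in_resolvent_set: "r \<le> \<bar>Re z\<bar> \<or> r \<le> \<bar>Im z\<bar> \<or> Re z = 0 \<Longrightarrow> z \<in> \<Omega>"
  using resolvent_set_outside_ball[of z] imaginary_axis[of z] norm_T
    abs_Re_le_cmod[of z] abs_Im_le_cmod[of z] by linarith

lemma left_edges:
  shows left_edges_subset: "chain_support left_edges \<subseteq> \<Omega>"
    and left_edges_nonpos: "z \<in> chain_support left_edges \<Longrightarrow> Re z \<le> 0"
    and closed_left_edges: "closed_chain left_edges"
  using r_pos
  by (auto simp: left_edges_def rectangle_edges_def Let_def edge_simps closed_chain_def
      simp del: Compl_iff intro!: in_resolvent_set)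

lemma right_edges:
  shows right_edges_subset: "chain_support right_edges \<subseteq> \<Omega>"
    and right_edges_nonneg: "z \<in> chain_support right_edges \<Longrightarrow> 0 \<le> Re z"
    and closed_right_edges: "closed_chain right_edges"
  using r_pos
  by (auto simp: right_edges_def rectangle_edges_def Let_def edge_simps closed_chain_def
      simp del: Compl_iff intro!: in_resolvent_set)

lemma outer_edges:
  shows outer_edges_subset: "chain_support outer_edges \<subseteq> \<Omega>"
    and outer_edges_norm: "z \<in> chain_support outer_edges \<Longrightarrow> r \<le> norm z"
    and closed_outer_edges: "closed_chain outer_edges"
proof -
  have *: "r \<le> \<bar>Re z\<bar> \<or> r \<le> \<bar>Im z\<bar>" if "z \<in> chain_support outer_edges" for z
    using that r_pos by (auto simp: outer_edges_def edge_simps)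
  then show "chain_support outer_edges \<subseteq> \<Omega>"
    using in_resolvent_set by blast
  show "z \<in> chain_support outer_edges \<Longrightarrow> r \<le> norm z"
    using *[of z] abs_Re_le_cmod[of z] abs_Im_le_cmod[of z] by linarith
  show "closed_chain outer_edges" by (auto simp: outer_edges_def closed_chain_def)
qed

lemma left_right_outer:
  assumes "continuous_on \<Omega> f"
  shows "chain_integral J f left_edges + chain_integral J f right_edges = chain_integral J f outer_edges"
proof -
  have "closed_segment (Complex 0 r) (Complex 0 (- r)) \<subseteq> \<Omega>"
    by (auto simp: edge_simps simp del: Compl_iff intro!: in_resolvent_set)
  then have "segment_integral J f (Complex 0 (- r), Complex 0 r) = - segment_integral J f (Complex 0 r, Complex 0 (- r))"
    by (intro segment_integral_reverse continuous_on_subset[OF assms])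
  then show ?thesis
    by (simp add: left_edges_def right_edges_def outer_edges_def rectangle_edges_def Let_def)
qed

text \<open>
  The principal logarithm is a primitive of \<open>1 / z\<close> near all edges but the left one, which crosses its
  branch cut; there \<open>Ln (- z)\<close> is used instead. The jumps by \<open>\<i> \<pi>\<close> add up to \<open>2 \<pi> \<i>\<close>.
\<close>

lemma chain_integral_inverse_outer: "chain_integral J (\<lambda>z. cmul J (inverse z)) outer_edges = cmul J (2 * of_real pi * \<i>)"
proof -
  define C1 where "C1 = [(Complex 0 (- r), Complex r (- r)), (Complex r (- r), Complex r r), (Complex r r, Complex 0 r),
   (Complex 0 r, Complex (- r) r)]"
  define C2 where "C2 = [(Complex (- r) (- r), Complex 0 (- r))]"
  define C3 where "C3 = [(Complex (- r) r, Complex (- r) (- r))]"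
  have split: "chain_integral J f outer_edges = chain_integral J f C1 + chain_integral J f C3 + chain_integral J f C2" for f
    by (simp add: outer_edges_def C1_def C2_def C3_def)
  have 1: "chain_integral J (\<lambda>z. cmul J (inverse z)) C = (\<Sum>(a, b)\<leftarrow>C. cmul J (Ln b) - cmul J (Ln a))"
    if "\<And>z. z \<in> chain_support C \<Longrightarrow> z \<notin> \<real>\<^sub>\<le>\<^sub>0" for C
    by (rule chain_integral_derivative, rule has_cderivative_cmul)
      (use that in \<open>auto intro!: derivative_eq_intros\<close>)
  have 2: "chain_integral J (\<lambda>z. cmul J (inverse z)) C3 = (\<Sum>(a, b)\<leftarrow>C3. cmul J (Ln (- b)) - cmul J (Ln (- a)))"
  proof (rule chain_integral_derivative, rule has_cderivative_cmul)
    fix z assume "z \<in> chain_support C3"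
    then have "- z \<notin> \<real>\<^sub>\<le>\<^sub>0" "z \<noteq> 0"
      using r_pos by (auto simp: C3_def edge_simps complex_nonpos_Reals_iff)
    then show "((\<lambda>z. Ln (- z)) has_field_derivative inverse z) (at z within chain_support C3)"
      by (auto intro!: derivative_eq_intros simp: field_simps)
  qed
  have n: "z \<notin> \<real>\<^sub>\<le>\<^sub>0" if "z \<in> chain_support C1 \<or> z \<in> chain_support C2" for z
    using that r_pos by (auto simp: C1_def C2_def edge_simps complex_nonpos_Reals_iff)
  have "Ln (- Complex r (- r)) = Ln (Complex r (- r)) + \<i> * pi" "Ln (- Complex r r) = Ln (Complex r r) - \<i> * pi"
    using r_pos Ln_minus[of "Complex r (- r)"] Ln_minus[of "Complex r r"] by (simp_all add: complex_eq_iff)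
  moreover have "- Complex r (- r) = Complex (- r) r" "- Complex r r = Complex (- r) (- r)"
    by (simp_all add: complex_eq_iff)
  ultimately have L: "Ln (Complex (- r) r) = Ln (Complex r (- r)) + \<i> * pi"
    "Ln (Complex (- r) (- r)) = Ln (Complex r r) - \<i> * pi" by simp_all
  have "chain_integral J (\<lambda>z. cmul J (inverse z)) outer_edges
    = cmul J ((Ln (Complex (- r) r) - Ln (Complex 0 (- r))) + (Ln (- Complex (- r) (- r)) - Ln (- Complex (- r) r))
      + (Ln (Complex 0 (- r)) - Ln (Complex (- r) (- r))))"
    unfolding split 2 using 1[of C1] 1[of C2] n by (simp add: C1_def C2_def C3_def cmul_linear)
  moreover have "- Complex (- r) (- r) = Complex r r" "- Complex (- r) r = Complex r (- r)"
    by (simp_all add: complex_eq_iff)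
  ultimately show ?thesis by (simp add: L algebra_simps)
qed

lemma chain_integral_power_outer:
  assumes "0 < n"
  shows "chain_integral J (\<lambda>z. cmul J (inverse z ^ Suc n)) outer_edges = 0"
proof (rule closed_chain_integral_derivative[OF closed_outer_edges], rule has_cderivative_cmul)
  fix z assume "z \<in> chain_support outer_edges"
  then have "z \<noteq> 0" using outer_edges_norm r_pos by force
  obtain m where m: "n = Suc m" using assms by (cases n) auto
  show "((\<lambda>z. - inverse (of_nat n) * inverse z ^ n) has_field_derivative inverse z ^ Suc n) (at z within chain_support outer_edges)"
  proof -
    have "((\<lambda>z. - inverse (of_nat n) * inverse z ^ Suc m) has_field_derivative
      - inverse (of_nat n) * ((1 + of_nat m) * (- (inverse z ^ Suc (Suc 0)) * inverse z ^ m))) (at z within chain_support outer_edges)"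
      by (intro DERIV_cmult DERIV_power_Suc DERIV_inverse \<open>z \<noteq> 0\<close>)
    moreover have "- inverse (of_nat n) * ((1 + of_nat m) * (- (inverse z ^ Suc (Suc 0)) * inverse z ^ m)) = inverse z ^ Suc n"
    proof -
      have "inverse (of_nat n) * (1 + of_nat m :: complex) = 1"
        unfolding m of_nat_Suc by (rule left_inverse) (simp flip: of_nat_Suc)
      moreover have "- u * (v * (- a * b)) = (u * v) * (a * b)" for u v a b :: complex
        by (simp add: algebra_simps)
      ultimately show ?thesis by (simp add: m del: of_nat_Suc flip: power_add)
    qed
    ultimately show ?thesis by (simp only: m)
  qed
qed

text \<open>
  Iterating \<open>\<R> z = z\<^sup>-\<^sup>1 + z\<^sup>-\<^sup>1 T \<R> z\<close> writes the resolvent as \<open>\<Sum>n<N. z\<^sup>-\<^sup>n\<^sup>-\<^sup>1 T\<^sup>n\<close> plus the remainder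
  \<open>z\<^sup>-\<^sup>N T\<^sup>N \<R> z\<close>. Only the term \<open>n = 0\<close> contributes to the integral, and the remainder is \<open>O((norm T / r)\<^sup>N)\<close>.
\<close>

lemma chain_integral_resolvent_outer: "chain_integral J \<R> outer_edges = cmul J (2 * of_real pi * \<i>)"
proof -
  define C where "C = outer_edges"
  have nz: "z \<noteq> 0" if "z \<in> chain_support C" for z
    using outer_edges_norm that r_pos by (force simp: C_def)
  have cR: "continuous_on (chain_support C) \<R>"
    unfolding C_def by (rule continuous_on_subset[OF continuous_on_resolvent outer_edges_subset])
  define f where "f N z = blinfun_power T N o\<^sub>L (cmul J (inverse z ^ N) o\<^sub>L \<R> z)" for N z
  define K where "K N = chain_integral J (f N) C" for N
  have ci: "continuous_on (chain_support C) (\<lambda>z. cmul J (inverse z ^ N))" for N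
    using nz by (intro continuous_intros) auto
  have cf: "continuous_on (chain_support C) (f N)" for N
    unfolding f_def by (intro continuous_intros ci cR)
  have pJ: "blinfun_power T N o\<^sub>L J = J o\<^sub>L blinfun_power T N" for N
    by (rule blinfun_power_commute[OF T_J])
  have step: "K N = (blinfun_power T N o\<^sub>L chain_integral J (\<lambda>z. cmul J (inverse z ^ Suc N)) C) + K (Suc N)" for N
  proof -
    have "K N = chain_integral J (\<lambda>z. (blinfun_power T N o\<^sub>L cmul J (inverse z ^ Suc N)) + f (Suc N) z) C"
      unfolding K_def
    proof (rule chain_integral_cong)
      fix z assume z: "z \<in> chain_support C"
      have "cmul J (inverse z ^ N) o\<^sub>L \<R> z = cmul J (inverse z ^ Suc N) o\<^sub>L (cmul J z o\<^sub>L \<R> z)"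
      proof -
        have "inverse z ^ Suc N * z = inverse z ^ N" using nz[OF z] by simp
        then show ?thesis by (simp only: cmul_compose)
      qed
      also have "\<dots> = cmul J (inverse z ^ Suc N) + (T o\<^sub>L (cmul J (inverse z ^ Suc N) o\<^sub>L \<R> z))"
        using z outer_edges_subset resolvent_identity[of z]
        by (simp add: C_def subset_iff blinfun_compose_bilinear T_cmul flip: blinfun_compose_assoc)
      finally have e: "f N z = (blinfun_power T N o\<^sub>L cmul J (inverse z ^ Suc N))
          + (blinfun_power T N o\<^sub>L (T o\<^sub>L (cmul J (inverse z ^ Suc N) o\<^sub>L \<R> z)))"
        by (simp only: f_def blinfun_compose_bilinear)
      have "blinfun_power T N o\<^sub>L T = blinfun_power T (Suc N)"
        by (simp add: blinfun_power_commute)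
      then show "f N z = (blinfun_power T N o\<^sub>L cmul J (inverse z ^ Suc N)) + f (Suc N) z"
        unfolding e unfolding f_def by (simp only: blinfun_compose_assoc[symmetric])
    qed
    also have "\<dots> = (blinfun_power T N o\<^sub>L chain_integral J (\<lambda>z. cmul J (inverse z ^ Suc N)) C) + K (Suc N)"
      unfolding K_def
      by (subst chain_integral_add[OF _ cf], intro continuous_intros ci,
          subst chain_integral_compose_left[OF ci pJ]) simp
    finally show ?thesis .
  qed
  have K1: "K (Suc N) = K 1" for N
  proof (induction N)
    case (Suc N)
    then show ?case using step[of "Suc N"] chain_integral_power_outer[of "Suc N"]
      by (simp add: C_def blinfun_compose_bilinear)
  qed simp
  have "bounded (\<R> ` chain_support C)"
    by (intro compact_imp_bounded compact_continuous_image cR compact_chain_support)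
  then obtain M where M: "\<And>z. z \<in> chain_support C \<Longrightarrow> norm (\<R> z) \<le> M" "0 < M"
    by (auto simp: bounded_pos)
  define q where "q = norm T / r"
  have q: "0 \<le> q" "q < 1" using norm_T r_pos by (auto simp: q_def)
  have bound: "norm (K 1) \<le> \<kappa> * (\<kappa> * M) * chain_length C * q ^ Suc N" for N
  proof -
    have "norm (K (Suc N)) \<le> \<kappa> * (norm T ^ Suc N * ((\<kappa> * inverse r ^ Suc N) * M)) * chain_length C"
      unfolding K_def
    proof (rule norm_chain_integral_le[OF cf])
      fix z assume z: "z \<in> chain_support C"
      have "norm (inverse z ^ Suc N) \<le> inverse r ^ Suc N"
        unfolding norm_power norm_inverse
        using outer_edges_norm[of z] z r_pos by (intro power_mono le_imp_inverse_le) (auto simp: C_def)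
      then have "norm (cmul J (inverse z ^ Suc N)) \<le> \<kappa> * inverse r ^ Suc N"
        by (intro order_trans[OF norm_cmul_le] mult_left_mono) auto
      then show "norm (f (Suc N) z) \<le> norm T ^ Suc N * ((\<kappa> * inverse r ^ Suc N) * M)"
        unfolding f_def by (intro norm_blinfun_compose_le norm_blinfun_power M z)
    qed
    also have "\<dots> = \<kappa> * (\<kappa> * M) * chain_length C * q ^ Suc N"
      by (simp only: q_def divide_inverse power_mult_distrib power_inverse mult_ac)
    finally show ?thesis using K1[of N] by simp
  qed
  have "(\<lambda>N. \<kappa> * (\<kappa> * M) * chain_length C * q ^ Suc N) \<longlonglongrightarrow> \<kappa> * (\<kappa> * M) * chain_length C * 0"
    using q by (intro tendsto_mult tendsto_const LIMSEQ_Suc LIMSEQ_realpow_zero)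
  then have "norm (K 1) \<le> 0"
    using bound by (intro LIMSEQ_le_const[of _ 0]) auto
  then have "K 0 = cmul J (2 * of_real pi * \<i>)"
    using step[of 0] chain_integral_inverse_outer by (simp add: C_def)
  then show ?thesis by (simp add: K_def f_def[abs_def] C_def)
qed

definition P where "P = riesz_projector J T (rectpath (Complex (- r) (- r)) (Complex 0 r))"
definition Q where "Q = riesz_projector J T (rectpath (Complex 0 (- r)) (Complex r r))"

definition inv_2pi_i where "inv_2pi_i = 1 / (2 * of_real pi * \<i>)"

lemma P_eq: "P = cmul J inv_2pi_i o\<^sub>L exp_integral left_edges 0"
  and Q_eq: "Q = cmul J inv_2pi_i o\<^sub>L exp_integral right_edges 0"
proof -
  have "exp_integral C 0 = chain_integral J \<R> C" for C
    by (simp add: exp_integral_def)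
  then show "P = cmul J inv_2pi_i o\<^sub>L exp_integral left_edges 0" "Q = cmul J inv_2pi_i o\<^sub>L exp_integral right_edges 0"
    using has_path_integral_unique[OF has_path_integral_rectpath[OF continuous_on_subset[OF continuous_on_resolvent left_edges_subset[unfolded left_edges_def]]]]
      has_path_integral_unique[OF has_path_integral_rectpath[OF continuous_on_subset[OF continuous_on_resolvent right_edges_subset[unfolded right_edges_def]]]]
    by (simp_all add: P_def Q_def inv_2pi_i_def riesz_projector_def left_edges_def right_edges_def)
qed

lemma P_plus_Q: "P + Q = id_blinfun"
proof -
  have "P + Q = cmul J inv_2pi_i o\<^sub>L chain_integral J \<R> outer_edges"
    using left_right_outer[OF continuous_on_resolvent]
    by (simp add: P_eq Q_eq exp_integral_def flip: blinfun_compose_bilinear(2))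
  also have "\<dots> = id_blinfun"
    unfolding chain_integral_resolvent_outer by (simp add: inv_2pi_i_def flip: cmul_mult)
  finally show ?thesis .
qed

lemma exp_integral_commute:
  assumes "T o\<^sub>L B = B o\<^sub>L T" "B o\<^sub>L J = J o\<^sub>L B" "chain_support C \<subseteq> \<Omega>"
  shows "B o\<^sub>L exp_integral C t = exp_integral C t o\<^sub>L B"
proof -
  have cont: "continuous_on (chain_support C) (\<lambda>z. cmul J (exp (of_real t * z)) o\<^sub>L \<R> z)"
    by (intro continuous_on_cmul_resolvent assms continuous_intros)
  show ?thesis
    unfolding exp_integral_def chain_integral_compose_left[OF cont assms(2), symmetric]
      chain_integral_compose_right[OF cont, symmetric]
  proof (rule chain_integral_cong)
    fix z assume z: "z \<in> chain_support C"
    then show "B o\<^sub>L (cmul J (exp (of_real t * z)) o\<^sub>L \<R> z) = (cmul J (exp (of_real t * z)) o\<^sub>L \<R> z) o\<^sub>L B"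
      using resolvent_commute[OF assms(1,2), of z] assms(3) cmul_commute[OF assms(2)]
      by (metis blinfun_compose_assoc subsetD)
  qed
qed

lemma P_commute: assumes "T o\<^sub>L B = B o\<^sub>L T" "B o\<^sub>L J = J o\<^sub>L B" shows "B o\<^sub>L P = P o\<^sub>L B"
  unfolding P_eq using exp_integral_commute[OF assms left_edges_subset, of 0] cmul_commute[OF assms(2)]
  by (metis blinfun_compose_assoc)

text \<open>
  The sign \<open>s\<close> treats both rectangles at once: time runs forward on the left one and backward on
  the right one.
\<close>

lemma exp_decay:
  assumes C: "chain_support C \<subseteq> \<Omega>" "closed_chain C"
    and s: "\<bar>s\<bar> = 1" "\<And>z. z \<in> chain_support C \<Longrightarrow> s * Re z \<le> 0"
  shows "\<exists>K\<ge>0. \<forall>t>0. norm (op_exp (s *\<^sub>R T) t o\<^sub>L (cmul J inv_2pi_i o\<^sub>L exp_integral C 0)) \<le> K / t"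
proof -
  obtain K where K: "0 \<le> K" "\<And>t. (\<forall>z\<in>chain_support C. t * Re z \<le> 0) \<Longrightarrow> norm (t *\<^sub>R exp_integral C t) \<le> K"
    using exp_integral_bound[OF C] by blast
  define Z where "Z t = cmul J inv_2pi_i o\<^sub>L exp_integral C (s * t)" for t
  have "norm (op_exp (s *\<^sub>R T) t o\<^sub>L (cmul J inv_2pi_i o\<^sub>L exp_integral C 0)) \<le> \<kappa> * norm inv_2pi_i * K / t" if t: "0 < t" for t
  proof -
    have "Z t = op_exp (s *\<^sub>R T) t o\<^sub>L Z 0"
    proof (rule op_exp_unique)
      fix t :: real assume "0 \<le> t"
      have "((exp_integral C \<circ> (\<lambda>t. s * t)) has_vector_derivative s *\<^sub>R (T o\<^sub>L exp_integral C (s * t))) (at t within {0..})"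
        by (rule vector_diff_chain_within) (auto intro!: derivative_eq_intros exp_integral_derivative C)
      then have "(Z has_vector_derivative cmul J inv_2pi_i o\<^sub>L (s *\<^sub>R (T o\<^sub>L exp_integral C (s * t)))) (at t within {0..})"
        unfolding Z_def[abs_def] o_def
        by (rule bounded_linear.has_vector_derivative[OF bounded_linear_compose_right])
      then show "(Z has_vector_derivative (s *\<^sub>R T o\<^sub>L Z t)) (at t within {0..})"
        unfolding Z_def by (simp add: blinfun_compose_bilinear T_cmul flip: blinfun_compose_assoc)
    qed (use t in simp)
    moreover have "norm (Z t) \<le> \<kappa> * norm inv_2pi_i * (K / t)"
      unfolding Z_def
    proof (intro norm_blinfun_compose_le norm_cmul_le)
      have "norm ((s * t) *\<^sub>R exp_integral C (s * t)) \<le> K"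
      proof (rule K(2), rule ballI)
        fix z assume "z \<in> chain_support C"
        then have "t * (s * Re z) \<le> 0"
          by (rule mult_nonneg_nonpos[OF less_imp_le[OF t] s(2)])
        then show "s * t * Re z \<le> 0" by (simp add: mult_ac)
      qed
      then show "norm (exp_integral C (s * t)) \<le> K / t"
        using t s(1) by (simp add: abs_mult field_simps)
    qed
    ultimately show ?thesis by (simp add: Z_def)
  qed
  then show ?thesis
    by (intro exI[of _ "\<kappa> * norm inv_2pi_i * K"]) (use K(1) in auto)
qed

lemma riesz_decay:
  "\<exists>K. \<forall>t>0. norm (op_exp T t o\<^sub>L P) \<le> K / t \<and> norm (op_exp (- T) t o\<^sub>L Q) \<le> K / t"
proof -
  obtain K1 where K1: "\<forall>t>0. norm (op_exp T t o\<^sub>L P) \<le> K1 / t"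
    using exp_decay[OF left_edges_subset closed_left_edges, of 1] left_edges_nonpos
    by (auto simp: P_eq)
  obtain K2 where K2: "\<forall>t>0. norm (op_exp (- T) t o\<^sub>L Q) \<le> K2 / t"
    using exp_decay[OF right_edges_subset closed_right_edges, of "- 1"] right_edges_nonneg
    by (auto simp: Q_eq)
  have le: "K1 / t \<le> max K1 K2 / t" "K2 / t \<le> max K1 K2 / t" if "0 < t" for t
    using that by (auto intro!: divide_right_mono)
  then have "norm (op_exp T t o\<^sub>L P) \<le> max K1 K2 / t \<and> norm (op_exp (- T) t o\<^sub>L Q) \<le> max K1 K2 / t"
    if "0 < t" for t
    using order_trans[OF K1[rule_format, OF that] le(1)[OF that]]
      order_trans[OF K2[rule_format, OF that] le(2)[OF that]] by simp
  then show ?thesis by blast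
qed

end

subsection \<open>Descent to the original space\<close>

text \<open>
  Vectors that are both stable and unstable vanish. Thus the spectral projectors are orthogonal, hence
  idempotent, as a consequence of their dynamics.
\<close>

lemma splitting_orthogonal:
  fixes T P Q :: "'e::banach \<Rightarrow>\<^sub>L 'e"
  assumes "P + Q = id_blinfun" "T o\<^sub>L P = P o\<^sub>L T"
    and "\<And>t. 0 < t \<Longrightarrow> norm (op_exp T t o\<^sub>L P) \<le> K / t"
    and "\<And>t. 0 < t \<Longrightarrow> norm (op_exp (- T) t o\<^sub>L Q) \<le> K / t"
  shows "P o\<^sub>L Q = 0" "Q o\<^sub>L P = 0"
proof -
  note P = tendsto_0_of_inverse_time_bound[of "\<lambda>t. op_exp T t o\<^sub>L P", OF assms(3)]
  note Q = tendsto_0_of_inverse_time_bound[of "\<lambda>t. op_exp (- T) t o\<^sub>L Q", OF assms(4)]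
  show "P o\<^sub>L Q = 0" by (rule stable_compose_unstable[OF assms(2) P Q])
  have "Q = id_blinfun - P" using assms(1) by (simp add: algebra_simps)
  then have "- T o\<^sub>L Q = Q o\<^sub>L - T" using assms(2) by (simp add: blinfun_compose_bilinear)
  from stable_compose_unstable[OF this Q] P show "Q o\<^sub>L P = 0" by simp
qed

context hyperbolic_operator
begin

lemma T_P: "T o\<^sub>L P = P o\<^sub>L T" and J_P: "J o\<^sub>L P = P o\<^sub>L J"
  using P_commute[of T] P_commute[of J] T_J by simp_all

end

lemma range_projection:
  fixes P Q :: "'e::real_normed_vector \<Rightarrow>\<^sub>L 'e"
  assumes "P + Q = id_blinfun" "Q o\<^sub>L P = 0" shows "x \<in> range P \<longleftrightarrow> P x = x"
proof
  assume "x \<in> range P"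
  then obtain y where "x = P y" by blast
  moreover have "P (P y) + Q (P y) = P y"
    using arg_cong[OF assms(1), of "\<lambda>A. blinfun_apply A (P y)"] by (simp add: blinfun.add_left)
  moreover have "Q (P y) = 0" using arg_cong[OF assms(2), of "\<lambda>A. blinfun_apply A y"] by simp
  ultimately show "P x = x" by simp
qed (metis rangeI)

lemma inj_complex_of_scalar: "inj (complex_of_scalar :: 'k::real_or_complex \<Rightarrow> complex)"
proof (rule injI)
  fix a b :: 'k assume eq: "complex_of_scalar a = complex_of_scalar b"
  have "complex_of_scalar (a - b) + complex_of_scalar b = complex_of_scalar a"
    by (simp flip: complex_of_scalar_add)
  then show "a = b" using eq norm_complex_of_scalar[of "a - b"] by simp
qed

lemma complex_of_scalar_of_real: "complex_of_scalar (of_real r :: 'k::real_or_complex) = of_real r"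
  using complex_of_scalar_scaleR[of r "1 :: 'k"]
  by (simp add: scaleR_conv_of_real complex_of_scalar_one)

text \<open>
  If some scalar had a nonreal image, that image and \<open>1\<close> would span the complex plane.
\<close>

lemma scalar_of_real:
  assumes "\<not> surj (complex_of_scalar :: 'k::real_or_complex \<Rightarrow> complex)"
  shows "\<exists>r. (c :: 'k) = of_real r"
proof -
  have Im: "Im (complex_of_scalar c) = 0"
  proof (rule ccontr)
    assume nz: "Im (complex_of_scalar c) \<noteq> 0"
    have "\<exists>d. complex_of_scalar (d :: 'k) = z" for z
    proof
      define s where "s = Im z / Im (complex_of_scalar c)"
      show "complex_of_scalar (of_real (Re z - s * Re (complex_of_scalar c)) + s *\<^sub>R c) = z"
        unfolding complex_of_scalar_add complex_of_scalar_of_real complex_of_scalar_scaleR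
        using nz by (simp add: complex_eq_iff s_def)
    qed
    then show False using assms by (metis surjI)
  qed
  have "complex_of_scalar c = complex_of_scalar (of_real (Re (complex_of_scalar c)) :: 'k)"
    unfolding complex_of_scalar_of_real using Im by (simp add: complex_eq_iff)
  then show ?thesis using inj_complex_of_scalar by (auto dest: injD)
qed

context banach_over
begin

lemma bounded_linear_smul: "bounded_linear (smul c)"
proof (rule bounded_linear_intro)
  fix x y and r :: real
  show "smul c (x + y) = smul c x + smul c y" by (rule scale_right_distrib)
  show "smul c (r *\<^sub>R x) = r *\<^sub>R smul c x"
    by (simp add: mult.commute flip: smul_of_real)
  show "norm (smul c x) \<le> norm x * norm c" by (simp add: norm_smul)
qed

lemma bounded_operators_real:
  assumes "\<not> surj (complex_of_scalar :: 'k \<Rightarrow> complex)" shows "B \<in> bounded_operators smul"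
  unfolding bounded_operators_def
proof (intro CollectI allI)
  fix c :: 'k and x
  obtain r where "c = of_real r" using scalar_of_real[OF assms] by blast
  then show "B (smul c x) = smul c (B x)" by (simp add: smul_of_real blinfun.scaleR_right)
qed

lemma smul_i_apply: "smul_i smul x = smul (inv complex_of_scalar \<i>) x"
  by (simp add: smul_i_def bounded_linear_Blinfun_apply bounded_linear_smul)

text \<open>
  Every scalar is a real combination of \<open>1\<close> and the preimage of \<open>\<i>\<close>.
\<close>

lemma bounded_operators_complex:
  assumes surj: "surj (complex_of_scalar :: 'k \<Rightarrow> complex)"
  shows "B \<in> bounded_operators smul \<longleftrightarrow> B o\<^sub>L smul_i smul = smul_i smul o\<^sub>L B"
proof
  assume "B \<in> bounded_operators smul"
  then show "B o\<^sub>L smul_i smul = smul_i smul o\<^sub>L B"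
    by (intro blinfun_eqI) (simp add: smul_i_apply bounded_operators_def)
next
  assume comm: "B o\<^sub>L smul_i smul = smul_i smul o\<^sub>L B"
  define \<iota> where "\<iota> = inv (complex_of_scalar :: 'k \<Rightarrow> complex) \<i>"
  have \<iota>: "complex_of_scalar \<iota> = \<i>" unfolding \<iota>_def by (rule surj_f_inv_f[OF surj])
  show "B \<in> bounded_operators smul"
    unfolding bounded_operators_def
  proof (intro CollectI allI)
    fix c :: 'k and x
    define z where "z = complex_of_scalar c"
    have "complex_of_scalar c = complex_of_scalar (of_real (Re z) + of_real (Im z) * \<iota>)"
      unfolding complex_of_scalar_add complex_of_scalar_mult complex_of_scalar_of_real \<iota> z_def
      by (simp add: complex_eq_iff)
    then have c: "c = of_real (Re z) + of_real (Im z) * \<iota>" using inj_complex_of_scalar by (auto dest: injD)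
    have s: "smul c x = Re z *\<^sub>R x + Im z *\<^sub>R smul_i smul x" for x
      unfolding c smul_i_apply \<iota>_def[symmetric]
      by (simp add: scale_left_distrib smul_of_real flip: scale_scale)
    have "B (smul_i smul x) = smul_i smul (B x)"
      using arg_cong[OF comm, of "\<lambda>A. blinfun_apply A x"] by simp
    then show "B (smul c x) = smul c (B x)"
      by (simp add: s blinfun.add_right blinfun.scaleR_right)
  qed
qed

lemma smul_i_squared:
  assumes surj: "surj (complex_of_scalar :: 'k \<Rightarrow> complex)"
  shows "smul_i smul o\<^sub>L smul_i smul = - id_blinfun"
proof -
  define \<iota> where "\<iota> = inv (complex_of_scalar :: 'k \<Rightarrow> complex) \<i>"
  have \<iota>: "complex_of_scalar \<iota> = \<i>" unfolding \<iota>_def by (rule surj_f_inv_f[OF surj])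
  have "complex_of_scalar (\<iota> * \<iota>) = complex_of_scalar (of_real (- 1) :: 'k)"
    unfolding complex_of_scalar_mult complex_of_scalar_of_real \<iota> by simp
  then have "\<iota> * \<iota> = of_real (- 1)" using inj_complex_of_scalar by (auto dest: injD)
  then have "smul (\<iota> * \<iota>) x = - x" for x using smul_of_real[of "- 1" x] by simp
  then show ?thesis
    by (intro blinfun_eqI) (simp add: smul_i_apply \<iota>_def[symmetric] blinfun.minus_left)
qed

end

lemma complexify_apply: "complexify T v = (T (fst v), T (snd v))"
  by transfer (simp add: split_beta)

lemma complexification_J_apply: "complexification_J v = (- snd v, fst v)"
  by transfer (simp add: split_beta)

lemma norm_complexify_le: "norm (complexify T) \<le> norm T"
proof (rule norm_blinfun_bound)
  fix v :: "'a \<times> 'a"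
  have "norm (complexify T v) = sqrt ((norm (T (fst v)))\<^sup>2 + (norm (T (snd v)))\<^sup>2)"
    by (simp add: complexify_apply norm_Pair)
  also have "\<dots> \<le> sqrt ((norm T * norm (fst v))\<^sup>2 + (norm T * norm (snd v))\<^sup>2)"
    by (intro real_sqrt_le_mono add_mono power_mono norm_blinfun) auto
  also have "\<dots> = norm T * norm v"
    by (simp add: norm_prod_def power_mult_distrib real_sqrt_mult flip: distrib_left)
  finally show "norm (complexify T v) \<le> norm T * norm v" .
qed simp

lemma bounded_linear_complexify: "bounded_linear complexify"
proof (rule bounded_linear_intro)
  show "norm (complexify T) \<le> norm T * 1" for T :: "'a \<Rightarrow>\<^sub>L 'a" using norm_complexify_le by simp
qed (auto intro!: blinfun_eqI simp: complexify_apply blinfun.bilinear_simps)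

lemma complexify_compose: "complexify (A o\<^sub>L B) = complexify A o\<^sub>L complexify B"
  by (intro blinfun_eqI) (simp add: complexify_apply)

lemma op_exp_complexify:
  fixes T :: "'a::banach \<Rightarrow>\<^sub>L 'a"
  assumes "0 \<le> t" shows "op_exp (complexify T) t = complexify (op_exp T t)"
proof -
  have "complexify (op_exp T t) = op_exp (complexify T) t o\<^sub>L complexify (op_exp T 0)"
  proof (rule op_exp_unique[OF _ assms])
    fix t :: real assume "0 \<le> t"
    from bounded_linear.has_vector_derivative[OF bounded_linear_complexify op_exp_derivative[OF this]]
    show "((\<lambda>t. complexify (op_exp T t)) has_vector_derivative (complexify T o\<^sub>L complexify (op_exp T t))) (at t within {0..})"
      by (simp add: complexify_compose)
  qed
  moreover have "complexify (id_blinfun :: 'a \<Rightarrow>\<^sub>L 'a) = id_blinfun"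
    by (intro blinfun_eqI) (simp add: complexify_apply)
  ultimately show ?thesis by (simp add: op_exp_0)
qed

text \<open>
  Let \<open>p x\<close> and \<open>b x\<close> be the real and imaginary part of \<open>P (x, 0)\<close>. Since \<open>P + Q\<close> is the identity, the
  imaginary part of \<open>Q (x, 0)\<close> is \<open>- b x\<close>. Hence \<open>b\<close> decays under both the forward and the backward
  exponential, and composing it with \<open>p\<close> and \<open>q\<close> shows \<open>b = 0\<close>: the projectors are real.
\<close>

lemma splitting_of_complexification:
  fixes T :: "'a::banach \<Rightarrow>\<^sub>L 'a" and P Q :: "('a \<times> 'a) \<Rightarrow>\<^sub>L ('a \<times> 'a)"
  assumes PQ: "P + Q = id_blinfun" "complexify T o\<^sub>L P = P o\<^sub>L complexify T"
    and P: "\<And>t. 0 < t \<Longrightarrow> norm (op_exp (complexify T) t o\<^sub>L P) \<le> K / t"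
    and Q: "\<And>t. 0 < t \<Longrightarrow> norm (op_exp (- complexify T) t o\<^sub>L Q) \<le> K / t"
  obtains p q where "p + q = id_blinfun" "T o\<^sub>L p = p o\<^sub>L T"
    "\<And>t. 0 < t \<Longrightarrow> norm (op_exp T t o\<^sub>L p) \<le> K / t"
    "\<And>t. 0 < t \<Longrightarrow> norm (op_exp (- T) t o\<^sub>L q) \<le> K / t"
    "range p = {x. (x, 0) \<in> range P}" "range q = {x. (x, 0) \<in> range Q}"
proof -
  define i :: "'a \<Rightarrow>\<^sub>L ('a \<times> 'a)" where "i = Blinfun (\<lambda>x. (x, 0))"
  have i: "i x = (x, 0)" for x
    unfolding i_def by (subst bounded_linear_Blinfun_apply) (auto intro!: bounded_linear_Pair)
  have norm_i: "norm i \<le> 1" by (rule norm_blinfun_bound) (auto simp: i norm_Pair)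
  have norm_fst: "norm (fst_blinfun :: ('a \<times> 'a) \<Rightarrow>\<^sub>L 'a) \<le> 1"
    by (rule norm_blinfun_bound) (auto simp: norm_fst_le)
  have norm_snd: "norm (snd_blinfun :: ('a \<times> 'a) \<Rightarrow>\<^sub>L 'a) \<le> 1"
    by (rule norm_blinfun_bound) (auto simp: norm_snd_le)
  have mT: "- complexify T = complexify (- T)"
    by (intro blinfun_eqI) (simp add: complexify_apply blinfun.minus_left)
  have T_PQ: "T (fst (R (x, 0))) = fst (R (T x, 0))" "T (snd (R (x, 0))) = snd (R (T x, 0))"
    if "complexify T o\<^sub>L R = R o\<^sub>L complexify T" for R x
  proof -
    have "R (T x, 0) = (T (fst (R (x, 0))), T (snd (R (x, 0))))"
      using arg_cong[OF that, of "\<lambda>A. blinfun_apply A (x, 0)"] by (simp add: complexify_apply)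
    then show "T (fst (R (x, 0))) = fst (R (T x, 0))" "T (snd (R (x, 0))) = snd (R (T x, 0))"
      by simp_all
  qed
  have bound: "norm (op_exp S t o\<^sub>L (\<pi> o\<^sub>L (R o\<^sub>L i))) \<le> K / t"
    if "0 < t" "norm (op_exp (complexify S) t o\<^sub>L R) \<le> K / t" "\<pi> = fst_blinfun \<or> \<pi> = snd_blinfun"
    for S :: "'a \<Rightarrow>\<^sub>L 'a" and R t and \<pi> :: "('a \<times> 'a) \<Rightarrow>\<^sub>L 'a"
  proof -
    have "op_exp S t o\<^sub>L (\<pi> o\<^sub>L (R o\<^sub>L i)) = \<pi> o\<^sub>L ((op_exp (complexify S) t o\<^sub>L R) o\<^sub>L i)"
      using that(1,3) by (intro blinfun_eqI) (auto simp: op_exp_complexify complexify_apply)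
    also have "norm \<dots> \<le> 1 * (K / t * 1)"
      using that norm_fst norm_snd by (intro norm_blinfun_compose_le norm_i) auto
    finally show ?thesis by simp
  qed
  define p q b where "p = fst_blinfun o\<^sub>L (P o\<^sub>L i)" "q = fst_blinfun o\<^sub>L (Q o\<^sub>L i)" "b = snd_blinfun o\<^sub>L (P o\<^sub>L i)"
  note defs = this
  have sum: "P v + Q v = v" for v
    using arg_cong[OF PQ(1), of "\<lambda>A. blinfun_apply A v"] by (simp add: blinfun.add_left)
  have pq: "p + q = id_blinfun"
  proof (rule blinfun_eqI)
    fix x show "(p + q) x = id_blinfun x"
      using arg_cong[OF sum[of "(x, 0)"], of fst] by (simp add: defs i blinfun.add_left)
  qed
  have b': "- b = snd_blinfun o\<^sub>L (Q o\<^sub>L i)"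
  proof (rule blinfun_eqI)
    fix x show "(- b) x = (snd_blinfun o\<^sub>L (Q o\<^sub>L i)) x"
      using arg_cong[OF sum[of "(x, 0)"], of snd]
      by (simp add: defs i blinfun.minus_left add_eq_0_iff)
  qed
  have Tp: "T o\<^sub>L p = p o\<^sub>L T"
    by (intro blinfun_eqI) (simp add: defs i T_PQ[OF PQ(2)])
  have p: "norm (op_exp T t o\<^sub>L p) \<le> K / t" "norm (op_exp T t o\<^sub>L b) \<le> K / t" if "0 < t" for t
    unfolding defs using that P by (auto intro!: bound)
  have q: "norm (op_exp (- T) t o\<^sub>L q) \<le> K / t" "norm (op_exp (- T) t o\<^sub>L - b) \<le> K / t" if "0 < t" for t
    unfolding b' unfolding defs using that Q by (auto intro!: bound simp: mT)
  have "q = id_blinfun - p" using pq by (simp add: algebra_simps)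
  then have Tq: "- T o\<^sub>L q = q o\<^sub>L - T" using Tp by (simp add: blinfun_compose_bilinear)
  have "p o\<^sub>L - b = 0"
    by (rule stable_compose_unstable[OF Tp]) (rule tendsto_0_of_inverse_time_bound, use p q in blast)+
  moreover have "((\<lambda>t. op_exp (- T) t o\<^sub>L q) \<longlongrightarrow> 0) at_top" "((\<lambda>t. op_exp T t o\<^sub>L b) \<longlongrightarrow> 0) at_top"
    by (rule tendsto_0_of_inverse_time_bound, use p q in blast)+
  then have "q o\<^sub>L b = 0" using stable_compose_unstable[OF Tq, of b] by simp
  ultimately have "(p + q) o\<^sub>L b = 0" by (simp add: blinfun_compose_bilinear)
  then have b0: "b = 0" by (simp add: pq)
  have Pi: "P (x, 0) = (p x, 0)" for x
    using arg_cong[OF b0, of "\<lambda>A. blinfun_apply A x"] by (simp add: defs i prod_eq_iff)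
  have Qi: "Q (x, 0) = (q x, 0)" for x
    using arg_cong[OF b'[unfolded b0], of "\<lambda>A. blinfun_apply A x"] by (simp add: defs i prod_eq_iff)
  have orth: "P o\<^sub>L Q = 0" "Q o\<^sub>L P = 0" using splitting_orthogonal[OF PQ P Q] by auto
  have "Q + P = id_blinfun" using PQ(1) by (simp add: add.commute)
  then have rQ: "v \<in> range Q \<longleftrightarrow> Q v = v" and rP: "v \<in> range P \<longleftrightarrow> P v = v" for v
    using range_projection[of Q P v] range_projection[OF PQ(1), of v] orth by auto
  have orth': "p o\<^sub>L q = 0" "q o\<^sub>L p = 0" using splitting_orthogonal[OF pq Tp p(1) q(1)] by auto
  have "q + p = id_blinfun" using pq by (simp add: add.commute)
  then have rq: "v \<in> range q \<longleftrightarrow> q v = v" and rp: "v \<in> range p \<longleftrightarrow> p v = v" for v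
    using range_projection[of q p v] range_projection[OF pq, of v] orth' by auto
  have "range p = {x. (x, 0) \<in> range P}" "range q = {x. (x, 0) \<in> range Q}"
    by (simp_all only: set_eq_iff mem_Collect_eq rP rQ rp rq Pi Qi prod.inject) auto
  with pq Tp p(1) q(1) show ?thesis by (rule that)
qed

lemma (in banach_over) hyperbolic_splitting:
  assumes T: "T \<in> bounded_operators smul" and hyp: "hyperbolic smul T"
  obtains p q K where "p + q = id_blinfun" "T o\<^sub>L p = p o\<^sub>L T"
    "\<And>t. 0 < t \<Longrightarrow> norm (op_exp T t o\<^sub>L p) \<le> K / t"
    "\<And>t. 0 < t \<Longrightarrow> norm (op_exp (- T) t o\<^sub>L q) \<le> K / t"
    "p \<in> bounded_operators smul" "q \<in> bounded_operators smul"
    "range p = negative_subspace smul T" "range q = positive_subspace smul T"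
proof (cases "surj (complex_of_scalar :: 'k \<Rightarrow> complex)")
  case True
  define J where "J = smul_i smul"
  interpret hyperbolic_operator J T "norm T + 1"
    by unfold_locales
      (use hyp T True in \<open>auto simp: J_def smul_i_squared bounded_operators_complex hyperbolic_def spectrum_def\<close>)
  obtain K where K: "\<forall>t>0. norm (op_exp T t o\<^sub>L P) \<le> K / t \<and> norm (op_exp (- T) t o\<^sub>L Q) \<le> K / t"
    using riesz_decay by blast
  have "Q = id_blinfun - P" using P_plus_Q by (simp add: algebra_simps)
  then have "Q o\<^sub>L J = J o\<^sub>L Q" using J_P by (simp add: blinfun_compose_bilinear)
  then have "P \<in> bounded_operators smul" "Q \<in> bounded_operators smul"
    using J_P True by (auto simp: J_def bounded_operators_complex)
  moreover have "range P = negative_subspace smul T" "range Q = positive_subspace smul T"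
    unfolding P_def Q_def unfolding J_def negative_subspace_def positive_subspace_def Let_def
      spectral_subspace_def using True by simp_all
  ultimately show ?thesis using that[OF P_plus_Q T_P] K by blast
next
  case False
  interpret hyperbolic_operator complexification_J "complexify T" "norm T + 1"
  proof
    show "norm (complexify T) < norm T + 1" using norm_complexify_le[of T] by simp
  qed (use hyp False in \<open>auto intro!: blinfun_eqI
        simp: complexification_J_apply complexify_apply hyperbolic_def spectrum_def blinfun.bilinear_simps\<close>)
  obtain K where K: "\<And>t. 0 < t \<Longrightarrow> norm (op_exp (complexify T) t o\<^sub>L P) \<le> K / t"
    "\<And>t. 0 < t \<Longrightarrow> norm (op_exp (- complexify T) t o\<^sub>L Q) \<le> K / t"
    using riesz_decay by blast
  show ?thesis
  proof (rule splitting_of_complexification[OF P_plus_Q T_P K])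
    fix p q
    assume pq: "p + q = id_blinfun" "T o\<^sub>L p = p o\<^sub>L T"
      "\<And>t. 0 < t \<Longrightarrow> norm (op_exp T t o\<^sub>L p) \<le> K / t"
      "\<And>t. 0 < t \<Longrightarrow> norm (op_exp (- T) t o\<^sub>L q) \<le> K / t"
      and r: "range p = {x. (x, 0) \<in> range P}" "range q = {x. (x, 0) \<in> range Q}"
    have "range p = negative_subspace smul T" "range q = positive_subspace smul T"
      unfolding r P_def Q_def negative_subspace_def positive_subspace_def Let_def
        spectral_subspace_def using False by simp_all
    with pq bounded_operators_real[OF False] bounded_operators_real[OF False] show ?thesis
      by (rule that)
  qed
qed

section \<open>Complementary closed subspaces\<close>

text \<open>
  The first half of the open mapping argument. The closures of the sets of all \<open>v + w\<close> with
  \<open>norm v \<le> n\<close> cover the space, so by Baire's theorem one of them contains a ball, and by convexity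
  and symmetry a ball about \<open>0\<close>.
\<close>

lemma approximate_decomposition:
  fixes V W :: "'a::banach set"
  assumes V: "subspace V" and W: "subspace W" and sum: "\<And>z. \<exists>v\<in>V. \<exists>w\<in>W. z = v + w"
  shows "\<exists>c>0. \<forall>z. \<exists>v\<in>V. \<exists>w\<in>W. norm v \<le> c * norm z \<and> norm (z - v - w) \<le> norm z / 2"
proof -
  define S where "S n = {v + w |v w. v \<in> V \<and> w \<in> W \<and> norm v \<le> real n}" for n
  have "\<Union> (range (\<lambda>n. closure (S n))) = UNIV"
  proof -
    have "\<exists>n. z \<in> S n" for z
    proof -
      obtain v w where vw: "v \<in> V" "w \<in> W" "z = v + w" using sum by blast
      obtain n where "norm v \<le> real n" using real_arch_simple by blast
      then show ?thesis using vw unfolding S_def by blast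
    qed
    then show ?thesis using closure_subset by fastforce
  qed
  moreover have "euclidean interior_of \<Union> (range (\<lambda>n. closure (S n))) = {}"
    if "\<And>n. interior (closure (S n)) = {}"
    by (rule Baire_category_alt)
      (use that in \<open>auto simp: completely_metrizable_space_euclidean\<close>)
  ultimately obtain n where "interior (closure (S n)) \<noteq> {}"
    by auto
  then obtain x where "x \<in> interior (closure (S n))" by blast
  then obtain e where e: "0 < e" "ball x e \<subseteq> closure (S n)"
    by (meson interior_subset mem_interior)
  have "convex (S n)"
    unfolding convex_alt
  proof (intro ballI allI impI)
    fix y z and u :: real
    assume "y \<in> S n" "z \<in> S n" and u: "0 \<le> u \<and> u \<le> 1"
    then obtain v1 w1 v2 w2 where 1: "y = v1 + w1" "z = v2 + w2" "v1 \<in> V" "w1 \<in> W" "v2 \<in> V" "w2 \<in> W"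
      and n: "norm v1 \<le> n" "norm v2 \<le> n"
      unfolding S_def by blast
    have "(1 - u) *\<^sub>R v1 + u *\<^sub>R v2 \<in> V" "(1 - u) *\<^sub>R w1 + u *\<^sub>R w2 \<in> W"
      using V W 1 by (auto intro!: subspace_add subspace_scale)
    moreover have "norm ((1 - u) *\<^sub>R v1 + u *\<^sub>R v2) \<le> (1 - u) * n + u * n"
      using u n by (intro norm_triangle_le add_mono) (auto intro: mult_left_mono)
    then have "norm ((1 - u) *\<^sub>R v1 + u *\<^sub>R v2) \<le> n" by (simp add: algebra_simps)
    moreover have "(1 - u) *\<^sub>R y + u *\<^sub>R z = ((1 - u) *\<^sub>R v1 + u *\<^sub>R v2) + ((1 - u) *\<^sub>R w1 + u *\<^sub>R w2)"
      by (simp add: 1 algebra_simps)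
    ultimately show "(1 - u) *\<^sub>R y + u *\<^sub>R z \<in> S n" unfolding S_def by blast
  qed
  then have conv: "convex (closure (S n))" by (rule convex_closure)
  have "uminus ` S n \<subseteq> S n"
  proof
    fix y assume "y \<in> uminus ` S n"
    then obtain v w where "y = - v + - w" "v \<in> V" "w \<in> W" "norm v \<le> n"
      unfolding S_def by auto
    then show "y \<in> S n" using subspace_neg[OF V] subspace_neg[OF W] unfolding S_def
      by (metis (mono_tags, lifting) mem_Collect_eq norm_minus_cancel)
  qed
  then have sym: "- y \<in> closure (S n)" if y: "y \<in> closure (S n)" for y
    unfolding closure_approachable
  proof (intro allI impI)
    fix d :: real assume "0 < d"
    then obtain s where "s \<in> S n" "dist s y < d"
      using y[unfolded closure_approachable] by blast
    then show "\<exists>s\<in>S n. dist s (- y) < d"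
      using \<open>uminus ` S n \<subseteq> S n\<close> dist_minus[of s y] by (intro bexI[of _ "- s"]) auto
  qed
  have ball: "z \<in> closure (S n)" if "norm z < e" for z
  proof -
    have "x + z \<in> closure (S n)" "x - z \<in> closure (S n)"
      using that e(2) by (auto simp: dist_norm subset_iff)
    then have "(1 / 2) *\<^sub>R (x + z) + (1 / 2) *\<^sub>R - (x - z) \<in> closure (S n)"
      by (intro convexD[OF conv] sym) simp_all
    then show ?thesis by (simp add: algebra_simps flip: scaleR_add_left)
  qed
  define c where "c = 2 * (real n + 1) / e"
  have "\<exists>v\<in>V. \<exists>w\<in>W. norm v \<le> c * norm z \<and> norm (z - v - w) \<le> norm z / 2" for z
  proof (cases "z = 0")
    case True
    then show ?thesis using V W by (intro bexI[of _ 0]) (auto simp: subspace_0)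
  next
    case False
    \<comment> \<open>Rescaling \<open>z\<close> to half the radius of the ball.\<close>
    define t where "t = e / (2 * norm z)"
    have t: "0 < t" using e False by (simp add: t_def)
    have "norm (t *\<^sub>R z) < e" using e False by (simp add: t_def)
    then have "t *\<^sub>R z \<in> closure (S n)" by (rule ball)
    then obtain y where "y \<in> S n" "dist y (t *\<^sub>R z) < e / 4"
      using e by (meson closure_approachable divide_pos_pos zero_less_numeral)
    then obtain v w where vw: "v \<in> V" "w \<in> W" "norm v \<le> n" "norm (t *\<^sub>R z - (v + w)) < e / 4"
      unfolding S_def by (auto simp: dist_norm norm_minus_commute)
    have "norm ((1 / t) *\<^sub>R v) \<le> c * norm z"
    proof -
      have "norm v * (2 * norm z) \<le> (real n + 1) * (2 * norm z)"
        using vw(3) by (intro mult_right_mono) auto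
      then show ?thesis using e False by (simp add: t_def c_def field_simps)
    qed
    moreover have "norm (z - (1 / t) *\<^sub>R v - (1 / t) *\<^sub>R w) \<le> norm z / 2"
    proof -
      have "z - (1 / t) *\<^sub>R v - (1 / t) *\<^sub>R w = (1 / t) *\<^sub>R (t *\<^sub>R z - (v + w))"
        using t by (simp add: algebra_simps)
      also have "norm \<dots> = (1 / t) * norm (t *\<^sub>R z - (v + w))" using t by simp
      also have "\<dots> \<le> (1 / t) * (e / 4)" using vw(4) t by (intro mult_left_mono) auto
      also have "\<dots> = norm z / 2" using e False by (simp add: t_def field_simps)
      finally show ?thesis .
    qed
    ultimately show ?thesis using vw V W by (meson subspace_scale)
  qed
  moreover have "0 < c" using e by (simp add: c_def)
  ultimately show ?thesis by blast
qed

text \<open>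
  The second half: the remainders \<open>z k\<close> of repeated approximate decompositions are halved in each step,
  and the pieces sum up to elements of \<open>V\<close> and \<open>W\<close>, because these are closed.
\<close>

lemma complementary_projection_bounded:
  fixes V W :: "'a::banach set"
  assumes V: "subspace V" "closed V" and W: "subspace W" "closed W"
    and int: "V \<inter> W = {0}" and sum: "\<And>z. \<exists>v\<in>V. \<exists>w\<in>W. z = v + w"
  shows "\<exists>c>0. \<forall>v\<in>V. \<forall>w\<in>W. norm v \<le> c * norm (v + w)"
proof -
  obtain c where c: "0 < c"
    and "\<forall>z. \<exists>v\<in>V. \<exists>w\<in>W. norm v \<le> c * norm z \<and> norm (z - v - w) \<le> norm z / 2"
    using approximate_decomposition[OF V(1) W(1) sum] by blast
  then obtain f g where f: "\<And>z. f z \<in> V" "\<And>z. norm (f z) \<le> c * norm z"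
    and g: "\<And>z. g z \<in> W" and fg: "\<And>z. norm (z - f z - g z) \<le> norm z / 2"
    by metis
  have "norm v \<le> 2 * c * norm (v + w)" if vw: "v \<in> V" "w \<in> W" for v w
  proof -
    define z where "z k = ((\<lambda>z. z - f z - g z) ^^ k) (v + w)" for k
    have z: "z 0 = v + w" "z (Suc k) = z k - f (z k) - g (z k)" for k by (simp_all add: z_def)
    have zk: "norm (z k) \<le> (1 / 2) ^ k * norm (v + w)" for k
    proof (induction k)
      case (Suc k)
      then show ?case using fg[of "z k"] by (simp add: z(2))
    qed (simp add: z)
    have fk: "norm (f (z k)) \<le> c * norm (v + w) * (1 / 2) ^ k" for k
    proof -
      have "norm (f (z k)) \<le> c * norm (z k)" by (rule f(2))
      also have "\<dots> \<le> c * ((1 / 2) ^ k * norm (v + w))" using c zk by (intro mult_left_mono) auto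
      finally show ?thesis by (simp add: mult_ac)
    qed
    have sg: "(\<lambda>k. c * norm (v + w) * (1 / 2) ^ k) sums (c * norm (v + w) * 2)"
      using sums_mult[OF geometric_sums[of "1 / 2 :: real"]] by simp
    have sf: "summable (\<lambda>k. f (z k))"
      by (rule summable_comparison_test'[OF sums_summable[OF sg]]) (rule fk)
    define v' where "v' = (\<Sum>k. f (z k))"
    have v'lim: "(\<lambda>n. \<Sum>k<n. f (z k)) \<longlonglongrightarrow> v'"
      unfolding v'_def using sf by (rule summable_LIMSEQ)
    have v': "v' \<in> V"
      by (rule closed_sequentially[OF V(2) _ v'lim]) (auto intro!: subspace_sum V f)
    \<comment> \<open>The \<open>W\<close>-pieces converge because the \<open>V\<close>-pieces do and the remainders tend to \<open>0\<close>.\<close>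
    have part: "(\<Sum>k<n. g (z k)) = v + w - z n - (\<Sum>k<n. f (z k))" for n
      by (induction n) (simp_all add: z)
    have "(\<lambda>n. z n) \<longlonglongrightarrow> 0"
    proof (rule Lim_null_comparison)
      show "\<forall>\<^sub>F n in sequentially. norm (z n) \<le> (1 / 2) ^ n * norm (v + w)" using zk by simp
      have "(\<lambda>n. (1 / 2) ^ n * norm (v + w)) \<longlonglongrightarrow> 0 * norm (v + w)"
        by (intro tendsto_mult LIMSEQ_realpow_zero tendsto_const) auto
      then show "(\<lambda>n. (1 / 2) ^ n * norm (v + w)) \<longlonglongrightarrow> 0" by simp
    qed
    then have "(\<lambda>n. \<Sum>k<n. g (z k)) \<longlonglongrightarrow> v + w - 0 - v'"
      unfolding part by (intro tendsto_diff tendsto_const v'lim)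
    then have w': "v + w - v' \<in> W"
      using closed_sequentially[OF W(2), of "\<lambda>n. \<Sum>k<n. g (z k)"] by (simp add: subspace_sum W g)
    have "v - v' \<in> V" using V vw v' by (intro subspace_diff)
    moreover have "(v + w - v') - w \<in> W" by (rule subspace_diff[OF W(1) w' vw(2)])
    then have "v - v' \<in> W" by simp
    ultimately have "v - v' \<in> V \<inter> W" by simp
    then have "v = v'" using int by simp
    moreover have "norm v' \<le> (\<Sum>k. c * norm (v + w) * (1 / 2) ^ k)"
      unfolding v'_def
      by (rule norm_suminf_le[OF _ sums_summable[OF sg]]) (rule fk)
    ultimately show ?thesis using sums_unique[OF sg] by (simp add: mult_ac)
  qed
  moreover have "0 < 2 * c" using c by simp
  ultimately show ?thesis by blast
qed

section \<open>Invariant graphs over a hyperbolic splitting\<close>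

text \<open>
  The graph transform. The graph of \<open>L t\<close> over the range of \<open>p\<close> is the range of \<open>p + L t\<close>. The operator
  \<open>T + B t\<close> maps it into the graph of \<open>L (t + h)\<close> when \<open>T L = q (L' G - B (p + L))\<close> holds for \<open>L = L t\<close>,
  \<open>L' = L (t + h)\<close>, \<open>B = B t\<close> and \<open>G = T p + p B (p + L)\<close>. Solving for the \<open>L\<close> on the left with the
  contraction \<open>T' q\<close> gives a fixed point equation for the whole family. Since \<open>T p\<close> is a contraction as well,
  the right hand side maps the ball of radius \<open>\<kappa> * \<beta>\<close> in the space of bounded continuous operator
  valued functions to itself and halves distances there.
\<close>

lemma invariant_graph_exists:
  fixes p q T T' :: "'a::banach \<Rightarrow>\<^sub>L 'a" and B :: "real \<Rightarrow> ('a \<Rightarrow>\<^sub>L 'a)"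
  assumes pq: "p + q = id_blinfun" "p o\<^sub>L q = 0" "q o\<^sub>L p = 0"
    and T: "T o\<^sub>L T' = id_blinfun" "T o\<^sub>L p = p o\<^sub>L T"
    and contr: "norm (T o\<^sub>L p) \<le> 1 / 4" "norm (T' o\<^sub>L q) \<le> 1 / 4"
    and \<kappa>: "1 \<le> \<kappa>" "norm p \<le> \<kappa>" "norm q \<le> \<kappa>"
    and B: "continuous_on UNIV B"
    and \<beta>: "\<And>t. norm (B t) \<le> \<beta>" "\<kappa> * \<kappa> * \<beta> \<le> 1 / 16"
    and T'q: "T' o\<^sub>L q = q o\<^sub>L T'"
  obtains L where "\<And>t. norm (L t) \<le> \<kappa> * \<beta>" "\<And>t. q o\<^sub>L L t = L t" "\<And>t. L t o\<^sub>L p = L t"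
    "\<And>t. (T + B t) o\<^sub>L (p + L t) = (p + L (t + h)) o\<^sub>L ((T o\<^sub>L p) + (p o\<^sub>L (B t o\<^sub>L (p + L t))))"
proof -
  have \<beta>0: "0 \<le> \<beta>" using \<beta>(1)[of 0] norm_ge_zero order_trans by blast
  have \<kappa>\<beta>: "0 \<le> \<kappa> * \<beta>" "\<kappa> * \<beta> \<le> 1 / 16"
  proof -
    have "1 * (\<kappa> * \<beta>) \<le> \<kappa> * (\<kappa> * \<beta>)" using \<kappa>(1) \<beta>0 by (intro mult_right_mono) auto
    then show "\<kappa> * \<beta> \<le> 1 / 16" using \<beta>(2) by (simp add: mult_ac)
    show "0 \<le> \<kappa> * \<beta>" using \<kappa>(1) \<beta>0 by simp
  qed
  have pp: "p o\<^sub>L p = p" and qq: "q o\<^sub>L q = q"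
  proof -
    have "p o\<^sub>L (p + q) = p" "q o\<^sub>L (p + q) = q" by (simp_all add: pq(1))
    then show "p o\<^sub>L p = p" "q o\<^sub>L q = q" by (simp_all add: blinfun_compose_bilinear pq(2,3))
  qed
  \<comment> \<open>\<open>e M\<close> parametrizes the graph of \<open>M\<close>, and \<open>G t M\<close> is the induced motion of the parameter.\<close>
  define e where "e M = (id_blinfun + M) o\<^sub>L p" for M
  define G where "G t M = (T o\<^sub>L p) + (p o\<^sub>L (B t o\<^sub>L e M))" for t M
  define F where "F t M N = (T' o\<^sub>L q) o\<^sub>L ((N o\<^sub>L G t M) - (B t o\<^sub>L e M))" for t M N
  have e: "norm (e M) \<le> 2 * \<kappa>" if "norm M \<le> \<kappa> * \<beta>" for M
  proof -
    have "norm (id_blinfun + M) \<le> 1 + \<kappa> * \<beta>"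
      using that by (intro norm_triangle_le add_mono norm_blinfun_id_le)
    also have "\<dots> \<le> 2" using \<kappa>\<beta> by simp
    finally show ?thesis unfolding e_def using \<kappa>(2) by (rule norm_blinfun_compose_le)
  qed
  have G: "norm (G t M) \<le> 3 / 8" if "norm M \<le> \<kappa> * \<beta>" for t M
  proof -
    have "norm (G t M) \<le> 1 / 4 + \<kappa> * (\<beta> * (2 * \<kappa>))"
      unfolding G_def using that
      by (intro norm_triangle_le add_mono contr norm_blinfun_compose_le \<kappa> \<beta>(1) e)
    then show ?thesis using \<beta>(2) by (simp add: mult_ac)
  qed
  have ball: "norm (F t M N) \<le> \<kappa> * \<beta>" if "norm M \<le> \<kappa> * \<beta>" "norm N \<le> \<kappa> * \<beta>" for t M N
  proof -
    have "norm (F t M N) \<le> 1 / 4 * (\<kappa> * \<beta> * (3 / 8) + \<beta> * (2 * \<kappa>))"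
      unfolding F_def using that
      by (intro norm_blinfun_compose_le contr(2) order_trans[OF norm_triangle_ineq4] add_mono G e \<beta>(1))
    also have "\<dots> \<le> \<kappa> * \<beta>" using \<kappa>\<beta> by (simp add: mult_ac)
    finally show ?thesis .
  qed
  have lip: "norm (F t M N - F t M' N') \<le> 1 / 2 * d"
    if *: "norm M \<le> \<kappa> * \<beta>" "norm N' \<le> \<kappa> * \<beta>" "norm (M - M') \<le> d" "norm (N - N') \<le> d" for t M N M' N' d
  proof -
    have d0: "0 \<le> d" using *(3) norm_ge_zero order_trans by blast
    have "F t M N - F t M' N' = (T' o\<^sub>L q) o\<^sub>L (((N - N') o\<^sub>L G t M) + (N' o\<^sub>L (p o\<^sub>L (B t o\<^sub>L ((M - M') o\<^sub>L p))))
        - (B t o\<^sub>L ((M - M') o\<^sub>L p)))"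
      unfolding F_def G_def e_def by (simp add: blinfun_compose_bilinear algebra_simps)
    also have "norm \<dots> \<le> 1 / 4 * (d * (3 / 8) + \<kappa> * \<beta> * (\<kappa> * (\<beta> * (d * \<kappa>))) + \<beta> * (d * \<kappa>))"
      by (intro norm_blinfun_compose_le contr(2) order_trans[OF norm_triangle_ineq4] add_mono
          norm_triangle_le G \<beta>(1) \<kappa> *)
    also have "\<dots> = 1 / 4 * (3 / 8 + \<kappa> * \<beta> * (\<kappa> * \<kappa> * \<beta>) + \<kappa> * \<beta>) * d"
      by (simp add: algebra_simps)
    also have "\<dots> \<le> 1 / 4 * (3 / 8 + 1 / 16 * (1 / 16) + 1 / 16) * d"
      using \<kappa>\<beta> \<beta>(2) d0 \<beta>0 \<kappa>(1)
      by (intro mult_right_mono mult_left_mono add_mono mult_mono order_refl) auto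
    also have "\<dots> \<le> 1 / 2 * d" using d0 by simp
    finally show ?thesis .
  qed
  define \<Phi> where "\<Phi> L = Bcontfun (\<lambda>t. F t (apply_bcontfun L t) (apply_bcontfun L (t + h)))"
    for L :: "real \<Rightarrow>\<^sub>C ('a \<Rightarrow>\<^sub>L 'a)"
  have mem: "(\<lambda>t. F t (apply_bcontfun L t) (apply_bcontfun L (t + h))) \<in> bcontfun"
    if "norm L \<le> \<kappa> * \<beta>" for L
  proof (rule bcontfun_normI)
    have "continuous_on UNIV (\<lambda>t. apply_bcontfun L (t + h))"
      by (rule continuous_on_compose2[of UNIV "apply_bcontfun L"]) (auto intro!: continuous_intros)
    then show "continuous_on UNIV (\<lambda>t. F t (apply_bcontfun L t) (apply_bcontfun L (t + h)))"
      unfolding F_def G_def e_def by (intro continuous_intros B) auto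
    show "norm (F t (apply_bcontfun L t) (apply_bcontfun L (t + h))) \<le> \<kappa> * \<beta>" for t
      by (intro ball order_trans[OF norm_bounded that])
  qed
  have "\<exists>!L\<in>cball 0 (\<kappa> * \<beta>). \<Phi> L = L"
  proof (rule Banach_fix[of _ "1 / 2"])
    show "complete (cball 0 (\<kappa> * \<beta>) :: (real \<Rightarrow>\<^sub>C ('a \<Rightarrow>\<^sub>L 'a)) set)"
      by (rule complete_closed_subset[OF closed_cball subset_UNIV complete_UNIV])
    show "cball 0 (\<kappa> * \<beta>) \<noteq> {}" using \<kappa>\<beta> by simp
    show "\<Phi> ` cball 0 (\<kappa> * \<beta>) \<subseteq> cball 0 (\<kappa> * \<beta>)"
    proof (intro image_subsetI)
      fix L :: "real \<Rightarrow>\<^sub>C ('a \<Rightarrow>\<^sub>L 'a)" assume "L \<in> cball 0 (\<kappa> * \<beta>)"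
      then have L: "norm L \<le> \<kappa> * \<beta>" by simp
      have "norm (\<Phi> L) \<le> \<kappa> * \<beta>"
        unfolding \<Phi>_def
        by (rule norm_bound) (simp add: Bcontfun_inverse[OF mem[OF L]] ball order_trans[OF norm_bounded L])
      then show "\<Phi> L \<in> cball 0 (\<kappa> * \<beta>)" by simp
    qed
    fix L M :: "real \<Rightarrow>\<^sub>C ('a \<Rightarrow>\<^sub>L 'a)" assume "L \<in> cball 0 (\<kappa> * \<beta>)" "M \<in> cball 0 (\<kappa> * \<beta>)"
    then have LM: "norm L \<le> \<kappa> * \<beta>" "norm M \<le> \<kappa> * \<beta>" by auto
    show "dist (\<Phi> L) (\<Phi> M) \<le> 1 / 2 * dist L M"
      unfolding \<Phi>_def
    proof (rule dist_bound)
      fix t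
      have d: "norm (apply_bcontfun L t - apply_bcontfun M t) \<le> dist L M" for t
        using dist_bounded[of L t M] by (simp add: dist_norm)
      show "dist (apply_bcontfun (Bcontfun (\<lambda>t. F t (apply_bcontfun L t) (apply_bcontfun L (t + h)))) t)
            (apply_bcontfun (Bcontfun (\<lambda>t. F t (apply_bcontfun M t) (apply_bcontfun M (t + h)))) t)
          \<le> 1 / 2 * dist L M"
        unfolding Bcontfun_inverse[OF mem[OF LM(1)]] Bcontfun_inverse[OF mem[OF LM(2)]] dist_norm[of "F _ _ _"]
        by (intro lip order_trans[OF norm_bounded LM(1)] order_trans[OF norm_bounded LM(2)] d)
    qed
  qed auto
  then obtain L0 where L0: "norm L0 \<le> \<kappa> * \<beta>" "\<Phi> L0 = L0" by auto
  define L where "L = apply_bcontfun L0"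
  have L: "norm (L t) \<le> \<kappa> * \<beta>" for t unfolding L_def by (rule order_trans[OF norm_bounded L0(1)])
  have fix_L: "L t = F t (L t) (L (t + h))" for t
    using L0(2) Bcontfun_inverse[OF mem[OF L0(1)]] unfolding \<Phi>_def L_def by metis
  have qL: "q o\<^sub>L L t = L t" for t
  proof -
    have "q o\<^sub>L (T' o\<^sub>L q) = T' o\<^sub>L q"
      unfolding T'q by (simp add: qq flip: blinfun_compose_assoc)
    then show ?thesis by (subst (1 2) fix_L) (simp add: F_def flip: blinfun_compose_assoc)
  qed
  have ep: "e M o\<^sub>L p = e M" for M by (simp add: e_def blinfun_compose_assoc pp)
  have Lp: "L t o\<^sub>L p = L t" for t
  proof -
    have "G t M o\<^sub>L p = G t M" for M
      by (simp add: G_def blinfun_compose_bilinear blinfun_compose_assoc ep pp)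
    then have "F t M N o\<^sub>L p = F t M N" for M N
      by (simp add: F_def blinfun_compose_bilinear blinfun_compose_assoc ep)
    then show ?thesis using fix_L by metis
  qed
  have eL: "e (L t) = p + L t" for t by (simp add: e_def blinfun_compose_bilinear Lp)
  have inv: "(T + B t) o\<^sub>L (p + L t) = (p + L (t + h)) o\<^sub>L ((T o\<^sub>L p) + (p o\<^sub>L (B t o\<^sub>L (p + L t))))" for t
  proof -
    have TF: "T o\<^sub>L ((T' o\<^sub>L q) o\<^sub>L M) = q o\<^sub>L M" for M :: "'a \<Rightarrow>\<^sub>L 'a"
      by (simp add: T(1) flip: blinfun_compose_assoc)
    have "T o\<^sub>L L t = q o\<^sub>L ((L (t + h) o\<^sub>L G t (L t)) - (B t o\<^sub>L (p + L t)))"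
      by (subst fix_L) (simp only: F_def TF eL)
    also have "\<dots> = (L (t + h) o\<^sub>L G t (L t)) - (q o\<^sub>L (B t o\<^sub>L (p + L t)))"
      by (simp only: blinfun_compose_bilinear) (simp add: qL flip: blinfun_compose_assoc)
    finally have TL: "T o\<^sub>L L t = (L (t + h) o\<^sub>L G t (L t)) - (q o\<^sub>L (B t o\<^sub>L (p + L t)))" .
    have pG: "p o\<^sub>L G t (L t) = G t (L t)"
    proof -
      have "p o\<^sub>L (T o\<^sub>L p) = T o\<^sub>L p" by (metis T(2) blinfun_compose_assoc pp)
      then show ?thesis
        unfolding G_def by (simp add: blinfun_compose_bilinear) (simp add: pp flip: blinfun_compose_assoc)
    qed
    have split: "M = (p o\<^sub>L M) + (q o\<^sub>L M)" for M :: "'a \<Rightarrow>\<^sub>L 'a"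
      using pq(1) by (simp flip: blinfun_compose_bilinear(1))
    have "(T + B t) o\<^sub>L (p + L t) = (T o\<^sub>L p) + (T o\<^sub>L L t) + (B t o\<^sub>L (p + L t))"
      by (simp add: blinfun_compose_bilinear)
    also have "\<dots> = (T o\<^sub>L p) + (p o\<^sub>L (B t o\<^sub>L (p + L t))) + (L (t + h) o\<^sub>L G t (L t))"
      unfolding TL using split[of "B t o\<^sub>L (p + L t)"] by (simp add: algebra_simps)
    also have "\<dots> = (p o\<^sub>L G t (L t)) + (L (t + h) o\<^sub>L G t (L t))"
      unfolding pG by (simp add: G_def eL)
    finally show ?thesis by (simp add: G_def eL blinfun_compose_bilinear)
  qed
  show ?thesis by (rule that[OF L qL Lp inv])
qed

subsection \<open>Orbits relative to the invariant graphs\<close>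

text \<open>
  \<open>E n\<close> is the projector onto the graph at time \<open>n\<close> along the kernel of \<open>p\<close>, and \<open>S n\<close> the
  step from time \<open>n\<close> to time \<open>n + 1\<close>. The component \<open>p x\<close> serves as a coordinate on the
  graph, and \<open>x - E n x\<close> measures the deviation from it.
\<close>

locale invariant_graphs =
  fixes p :: "'a::banach \<Rightarrow>\<^sub>L 'a" and \<kappa> \<beta> :: real and E S :: "nat \<Rightarrow> ('a \<Rightarrow>\<^sub>L 'a)"
  assumes \<kappa>: "1 \<le> \<kappa>" "norm p \<le> \<kappa>"
    and \<beta>: "0 \<le> \<beta>" "\<kappa> * \<kappa> * \<beta> \<le> 1 / 16"
    and p_E: "p (E n x) = p x"
    and E_p: "E n (p x) = E n x"
    and E_near: "norm (E n - p) \<le> \<kappa> * \<beta>"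
    and invariant: "E (Suc n) (S n (E n x)) = S n (E n x)"
    and contracting: "norm (p (S n (E n x))) \<le> norm (p x) / 2"
    and expanding: "2 * norm (x - E n x) \<le> norm (S n x - E (Suc n) (S n x))"
    and coupling: "norm (p (S n (x - E n x))) \<le> \<kappa> * \<beta> * norm (x - E n x)"
begin

lemma \<kappa>\<beta>: "0 \<le> \<kappa> * \<beta>" "\<kappa> * (\<kappa> * \<beta>) \<le> 1 / 16" "\<kappa> * \<beta> \<le> 1 / 16"
proof -
  show "\<kappa> * (\<kappa> * \<beta>) \<le> 1 / 16" "0 \<le> \<kappa> * \<beta>" using \<kappa>(1) \<beta> by (simp_all add: mult_ac)
  have "1 * (\<kappa> * \<beta>) \<le> \<kappa> * (\<kappa> * \<beta>)" using \<kappa>(1) \<beta> by (intro mult_right_mono) auto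
  then show "\<kappa> * \<beta> \<le> 1 / 16" using \<beta>(2) by (simp add: mult_ac)
qed

lemma E_E: "E n (E n x) = E n x"
  by (metis E_p p_E)

lemma norm_E_le: "norm (E n) \<le> 2 * \<kappa>"
proof -
  have "norm (E n) \<le> norm (E n - p) + norm p" by norm
  also have "\<dots> \<le> 1 / 16 + \<kappa>" using E_near[of n] \<kappa> \<kappa>\<beta>(3) by linarith
  finally show ?thesis using \<kappa>(1) by linarith
qed

lemma norm_complement_le: "norm (x - E n x) \<le> (1 + 2 * \<kappa>) * norm x"
  using norm_triangle_ineq4[of x "E n x"] norm_blinfun_apply_le[OF norm_E_le order_refl, of n x]
  by (simp add: distrib_right)

context
  fixes x :: "nat \<Rightarrow> 'a"
  assumes orbit: "\<And>n. x (Suc n) = S n (x n)"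
begin

lemma orbit_on_graph:
  assumes "E 0 (x 0) = x 0"
  shows "E n (x n) = x n" and "norm (x n) \<le> 2 * \<kappa> * \<kappa> * (1 / 2) ^ n * norm (x 0)"
proof -
  have on: "E n (x n) = x n" for n
  proof (induction n)
    case (Suc n)
    then show ?case using invariant[of n "x n"] by (simp add: orbit)
  qed (rule assms)
  then show "E n (x n) = x n" .
  have "norm (p (x n)) \<le> (1 / 2) ^ n * norm (p (x 0))" for n
  proof (induction n)
    case (Suc n)
    then show ?case using contracting[of n "x n"] by (simp add: orbit on)
  qed simp
  also have "(1 / 2) ^ n * norm (p (x 0)) \<le> (1 / 2) ^ n * (\<kappa> * norm (x 0))" for n
    by (intro mult_left_mono norm_blinfun_apply_le \<kappa>) auto
  finally have "norm (p (x n)) \<le> (1 / 2) ^ n * (\<kappa> * norm (x 0))" .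
  then have "norm (E n (p (x n))) \<le> 2 * \<kappa> * ((1 / 2) ^ n * (\<kappa> * norm (x 0)))"
    by (rule norm_blinfun_apply_le[OF norm_E_le])
  then show "norm (x n) \<le> 2 * \<kappa> * \<kappa> * (1 / 2) ^ n * norm (x 0)"
    by (simp add: E_p on mult_ac)
qed

lemma orbit_off_graph: "2 ^ n * norm (x 0 - E 0 (x 0)) \<le> norm (x n - E n (x n))"
proof (induction n)
  case (Suc n)
  then show ?case using expanding[of "x n" n] by (simp add: orbit)
qed simp

text \<open>
  The quotient \<open>norm (p x) / norm (x - E x)\<close> is divided by \<open>4\<close> in each step, up to the error
  \<open>\<kappa> * \<beta> / 2\<close> caused by the coupling.
\<close>

lemma orbit_cone:
  assumes "0 \<le> c" "norm (p (x 0)) \<le> c * norm (x 0 - E 0 (x 0))"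
  shows "norm (p (x n)) \<le> ((1 / 4) ^ n * c + 2 * \<kappa> * \<beta>) * norm (x n - E n (x n))"
proof (induction n)
  case 0
  have "c * norm (x 0 - E 0 (x 0)) \<le> (c + 2 * \<kappa> * \<beta>) * norm (x 0 - E 0 (x 0))"
    using \<kappa>\<beta>(1) by (intro mult_right_mono) (auto simp: mult.assoc)
  then show ?case using assms(2) by simp
next
  case (Suc n)
  define w where "w = norm (x n - E n (x n))"
  have w: "2 * w \<le> norm (x (Suc n) - E (Suc n) (x (Suc n)))"
    using expanding[of "x n" n] by (simp add: orbit w_def)
  have "x n = E n (x n) + (x n - E n (x n))" by simp
  then have eq: "p (x (Suc n)) = p (S n (E n (x n))) + p (S n (x n - E n (x n)))"
    unfolding orbit by (metis blinfun.add_right)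
  have le: "norm (p (x (Suc n))) \<le> norm (p (x n)) / 2 + \<kappa> * \<beta> * w"
    unfolding eq w_def using norm_triangle_ineq[of "p (S n (E n (x n)))" "p (S n (x n - E n (x n)))"]
      contracting[of n "x n"] coupling[of n "x n"] by linarith
  have IH: "norm (p (x n)) \<le> ((1 / 4) ^ n * c + 2 * \<kappa> * \<beta>) * w"
    using Suc by (simp add: w_def)
  have "norm (p (x (Suc n))) \<le> ((1 / 4) ^ Suc n * c + \<kappa> * \<beta>) * (2 * w)"
    using le IH by (simp add: algebra_simps)
  also have "\<dots> \<le> ((1 / 4) ^ Suc n * c + 2 * \<kappa> * \<beta>) * norm (x (Suc n) - E (Suc n) (x (Suc n)))"
    using \<kappa>\<beta>(1) assms(1) by (intro mult_mono w) (simp_all add: w_def mult_ac)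
  finally show ?case .
qed

end

end

text \<open>
  The graph equation \<open>inv\<close> gives invariance and shows that the graph component evolves by
  \<open>T p + p B E\<close>, a contraction. Passing to \<open>x - E x\<close> kills the graph, and the induced map \<open>T + (1 - E) B\<close>
  on the range of \<open>q\<close> expands like \<open>T\<close> does, by a factor of at least \<open>4 - 1\<close>.
\<close>

lemma invariant_graphsI:
  fixes p q T T' :: "'a::banach \<Rightarrow>\<^sub>L 'a" and B L :: "nat \<Rightarrow> ('a \<Rightarrow>\<^sub>L 'a)"
  assumes pq: "p + q = id_blinfun" "p o\<^sub>L q = 0" "q o\<^sub>L p = 0"
    and T: "T' o\<^sub>L T = id_blinfun" "T o\<^sub>L p = p o\<^sub>L T"
    and contr: "norm (T o\<^sub>L p) \<le> 1 / 4" "norm (T' o\<^sub>L q) \<le> 1 / 4"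
    and \<kappa>: "1 \<le> \<kappa>" "norm p \<le> \<kappa>"
    and \<beta>: "\<And>n. norm (B n) \<le> \<beta>" "\<kappa> * \<kappa> * \<beta> \<le> 1 / 16"
    and L: "\<And>n. norm (L n) \<le> \<kappa> * \<beta>" "\<And>n. q o\<^sub>L L n = L n" "\<And>n. L n o\<^sub>L p = L n"
    and inv: "\<And>n. (T + B n) o\<^sub>L (p + L n) = (p + L (Suc n)) o\<^sub>L ((T o\<^sub>L p) + (p o\<^sub>L (B n o\<^sub>L (p + L n))))"
  shows "invariant_graphs p \<kappa> \<beta> (\<lambda>n. p + L n) (\<lambda>n. T + B n)"
proof -
  define E where "E n = p + L n" for n
  have \<beta>0: "0 \<le> \<beta>" using \<beta>(1)[of 0] norm_ge_zero order_trans by blast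
  have \<kappa>\<beta>: "0 \<le> \<kappa> * \<beta>" "\<kappa> * (\<kappa> * \<beta>) \<le> 1 / 16" using \<kappa>(1) \<beta>0 \<beta>(2) by (simp_all add: mult_ac)
  have "1 * (\<kappa> * \<beta>) \<le> \<kappa> * (\<kappa> * \<beta>)" using \<kappa>(1) \<beta>0 by (intro mult_right_mono) auto
  with \<kappa>\<beta> have \<kappa>\<beta>': "\<kappa> * \<beta> \<le> 1 / 16" by simp
  have "1 * \<beta> \<le> \<kappa> * \<beta>" using \<kappa>(1) \<beta>0 by (intro mult_right_mono) auto
  have id: "p x + q x = x" for x
    using arg_cong[OF pq(1), of "\<lambda>A. blinfun_apply A x"] by (simp add: blinfun.add_left)
  have ap: "p (q x) = 0" "q (p x) = 0" for x
    using arg_cong[OF pq(2), of "\<lambda>A. blinfun_apply A x"] arg_cong[OF pq(3), of "\<lambda>A. blinfun_apply A x"] by simp_all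
  have qL: "q (L n x) = L n x" and Lp: "L n (p x) = L n x" for n x
    using arg_cong[OF L(2), of "\<lambda>A. blinfun_apply A x"] arg_cong[OF L(3), of "\<lambda>A. blinfun_apply A x"] by simp_all
  have Tp: "T (p x) = p (T x)" for x using arg_cong[OF T(2), of "\<lambda>A. blinfun_apply A x"] by simp
  have T'T: "T' (T x) = x" for x using arg_cong[OF T(1), of "\<lambda>A. blinfun_apply A x"] by simp
  have pp: "p (p x) = p x" for x using id[of "p x"] by (simp add: ap)
  have pL: "p (L n x) = 0" for n x using ap(1)[of "L n x"] by (simp add: qL)
  have pE: "p (E n x) = p x" and Ep: "E n (p x) = E n x" for n x
    by (simp_all add: E_def blinfun.add_left blinfun.add_right pp pL Lp)
  have EE: "E n (E m x) = E n x" for n m x by (metis Ep pE)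
  have norm_E: "norm (E n) \<le> 2 * \<kappa>" for n
    unfolding E_def using L(1)[of n] \<kappa> \<kappa>\<beta>' norm_triangle_ineq[of p "L n"] by linarith
  have inv': "T (E n x) + B n (E n x) = E (Suc n) (p (T x) + p (B n (E n x)))" for n x
    using arg_cong[OF inv[of n], of "\<lambda>A. blinfun_apply A x"]
    by (simp add: E_def[symmetric] blinfun.add_left Tp)
  have pBE: "norm (p (B n (E n x))) \<le> norm (p x) / 8" for n x
  proof -
    have "norm (p (B n (E n (p x)))) \<le> \<kappa> * (\<beta> * (2 * \<kappa> * norm (p x)))"
      by (intro norm_blinfun_apply_le \<kappa> \<beta>(1) norm_E order_refl)
    also have "\<dots> = 2 * (\<kappa> * \<kappa> * \<beta>) * norm (p x)" by (simp add: mult_ac)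
    also have "\<dots> \<le> 2 * (1 / 16) * norm (p x)" using \<beta>(2) by (intro mult_right_mono mult_left_mono) auto
    finally show ?thesis by (simp add: Ep)
  qed
  have "invariant_graphs p \<kappa> \<beta> E (\<lambda>n. T + B n)"
  proof
    fix n x
    show "norm (E n - p) \<le> \<kappa> * \<beta>" using L(1) by (simp add: E_def)
    show "E (Suc n) ((T + B n) (E n x)) = (T + B n) (E n x)"
      by (simp add: blinfun.add_left inv' EE)
    have "norm (p (T x)) \<le> 1 / 4 * norm (p x)"
      using norm_blinfun_apply_le[OF contr(1) order_refl, of "p x"] by (simp add: Tp pp)
    moreover have "p ((T + B n) (E n x)) = p (T x) + p (B n (E n x))"
      by (simp add: blinfun.add_left inv' pE blinfun.add_right pp)
    ultimately show "norm (p ((T + B n) (E n x))) \<le> norm (p x) / 2"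
      using norm_triangle_ineq[of "p (T x)" "p (B n (E n x))"] pBE[of n x] norm_ge_zero[of "p x"]
      by (simp only:)
    define w where "w = x - E n x"
    have pw: "p w = 0" by (simp add: w_def blinfun.diff_right pE)
    have ETw: "E m (T w) = 0" for m using Ep[of m "T w"] by (simp add: pw flip: Tp)
    have w: "(T + B n) x - E (Suc n) ((T + B n) x) = T w + (B n w - E (Suc n) (B n w))"
    proof -
      have "(T + B n) x = (T + B n) (E n x) + (T w + B n w)"
        by (simp add: w_def blinfun.add_left blinfun.diff_right)
      moreover have "E (Suc n) ((T + B n) (E n x)) = (T + B n) (E n x)"
        by (simp add: blinfun.add_left inv' EE)
      ultimately show ?thesis by (simp add: blinfun.add_right ETw)
    qed
    have "norm w \<le> 1 / 4 * norm (T w)"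
    proof -
      have "p (T w) = 0" using pw by (simp flip: Tp)
      then have "q (T w) = T w" using id[of "T w"] by simp
      then have "w = (T' o\<^sub>L q) (T w)" by (simp add: T'T)
      then show ?thesis using norm_blinfun_apply_le[OF contr(2) order_refl, of "T w"] by metis
    qed
    moreover have "norm (B n w - E (Suc n) (B n w)) \<le> norm w"
    proof -
      have B: "norm (B n w) \<le> \<beta> * norm w" by (intro norm_blinfun_apply_le \<beta>(1) order_refl)
      have "norm (B n w - E (Suc n) (B n w)) \<le> norm (B n w) + norm (E (Suc n) (B n w))"
        by (rule norm_triangle_ineq4)
      also have "\<dots> \<le> \<beta> * norm w + 2 * \<kappa> * (\<beta> * norm w)"
        by (intro add_mono B norm_blinfun_apply_le norm_E)
      also have "\<dots> = (\<beta> + 2 * (\<kappa> * \<beta>)) * norm w" by (simp add: algebra_simps)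
      also have "\<dots> \<le> 1 * norm w"
        using \<kappa>\<beta>' \<open>1 * \<beta> \<le> \<kappa> * \<beta>\<close> by (intro mult_right_mono) auto
      finally show ?thesis by simp
    qed
    ultimately show "2 * norm (x - E n x) \<le> norm ((T + B n) x - E (Suc n) ((T + B n) x))"
      unfolding w w_def[symmetric] using norm_diff_ineq[of "T w" "B n w - E (Suc n) (B n w)"]
        norm_ge_zero[of w] by linarith
    have "p ((T + B n) w) = p (B n w)"
      by (simp add: blinfun.add_left blinfun.add_right pw flip: Tp)
    then show "norm (p ((T + B n) (x - E n x))) \<le> \<kappa> * \<beta> * norm (x - E n x)"
      unfolding w_def[symmetric] using norm_blinfun_apply_le[OF \<kappa>(2) norm_blinfun_apply_le[OF \<beta>(1) order_refl]]
      by (simp add: mult.assoc)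
  qed (fact \<kappa> \<beta>0 \<beta>(2) pE Ep)+
  then show ?thesis by (simp add: E_def[abs_def])
qed

section \<open>Distances between subspaces\<close>

lemma bdd_above_infdist:
  assumes "0 \<in> Z" shows "bdd_above ((\<lambda>y. infdist y (Z \<inter> cball 0 1)) ` (Y \<inter> cball 0 1))"
proof (rule bdd_aboveI2)
  fix y assume "y \<in> Y \<inter> cball 0 1"
  then have "dist y 0 \<le> 1" by (simp add: dist_commute)
  moreover have "infdist y (Z \<inter> cball 0 1) \<le> dist y 0" using assms by (intro infdist_le) auto
  ultimately show "infdist y (Z \<inter> cball 0 1) \<le> 1" by linarith
qed

lemma rho_nonneg:
  assumes "0 \<in> Y" "0 \<in> Z" shows "0 \<le> \<rho> Y Z"
proof -
  have "0 \<le> infdist 0 (Z \<inter> cball 0 1)" by (rule infdist_nonneg)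
  also have "\<dots> \<le> \<rho> Y Z"
    unfolding \<rho>_def using assms by (intro cSUP_upper bdd_above_infdist) auto
  finally show ?thesis .
qed

text \<open>
  The factor \<open>2\<close> pays for moving the point of \<open>Z\<close> into the unit ball.
\<close>

lemma rho_le:
  assumes "0 \<in> Y" "subspace Z" "0 \<le> \<eta>"
    and near: "\<And>y. y \<in> Y \<Longrightarrow> \<exists>z\<in>Z. norm (y - z) \<le> \<eta> * norm y"
  shows "\<rho> Y Z \<le> 2 * \<eta>"
  unfolding \<rho>_def
proof (rule cSUP_least)
  show "Y \<inter> cball 0 1 \<noteq> {}" using assms(1) by auto
  fix y assume "y \<in> Y \<inter> cball 0 1"
  then have y: "y \<in> Y" "norm y \<le> 1" by auto
  obtain z where z: "z \<in> Z" "norm (y - z) \<le> \<eta> * norm y" using near[OF y(1)] by blast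
  have yz: "norm (y - z) \<le> \<eta>" using z(2) mult_left_mono[OF y(2) \<open>0 \<le> \<eta>\<close>] by simp
  define z' where "z' = (1 / (1 + \<eta>)) *\<^sub>R z"
  have "norm z \<le> norm y + norm (y - z)" by norm
  then have nz: "norm z \<le> 1 + \<eta>" using y(2) yz by linarith
  have "norm z' \<le> 1" using nz \<open>0 \<le> \<eta>\<close> by (simp add: z'_def field_simps)
  moreover have "z' \<in> Z" unfolding z'_def using assms(2) z(1) by (rule subspace_scale)
  ultimately have "infdist y (Z \<inter> cball 0 1) \<le> dist y z'" by (intro infdist_le) auto
  also have "\<dots> \<le> norm (y - z) + norm (z - z')" unfolding dist_norm by norm
  also have "norm (z - z') \<le> \<eta>"
  proof -
    have "z - z' = (\<eta> / (1 + \<eta>)) *\<^sub>R z"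
      using \<open>0 \<le> \<eta>\<close> by (simp add: z'_def field_simps flip: scaleR_left_diff_distrib)
        (simp add: scaleR_left_distrib[symmetric] add_divide_distrib[symmetric] algebra_simps)
    then have "norm (z - z') = \<eta> * (norm z / (1 + \<eta>))" using \<open>0 \<le> \<eta>\<close> by simp
    also have "\<dots> \<le> \<eta> * 1" using nz \<open>0 \<le> \<eta>\<close> by (intro mult_left_mono) (auto simp: field_simps)
    finally show ?thesis by simp
  qed
  finally show "infdist y (Z \<inter> cball 0 1) \<le> 2 * \<eta>" using yz by linarith
qed

lemma infdist_lessD:
  assumes "infdist x S < e" "S \<noteq> {}" obtains y where "y \<in> S" "dist x y < e"
proof -
  have "Inf (dist x ` S) < e" using assms by (simp add: infdist_notempty)
  then show ?thesis using cInf_lessD[of "dist x ` S" e] assms(2) that by auto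
qed

lemma rho_lessD:
  assumes "subspace Y" "subspace Z" "\<rho> Y Z < \<eta>" "y \<in> Y"
  shows "\<exists>z\<in>Z. norm (y - z) \<le> \<eta> * norm y"
proof (cases "y = 0")
  case True
  then show ?thesis using assms(2) by (intro bexI[of _ 0]) (auto simp: subspace_0)
next
  case False
  define u where "u = (1 / norm y) *\<^sub>R y"
  have u: "u \<in> Y \<inter> cball 0 1" using assms(1,4) False by (simp add: u_def subspace_scale)
  have "infdist u (Z \<inter> cball 0 1) \<le> \<rho> Y Z"
    unfolding \<rho>_def by (rule cSUP_upper[OF u]) (rule bdd_above_infdist[OF subspace_0[OF assms(2)]])
  then have "infdist u (Z \<inter> cball 0 1) < \<eta>" using assms(3) by linarith
  moreover have "Z \<inter> cball 0 1 \<noteq> {}" using subspace_0[OF assms(2)] by auto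
  ultimately obtain z where z: "z \<in> Z" "dist u z < \<eta>"
    by (metis IntD1 infdist_lessD)
  have "norm (y - norm y *\<^sub>R z) = norm y * norm (u - z)"
  proof -
    have "y - norm y *\<^sub>R z = norm y *\<^sub>R (u - z)" using False by (simp add: u_def scaleR_diff_right)
    then show ?thesis by simp
  qed
  also have "\<dots> \<le> \<eta> * norm y"
    using mult_left_mono[of "norm (u - z)" \<eta> "norm y"] z(2) by (simp add: dist_norm mult.commute)
  finally show ?thesis using z(1) assms(2) by (meson subspace_scale)
qed

text \<open>
  Riesz's lemma: were \<open>N\<close> smaller than \<open>M\<close>, then \<open>M\<close> would contain points almost orthogonal to \<open>N\<close>. Here such
  a point is \<open>y - z\<close>, where \<open>z\<close> realizes the distance of \<open>y\<close> from \<open>N\<close> up to the factor \<open>3 / 2\<close>.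
\<close>

lemma near_subspace_eq:
  assumes "subspace M" "subspace N" "closed N" "N \<subseteq> M"
    and near: "\<And>y. y \<in> M \<Longrightarrow> \<exists>z\<in>N. norm (y - z) \<le> norm y / 2"
  shows "M = N"
proof (rule ccontr)
  assume "M \<noteq> N"
  then obtain y where y: "y \<in> M" "y \<notin> N" using assms(4) by blast
  have ne: "N \<noteq> {}" using subspace_0[OF assms(2)] by auto
  define d where "d = infdist y N"
  have "0 < d" unfolding d_def using y(2) assms(3) ne
    by (metis in_closed_iff_infdist_zero infdist_nonneg less_eq_real_def)
  then have "infdist y N < 3 / 2 * d" by (simp add: d_def)
  then obtain z where z: "z \<in> N" "dist y z < 3 / 2 * d"
    using ne by (metis infdist_lessD)
  have "y - z \<in> M" using assms(1,4) y(1) z(1) by (auto intro: subspace_diff)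
  then obtain z' where z': "z' \<in> N" "norm ((y - z) - z') \<le> norm (y - z) / 2" using near by blast
  have "d \<le> dist y (z + z')"
    unfolding d_def using assms(2) z(1) z'(1) by (intro infdist_le subspace_add)
  then show False using z(2) z'(2) \<open>0 < d\<close> by (simp add: dist_norm algebra_simps)
qed

section \<open>The stable space of an asymptotically hyperbolic path\<close>

text \<open>
  The projectors \<open>p\<close>, \<open>q\<close> are those onto \<open>E\<^sup>-\<close>, \<open>E\<^sup>+\<close>, and \<open>h\<close> is the length of a time step in which
  \<open>op_exp A\<^sub>0\<close> contracts \<open>E\<^sup>-\<close> and expands \<open>E\<^sup>+\<close> at least by the factor \<open>4\<close>.
\<close>

locale dichotomy = bounded_path A a for A :: "real \<Rightarrow> ('a::banach \<Rightarrow>\<^sub>L 'a)" and a :: real +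
  fixes A\<^sub>0 p q :: "'a \<Rightarrow>\<^sub>L 'a" and \<kappa> h :: real
  assumes limit: "(A \<longlongrightarrow> A\<^sub>0) at_top"
    and norm_A\<^sub>0: "norm A\<^sub>0 \<le> a"
    and p_plus_q: "p + q = id_blinfun"
    and p_q: "p o\<^sub>L q = 0" "q o\<^sub>L p = 0"
    and A\<^sub>0_p: "A\<^sub>0 o\<^sub>L p = p o\<^sub>L A\<^sub>0"
    and \<kappa>: "1 \<le> \<kappa>" "norm p \<le> \<kappa>" "norm q \<le> \<kappa>"
    and h: "0 < h"
    and contraction: "norm (op_exp A\<^sub>0 h o\<^sub>L p) \<le> 1 / 4" "norm (op_exp (- A\<^sub>0) h o\<^sub>L q) \<le> 1 / 4"
begin

definition step :: "real \<Rightarrow> nat \<Rightarrow> ('a \<Rightarrow>\<^sub>L 'a)"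
  where "step s n = X (s + real (Suc n) * h) o\<^sub>L Y (s + real n * h)"

lemma p_q_sum: "p x + q x = x"
  using arg_cong[OF p_plus_q, of "\<lambda>A. blinfun_apply A x"] by (simp add: blinfun.add_left)

lemma p_q_apply: "p (q x) = 0" "q (p x) = 0"
  using arg_cong[OF p_q(1), of "\<lambda>A. blinfun_apply A x"] arg_cong[OF p_q(2), of "\<lambda>A. blinfun_apply A x"]
  by simp_all

lemma bounded_path_limit: "bounded_path (\<lambda>_. A\<^sub>0) a"
  using norm_A\<^sub>0 bound_pos by unfold_locales auto

text \<open>
  The difference \<open>Z\<close> of the two transition operators solves \<open>Z' = A Z + (A - A\<^sub>0) op_exp A\<^sub>0\<close> with
  \<open>Z 0 = 0\<close>.
\<close>

lemma transition_near_exp: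
  assumes "0 \<le> s" "0 \<le> \<epsilon>" and near: "\<And>t. s \<le> t \<Longrightarrow> norm (A t - A\<^sub>0) \<le> \<epsilon>"
  shows "norm ((X (s + h) o\<^sub>L Y s) - op_exp A\<^sub>0 h) \<le> 2 * exp (2 * a * h) * (\<epsilon> * (2 * exp (2 * a * h)) * h)"
proof -
  define Z where "Z r = (X (s + r) o\<^sub>L Y s) - op_exp A\<^sub>0 r" for r
  have "norm (Z h) \<le> 2 * exp (2 * a * h) * (norm (Z 0) + (\<epsilon> * (2 * exp (2 * a * h))) * h)"
  proof (rule linear_growth_bound)
    fix r assume r: "r \<in> {0..h}"
    show "(Z has_vector_derivative (A (s + r) o\<^sub>L (X (s + r) o\<^sub>L Y s)) - (A\<^sub>0 o\<^sub>L op_exp A\<^sub>0 r)) (at r within {0..h})"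
      unfolding Z_def[abs_def] using r assms(1)
      by (intro has_vector_derivative_diff has_vector_derivative_Icc_subset transition_derivative op_exp_derivative) auto
    have "(A (s + r) o\<^sub>L (X (s + r) o\<^sub>L Y s)) - (A\<^sub>0 o\<^sub>L op_exp A\<^sub>0 r)
        = (A (s + r) o\<^sub>L Z r) + ((A (s + r) - A\<^sub>0) o\<^sub>L op_exp A\<^sub>0 r)"
      by (simp add: Z_def blinfun_compose_bilinear)
    also have "norm \<dots> \<le> a * norm (Z r) + \<epsilon> * (2 * exp (2 * a * h))"
    proof (intro norm_triangle_le add_mono norm_blinfun_compose_le)
      have "norm (op_exp A\<^sub>0 r) \<le> 2 * exp (2 * a * r)"
        using bounded_path.norm_X_le[OF bounded_path_limit] r by simp
      also have "\<dots> \<le> 2 * exp (2 * a * h)" using r bound_pos by simp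
      finally show "norm (op_exp A\<^sub>0 r) \<le> 2 * exp (2 * a * h)" .
    qed (use near norm_path_le r assms(1) in auto)
    finally show "norm ((A (s + r) o\<^sub>L (X (s + r) o\<^sub>L Y s)) - (A\<^sub>0 o\<^sub>L op_exp A\<^sub>0 r))
      \<le> a * norm (Z r) + \<epsilon> * (2 * exp (2 * a * h))" .
  qed (use h bound_pos assms(2) in auto)
  moreover have "Z 0 = 0" using X_Y[OF assms(1)] by (simp add: Z_def op_exp_0)
  ultimately show ?thesis by (simp add: Z_def)
qed

lemma transition_tendsto_exp:
  assumes "0 < \<beta>"
  obtains \<tau> where "0 \<le> \<tau>" "\<And>s. \<tau> \<le> s \<Longrightarrow> norm ((X (s + h) o\<^sub>L Y s) - op_exp A\<^sub>0 h) \<le> \<beta>"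
proof -
  define C where "C = 2 * exp (2 * a * h) * (2 * exp (2 * a * h)) * h"
  have C: "0 < C" using h by (simp add: C_def)
  have "\<forall>\<^sub>F t in at_top. dist (A t) A\<^sub>0 < \<beta> / C"
    using limit C assms by (intro tendstoD) auto
  then obtain N where N: "\<And>t. N \<le> t \<Longrightarrow> norm (A t - A\<^sub>0) < \<beta> / C"
    by (auto simp: eventually_at_top_linorder dist_norm)
  have "norm ((X (s + h) o\<^sub>L Y s) - op_exp A\<^sub>0 h) \<le> \<beta>" if s: "max 0 N \<le> s" for s
  proof -
    have "norm ((X (s + h) o\<^sub>L Y s) - op_exp A\<^sub>0 h)
        \<le> 2 * exp (2 * a * h) * (\<beta> / C * (2 * exp (2 * a * h)) * h)"
      using s C assms N by (intro transition_near_exp) (auto intro: less_imp_le)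
    also have "\<dots> = \<beta> / C * C" unfolding C_def by (simp only: mult_ac)
    also have "\<dots> = \<beta>" using C by simp
    finally show ?thesis .
  qed
  then show ?thesis using that[of "max 0 N"] by simp
qed

lemma continuous_on_XY: "continuous_on {0..} X" "continuous_on {0..} Y"
proof -
  show "continuous_on {0..} X"
    using solution_X unfolding solution_def by (intro continuous_on_vector_derivative) auto
  show "continuous_on {0..} Y"
    using Y_derivative by (intro continuous_on_vector_derivative) auto
qed

text \<open>
  The graph transform is applied to the path of transition operators, made constant before \<open>\<tau>\<close> by
  means of \<open>max \<tau> t\<close>, and the resulting family of graphs is sampled at the times \<open>s + n h\<close>.
\<close>

lemma graphs_exist:
  assumes "0 < \<beta>" "\<kappa> * \<kappa> * \<beta> \<le> 1 / 16"
  obtains \<tau> where "0 \<le> \<tau>" "\<And>s. \<tau> \<le> s \<Longrightarrow> \<exists>E. invariant_graphs p \<kappa> \<beta> E (step s)"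
proof -
  obtain \<tau> where \<tau>: "0 \<le> \<tau>" "\<And>s. \<tau> \<le> s \<Longrightarrow> norm ((X (s + h) o\<^sub>L Y s) - op_exp A\<^sub>0 h) \<le> \<beta>"
    using transition_tendsto_exp[OF assms(1)] by metis
  define T where "T = op_exp A\<^sub>0 h"
  define T' where "T' = op_exp (- A\<^sub>0) h"
  define B where "B t = (X (max \<tau> t + h) o\<^sub>L Y (max \<tau> t)) - T" for t
  have T: "T o\<^sub>L T' = id_blinfun" "T' o\<^sub>L T = id_blinfun"
    using op_exp_minus[of h A\<^sub>0] op_exp_minus[of h "- A\<^sub>0"] h by (simp_all add: T_def T'_def)
  have Tp: "T o\<^sub>L p = p o\<^sub>L T"
    unfolding T_def using h by (intro op_exp_commute A\<^sub>0_p) simp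
  have q: "q = id_blinfun - p" using p_plus_q by (simp add: algebra_simps)
  have "- A\<^sub>0 o\<^sub>L q = q o\<^sub>L - A\<^sub>0" by (simp add: q blinfun_compose_bilinear A\<^sub>0_p)
  then have T'q: "T' o\<^sub>L q = q o\<^sub>L T'" unfolding T'_def using h by (intro op_exp_commute) simp_all
  have cB: "continuous_on UNIV B"
    unfolding B_def using \<tau>(1) h
    by (intro continuous_intros continuous_on_compose2[OF continuous_on_XY(1)]
        continuous_on_compose2[OF continuous_on_XY(2)]) auto
  have nB: "norm (B t) \<le> \<beta>" for t unfolding B_def T_def by (rule \<tau>(2)) simp
  obtain L where L: "\<And>t. norm (L t) \<le> \<kappa> * \<beta>" "\<And>t. q o\<^sub>L L t = L t" "\<And>t. L t o\<^sub>L p = L t"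
    "\<And>t. (T + B t) o\<^sub>L (p + L t) = (p + L (t + h)) o\<^sub>L ((T o\<^sub>L p) + (p o\<^sub>L (B t o\<^sub>L (p + L t))))"
    using invariant_graph_exists[OF p_plus_q p_q T(1) Tp contraction[folded T_def T'_def] \<kappa> cB nB assms(2) T'q]
    by metis
  have "\<exists>E. invariant_graphs p \<kappa> \<beta> E (step s)" if s: "\<tau> \<le> s" for s
  proof
    define t where "t n = s + real n * h" for n
    have "invariant_graphs p \<kappa> \<beta> (\<lambda>n. p + L (t n)) (\<lambda>n. T + B (t n))"
    proof (rule invariant_graphsI[OF p_plus_q p_q T(2) Tp contraction[folded T_def T'_def] \<kappa>(1,2) nB assms(2)])
      fix n
      have "t (Suc n) = t n + h" by (simp add: t_def algebra_simps)
      then show "(T + B (t n)) o\<^sub>L (p + L (t n)) = (p + L (t (Suc n))) o\<^sub>L ((T o\<^sub>L p) + (p o\<^sub>L (B (t n) o\<^sub>L (p + L (t n)))))"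
        by (simp only: L(4))
    qed (rule L)+
    moreover have "T + B (t n) = step s n" for n
    proof -
      have "0 \<le> real n * h" using h by simp
      then have "\<tau> \<le> t n" unfolding t_def using s by linarith
      moreover have "s + real (Suc n) * h = t n + h" by (simp add: t_def algebra_simps)
      ultimately show ?thesis by (simp add: B_def step_def t_def max_def add.assoc)
    qed
    ultimately show "invariant_graphs p \<kappa> \<beta> (\<lambda>n. p + L (t n)) (step s)" by simp
  qed
  with \<tau>(1) show ?thesis by (rule that)
qed

lemma step_orbit:
  assumes "0 \<le> s" shows "X (s + real (Suc n) * h) x = step s n (X (s + real n * h) x)"
  using assms h by (simp add: step_def)

lemma time_grid:
  assumes "s \<le> t"
  obtains n :: nat and r where "t = s + real n * h + r" "0 \<le> r" "r < h"
proof -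
  define n where "n = nat \<lfloor>(t - s) / h\<rfloor>"
  have "0 \<le> (t - s) / h" using assms h by simp
  then have n: "real n \<le> (t - s) / h" "(t - s) / h < real n + 1"
    unfolding n_def by (simp_all add: of_nat_floor)
  then have "real n * h \<le> t - s" "t - s < (real n + 1) * h" using h by (simp_all add: field_simps)
  then show ?thesis
    by (intro that[of n "t - s - real n * h"]) (auto simp: algebra_simps)
qed

lemma half_power_le:
  assumes "t = s + real n * h + r" "r < h"
  shows "(1 / 2) ^ n \<le> 2 * exp (- (ln 2 / h) * (t - s))"
proof -
  have "(1 / 2 :: real) ^ n = exp (- ln 2 * real n)"
    by (simp add: exp_minus exp_of_nat2_mult power_divide inverse_eq_divide)
  also have "\<dots> \<le> exp (ln 2 - (ln 2 / h) * (t - s))"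
  proof -
    have "(t - s) / h \<le> real n + 1" using assms h by (simp add: field_simps)
    then have "ln 2 * ((t - s) / h) \<le> ln 2 * (real n + 1)" by (intro mult_left_mono) auto
    then show ?thesis by (simp add: algebra_simps)
  qed
  also have "\<dots> = 2 * exp (- (ln 2 / h) * (t - s))" by (simp add: exp_diff exp_minus field_simps)
  finally show ?thesis .
qed

abbreviation Ws where "Ws \<equiv> stable_space A"

lemma mem_Ws: "x \<in> Ws \<longleftrightarrow> ((\<lambda>t. X t x) \<longlongrightarrow> 0) at_top"
  by (simp add: stable_space_def)

lemma on_graph_decay:
  assumes "0 \<le> s" "invariant_graphs p \<kappa> \<beta> E (step s)" "E 0 (X s x) = X s x" "s \<le> t"
  shows "norm (X t x) \<le> (8 * \<kappa> * \<kappa> * exp (2 * a * h)) * exp (- (ln 2 / h) * (t - s)) * norm (X s x)"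
proof -
  interpret invariant_graphs p \<kappa> \<beta> E "step s" by (rule assms(2))
  obtain n r where nr: "t = s + real n * h + r" "0 \<le> r" "r < h" using time_grid[OF assms(4)] .
  define u where "u = s + real n * h"
  have u: "0 \<le> u" "u \<le> t" "t - u < h" using nr assms(1) h by (auto simp: u_def)
  have "norm (X u x) \<le> 2 * \<kappa> * \<kappa> * (1 / 2) ^ n * norm (X s x)"
    using orbit_on_graph(2)[where x = "\<lambda>n. X (s + real n * h) x", of n] step_orbit[OF assms(1)] assms(3)
    by (simp add: u_def)
  also have "\<dots> \<le> 2 * \<kappa> * \<kappa> * (2 * exp (- (ln 2 / h) * (t - s))) * norm (X s x)"
    using half_power_le[OF nr(1,3)] \<kappa>(1) by (intro mult_right_mono mult_left_mono) auto
  finally have Xu: "norm (X u x) \<le> 2 * \<kappa> * \<kappa> * (2 * exp (- (ln 2 / h) * (t - s))) * norm (X s x)" .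
  have "norm (X t o\<^sub>L Y u) \<le> 2 * exp (2 * a * (t - u))" by (rule norm_transition_le[OF u(1,2)])
  also have "\<dots> \<le> 2 * exp (2 * a * h)" using u bound_pos by simp
  finally have "norm ((X t o\<^sub>L Y u) (X u x))
      \<le> 2 * exp (2 * a * h) * (2 * \<kappa> * \<kappa> * (2 * exp (- (ln 2 / h) * (t - s))) * norm (X s x))"
    using Xu by (rule norm_blinfun_apply_le)
  then show ?thesis using u(1) by (simp add: mult_ac)
qed

text \<open>
  An orbit that starts off the graph stays away from \<open>0\<close> at the times \<open>s + n h\<close>.
\<close>

lemma mem_Ws_iff:
  assumes s: "0 \<le> s" and "invariant_graphs p \<kappa> \<beta> E (step s)"
  shows "x \<in> Ws \<longleftrightarrow> E 0 (X s x) = X s x"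
proof
  interpret invariant_graphs p \<kappa> \<beta> E "step s" by (rule assms(2))
  assume "x \<in> Ws"
  then have "((\<lambda>t. X t x) \<longlongrightarrow> 0) at_top" by (simp add: mem_Ws)
  moreover have "filterlim (\<lambda>n. s + real n * h) at_top sequentially"
    by (rule filterlim_tendsto_add_at_top[OF tendsto_const])
      (intro filterlim_at_top_mult_tendsto_pos[OF tendsto_const h] filterlim_real_sequentially)
  ultimately have "(\<lambda>n. X (s + real n * h) x) \<longlonglongrightarrow> 0" by (rule filterlim_compose)
  then have lim: "(\<lambda>n. (1 + 2 * \<kappa>) * norm (X (s + real n * h) x)) \<longlonglongrightarrow> (1 + 2 * \<kappa>) * norm (0::'a)"
    by (intro tendsto_mult tendsto_const tendsto_norm)
  define w where "w = norm (X s x - E 0 (X s x))"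
  have "w \<le> (1 + 2 * \<kappa>) * norm (X (s + real n * h) x)" for n
  proof -
    have "1 * w \<le> 2 ^ n * w" by (intro mult_right_mono) (auto simp: w_def)
    also have "\<dots> \<le> norm (X (s + real n * h) x - E n (X (s + real n * h) x))"
      using orbit_off_graph[where x = "\<lambda>n. X (s + real n * h) x", of n] step_orbit[OF s] by (simp add: w_def)
    also have "\<dots> \<le> (1 + 2 * \<kappa>) * norm (X (s + real n * h) x)" by (rule norm_complement_le)
    finally show ?thesis by simp
  qed
  then have "w \<le> (1 + 2 * \<kappa>) * norm (0::'a)" by (intro LIMSEQ_le_const[OF lim]) blast
  then show "E 0 (X s x) = X s x" by (simp add: w_def)
next
  assume on: "E 0 (X s x) = X s x"
  have "((\<lambda>t. exp (- (ln 2 / h) * (t - s))) \<longlongrightarrow> 0) at_top"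
    using h by real_asymp
  then have "((\<lambda>t. (8 * \<kappa> * \<kappa> * exp (2 * a * h)) * exp (- (ln 2 / h) * (t - s)) * norm (X s x)) \<longlongrightarrow>
      (8 * \<kappa> * \<kappa> * exp (2 * a * h)) * 0 * norm (X s x)) at_top"
    by (intro tendsto_mult tendsto_const)
  then have "((\<lambda>t. (8 * \<kappa> * \<kappa> * exp (2 * a * h)) * exp (- (ln 2 / h) * (t - s)) * norm (X s x)) \<longlongrightarrow> 0) at_top"
    by simp
  moreover have "\<forall>\<^sub>F t in at_top. norm (X t x) \<le> (8 * \<kappa> * \<kappa> * exp (2 * a * h)) * exp (- (ln 2 / h) * (t - s)) * norm (X s x)"
    using eventually_ge_at_top[of s] by eventually_elim (rule on_graph_decay[OF s assms(2) on])
  ultimately show "x \<in> Ws" unfolding mem_Ws by (rule Lim_null_comparison[rotated])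
qed

end

context dichotomy
begin

lemma small_perturbation:
  assumes "0 < \<epsilon>"
  obtains \<beta> where "0 < \<beta>" "\<kappa> * \<kappa> * \<beta> \<le> 1 / 16" "\<beta> \<le> \<epsilon>"
proof
  show "0 < min (1 / (16 * (\<kappa> * \<kappa>))) \<epsilon>" using \<kappa>(1) assms by simp
  have "\<kappa> * \<kappa> * min (1 / (16 * (\<kappa> * \<kappa>))) \<epsilon> \<le> \<kappa> * \<kappa> * (1 / (16 * (\<kappa> * \<kappa>)))"
    using \<kappa>(1) by (intro mult_left_mono) auto
  then show "\<kappa> * \<kappa> * min (1 / (16 * (\<kappa> * \<kappa>))) \<epsilon> \<le> 1 / 16" using \<kappa>(1) by simp
qed simp

lemma base_graphs:
  obtains \<tau> \<beta> where "0 \<le> \<tau>" "\<And>s. \<tau> \<le> s \<Longrightarrow> \<exists>E. invariant_graphs p \<kappa> \<beta> E (step s)"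
  using small_perturbation[OF zero_less_one] graphs_exist by metis

lemma subspace_Ws: "subspace Ws"
proof (rule subspaceI)
  show "0 \<in> Ws" by (simp add: mem_Ws)
  show "x + y \<in> Ws" if "x \<in> Ws" "y \<in> Ws" for x y
    using that by (simp add: mem_Ws blinfun.add_right tendsto_add_zero)
  show "c *\<^sub>R x \<in> Ws" if "x \<in> Ws" for c x
    using tendsto_scaleR[OF tendsto_const that[unfolded mem_Ws], of c]
    by (simp add: mem_Ws blinfun.scaleR_right)
qed

lemma closed_Ws: "closed Ws"
proof -
  obtain \<tau> \<beta> where \<tau>: "0 \<le> \<tau>" "\<And>s. \<tau> \<le> s \<Longrightarrow> \<exists>E. invariant_graphs p \<kappa> \<beta> E (step s)"
    using base_graphs by metis
  then obtain E where "invariant_graphs p \<kappa> \<beta> E (step \<tau>)" by blast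
  then have "Ws = {x. E 0 (X \<tau> x) = X \<tau> x}" using mem_Ws_iff[OF \<tau>(1)] by blast
  also have "closed \<dots>" by (intro closed_Collect_eq continuous_intros)
  finally show ?thesis .
qed

lemma subspace_image: "subspace W \<Longrightarrow> subspace (X t ` W)"
  by (rule linear_subspace_image) (rule bounded_linear.linear[OF blinfun.bounded_linear_right])

lemma closed_image:
  assumes "closed W" "0 \<le> t" shows "closed (X t ` W)"
proof -
  have "X t ` W = Y t -` W"
    using assms(2) by (auto intro: image_eqI[of _ "X t" "Y t _"])
  also have "closed \<dots>"
    using assms(1) by (intro closed_vimage) (auto intro: continuous_intros)
  finally show ?thesis .
qed

text \<open>
  At time \<open>\<tau>\<close> the kernel of \<open>p\<close> is a complement of the graph; it is pulled back to time \<open>0\<close>.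
\<close>

lemma complement_Ws:
  obtains \<tau> where "0 \<le> \<tau>" "Ws \<inter> {z. p (X \<tau> z) = 0} = {0}"
    "\<And>x. \<exists>z. p (X \<tau> z) = 0 \<and> (\<exists>w\<in>Ws. x = z + w)"
proof -
  obtain \<tau> \<beta> where \<tau>: "0 \<le> \<tau>" "\<And>s. \<tau> \<le> s \<Longrightarrow> \<exists>E. invariant_graphs p \<kappa> \<beta> E (step s)"
    using base_graphs by metis
  then obtain E where E: "invariant_graphs p \<kappa> \<beta> E (step \<tau>)" by blast
  interpret invariant_graphs p \<kappa> \<beta> E "step \<tau>" by (rule E)
  note mem = mem_Ws_iff[OF \<tau>(1) E]
  have "z = 0" if "z \<in> Ws" "p (X \<tau> z) = 0" for z
  proof -
    have "X \<tau> z = E 0 (p (X \<tau> z))" unfolding E_p using that(1) mem by simp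
    then have "X \<tau> z = 0" using that by simp
    then have "Y \<tau> (X \<tau> z) = 0" by simp
    then show ?thesis using \<tau>(1) by simp
  qed
  then have "Ws \<inter> {z. p (X \<tau> z) = 0} = {0}" using subspace_0[OF subspace_Ws] by auto
  moreover have "\<exists>z. p (X \<tau> z) = 0 \<and> (\<exists>w\<in>Ws. x = z + w)" for x
  proof -
    define w where "w = Y \<tau> (E 0 (X \<tau> x))"
    have "w \<in> Ws" using \<tau>(1) by (simp add: mem w_def E_E)
    moreover have "p (X \<tau> (x - w)) = 0" using \<tau>(1) by (simp add: w_def blinfun.diff_right p_E)
    ultimately show ?thesis by (intro exI[of _ "x - w"]) (auto intro!: bexI[of _ w])
  qed
  ultimately show ?thesis using \<tau>(1) that by blast
qed

text \<open>
  Up to time \<open>\<tau>\<close> the general growth bound is compensated by the constant, and beyond \<open>\<tau>\<close> the orbit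
  lies on the graphs.
\<close>

lemma stable_decay:
  obtains c l where "0 < c" "0 < l"
    "\<And>s t x. 0 \<le> s \<Longrightarrow> s \<le> t \<Longrightarrow> x \<in> Ws \<Longrightarrow> norm (X t x) \<le> c * exp (- l * (t - s)) * norm (X s x)"
proof -
  obtain \<tau> \<beta> where \<tau>: "0 \<le> \<tau>" "\<And>s. \<tau> \<le> s \<Longrightarrow> \<exists>E. invariant_graphs p \<kappa> \<beta> E (step s)"
    using base_graphs by metis
  define l where "l = ln 2 / h"
  have l: "0 < l" using h by (simp add: l_def)
  define c0 where "c0 = 8 * \<kappa> * \<kappa> * exp (2 * a * h)"
  have "1 * 1 * 1 \<le> \<kappa> * \<kappa> * exp (2 * a * h)" using \<kappa>(1) h bound_pos by (intro mult_mono) auto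
  then have c0: "1 \<le> c0" by (simp add: c0_def mult.assoc)
  define c1 where "c1 = 2 * exp (2 * a * \<tau>) * exp (l * \<tau>)"
  have c1: "0 < c1" by (simp add: c1_def)
  have late: "norm (X t x) \<le> c0 * exp (- l * (t - s)) * norm (X s x)" if "\<tau> \<le> s" "s \<le> t" "x \<in> Ws" for s t x
  proof -
    have s: "0 \<le> s" using that(1) \<tau>(1) by simp
    obtain E where E: "invariant_graphs p \<kappa> \<beta> E (step s)" using \<tau>(2)[OF \<open>\<tau> \<le> s\<close>] by blast
    show ?thesis
      using on_graph_decay[OF s E] mem_Ws_iff[OF s E] that by (simp add: c0_def l_def)
  qed
  have early: "norm (X t x) \<le> c1 * exp (- l * (t - s)) * norm (X s x)" if "0 \<le> s" "s \<le> t" "t \<le> \<tau>" for s t x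
  proof -
    have "norm (X t o\<^sub>L Y s) \<le> 2 * exp (2 * a * (t - s))" by (rule norm_transition_le[OF that(1,2)])
    also have "\<dots> \<le> 2 * exp (2 * a * \<tau>)" using that bound_pos by simp
    also have "\<dots> \<le> c1 * exp (- l * (t - s))"
    proof -
      have "l * (t - s) \<le> l * \<tau>" using that l by (intro mult_left_mono) auto
      then have "1 \<le> exp (l * \<tau>) * exp (- l * (t - s))" by (simp flip: exp_add)
      then have "2 * exp (2 * a * \<tau>) * 1 \<le> 2 * exp (2 * a * \<tau>) * (exp (l * \<tau>) * exp (- l * (t - s)))"
        by (intro mult_left_mono) auto
      then show ?thesis by (simp add: c1_def mult.assoc)
    qed
    finally have "norm ((X t o\<^sub>L Y s) (X s x)) \<le> c1 * exp (- l * (t - s)) * norm (X s x)"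
      by (rule norm_blinfun_apply_le) simp
    then show ?thesis using that(1) by simp
  qed
  have "norm (X t x) \<le> (c0 + c0 * c1 + c1) * exp (- l * (t - s)) * norm (X s x)"
    if st: "0 \<le> s" "s \<le> t" "x \<in> Ws" for s t x
  proof -
    \<comment> \<open>An interval that contains \<open>\<tau>\<close> is split there.\<close>
    consider "\<tau> \<le> s" | "s \<le> \<tau>" "\<tau> \<le> t" | "t \<le> \<tau>" by linarith
    then have "\<exists>c\<in>{c0, c0 * c1, c1}. norm (X t x) \<le> c * exp (- l * (t - s)) * norm (X s x)"
    proof cases
      case 1
      then show ?thesis using late st by auto
    next
      case 2
      have "norm (X t x) \<le> c0 * exp (- l * (t - \<tau>)) * norm (X \<tau> x)" using late[of \<tau> t x] 2 st by simp
      also have "\<dots> \<le> c0 * exp (- l * (t - \<tau>)) * (c1 * exp (- l * (\<tau> - s)) * norm (X s x))"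
        using early[of s \<tau> x] 2 st c0 by (intro mult_left_mono) auto
      also have "\<dots> = c0 * c1 * (exp (- l * (t - \<tau>)) * exp (- l * (\<tau> - s))) * norm (X s x)"
        by (simp only: mult_ac)
      also have "exp (- l * (t - \<tau>)) * exp (- l * (\<tau> - s)) = exp (- l * (t - s))"
        by (simp add: algebra_simps flip: exp_add)
      finally show ?thesis by blast
    next
      case 3
      then show ?thesis using early st by auto
    qed
    then obtain c where c: "c \<in> {c0, c0 * c1, c1}"
      and le: "norm (X t x) \<le> c * exp (- l * (t - s)) * norm (X s x)" by blast
    have "c \<le> c0 + c0 * c1 + c1" using c c0 c1 by (auto intro: add_nonneg_nonneg)
    then have "c * exp (- l * (t - s)) * norm (X s x) \<le> (c0 + c0 * c1 + c1) * exp (- l * (t - s)) * norm (X s x)"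
      by (intro mult_right_mono) auto
    with le show ?thesis by linarith
  qed
  moreover have "0 < c0 + c0 * c1 + c1" using c0 c1 by (intro add_pos_pos) auto
  ultimately show ?thesis using that[of "c0 + c0 * c1 + c1" l] l by blast
qed

lemma mem_range_p: "y \<in> range p \<longleftrightarrow> p y = y"
  using range_projection[OF p_plus_q p_q(2)] by blast

lemma subspace_range: "subspace (range p)" "subspace (range q)"
  by (auto intro!: linear_subspace_image bounded_linear.linear[OF blinfun.bounded_linear_right])

text \<open>
  All limits are proved with graphs for a fixed size \<open>\<beta>\<close> of the perturbation, and \<open>\<beta>\<close> is arbitrarily small
  at the price of a larger \<open>\<tau>\<close>.
\<close>

lemma tendsto_0_of_small_perturbation:
  fixes f :: "real \<Rightarrow> real"
  assumes "0 < C" "\<And>t. 0 \<le> f t"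
    and "\<And>\<beta>. 0 < \<beta> \<Longrightarrow> \<kappa> * \<kappa> * \<beta> \<le> 1 / 16 \<Longrightarrow> \<forall>\<^sub>F t in at_top. f t \<le> C * \<beta>"
  shows "(f \<longlongrightarrow> 0) at_top"
proof (rule tendstoI)
  fix \<epsilon> :: real assume "0 < \<epsilon>"
  then have "0 < \<epsilon> / (2 * C)" using assms(1) by simp
  then obtain \<beta> where \<beta>: "0 < \<beta>" "\<kappa> * \<kappa> * \<beta> \<le> 1 / 16" "\<beta> \<le> \<epsilon> / (2 * C)" using small_perturbation by metis
  have "C * \<beta> \<le> C * (\<epsilon> / (2 * C))" using assms(1) \<beta>(3) by (intro mult_left_mono) auto
  also have "\<dots> < \<epsilon>" using assms(1) \<open>0 < \<epsilon>\<close> by simp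
  finally have "C * \<beta> < \<epsilon>" .
  from assms(3)[OF \<beta>(1,2)] show "\<forall>\<^sub>F t in at_top. dist (f t) 0 < \<epsilon>"
    by eventually_elim (use \<open>C * \<beta> < \<epsilon>\<close> assms(2) in auto)
qed

lemma Ws_tendsto: "((\<lambda>t. \<delta> (X t ` Ws) (range p)) \<longlongrightarrow> 0) at_top"
proof (rule tendsto_0_of_small_perturbation[of "2 * \<kappa>"])
  show "0 < 2 * \<kappa>" using \<kappa>(1) by simp
  have z: "0 \<in> X t ` Ws" "0 \<in> range p" for t
    using subspace_0[OF subspace_image[OF subspace_Ws]] subspace_0[OF subspace_range(1)] by auto
  show "0 \<le> \<delta> (X t ` Ws) (range p)" for t
    unfolding \<delta>_def using rho_nonneg[OF z] by (rule max.coboundedI1)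
  fix \<beta> :: real assume \<beta>: "0 < \<beta>" "\<kappa> * \<kappa> * \<beta> \<le> 1 / 16"
  obtain \<tau> where \<tau>: "0 \<le> \<tau>" "\<And>s. \<tau> \<le> s \<Longrightarrow> \<exists>E. invariant_graphs p \<kappa> \<beta> E (step s)"
    using graphs_exist[OF \<beta>] by metis
  have "\<delta> (X t ` Ws) (range p) \<le> 2 * \<kappa> * \<beta>" if t: "\<tau> \<le> t" for t
  proof -
    have t0: "0 \<le> t" using t \<tau>(1) by simp
    obtain E where E: "invariant_graphs p \<kappa> \<beta> E (step t)" using \<tau>(2)[OF t] by blast
    interpret invariant_graphs p \<kappa> \<beta> E "step t" by (rule E)
    have near: "norm (E 0 y - p y) \<le> \<kappa> * \<beta> * norm y" for y
      using norm_blinfun_apply_le[OF E_near order_refl, of 0 y] by (simp add: blinfun.diff_left)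
    have "\<rho> (X t ` Ws) (range p) \<le> 2 * (\<kappa> * \<beta>)"
    proof (rule rho_le[OF z(1) subspace_range(1) \<kappa>\<beta>(1)])
      fix y assume "y \<in> X t ` Ws"
      then have "E 0 y = y" using mem_Ws_iff[OF t0 E] by auto
      then show "\<exists>z\<in>range p. norm (y - z) \<le> \<kappa> * \<beta> * norm y"
        using near[of y] by (intro bexI[of _ "p y"]) auto
    qed
    moreover have "\<rho> (range p) (X t ` Ws) \<le> 2 * (\<kappa> * \<beta>)"
    proof (rule rho_le[OF z(2) subspace_image[OF subspace_Ws] \<kappa>\<beta>(1)])
      fix y assume "y \<in> range p"
      then have "norm (y - E 0 y) \<le> \<kappa> * \<beta> * norm y"
        using near[of y] by (simp add: mem_range_p norm_minus_commute)
      moreover have "Y t (E 0 y) \<in> Ws" using mem_Ws_iff[OF t0 E] t0 by (simp add: E_E)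
      then have "E 0 y \<in> X t ` Ws" using t0 by (intro image_eqI[of _ "X t" "Y t (E 0 y)"]) auto
      ultimately show "\<exists>z\<in>X t ` Ws. norm (y - z) \<le> \<kappa> * \<beta> * norm y" by blast
    qed
    ultimately show ?thesis by (simp add: \<delta>_def)
  qed
  then show "\<forall>\<^sub>F t in at_top. \<delta> (X t ` Ws) (range p) \<le> 2 * \<kappa> * \<beta>"
    unfolding eventually_at_top_linorder by blast
qed

text \<open>
  Let \<open>X(t) W\<close> converge to \<open>E\<^sup>-\<close> and suppose that the orbit of some \<open>x \<in> W\<close> is off the graphs. By the
  convergence its component off the graph is eventually dominated by its component in \<open>E\<^sup>-\<close>, while by
  \<open>orbit_cone\<close> the opposite inequality holds in the limit. Hence \<open>W \<subseteq> W\<^sup>s\<close>. Both \<open>X(t) W\<close> and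
  \<open>X(t) W\<^sup>s\<close> are eventually close to \<open>E\<^sup>-\<close>, hence close to each other, hence equal.
\<close>

lemma Ws_unique:
  assumes W: "subspace W" "closed W" and lim: "((\<lambda>t. \<delta> (X t ` W) (range p)) \<longlongrightarrow> 0) at_top"
  shows "W = Ws"
proof -
  have sub: "subspace (X t ` W)" "subspace (X t ` Ws)" for t
    by (intro subspace_image W subspace_Ws)+
  note norm_q = \<kappa>(3)
  have le: "W \<subseteq> Ws"
  proof
    fix x assume x: "x \<in> W"
    obtain \<tau> \<beta> where \<tau>: "0 \<le> \<tau>" "\<And>s. \<tau> \<le> s \<Longrightarrow> \<exists>E. invariant_graphs p \<kappa> \<beta> E (step s)"
      using base_graphs by metis
    then obtain E where E: "invariant_graphs p \<kappa> \<beta> E (step \<tau>)" by blast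
    interpret invariant_graphs p \<kappa> \<beta> E "step \<tau>" by (rule E)
    define y where "y n = X (\<tau> + real n * h) x" for n
    define w where "w n = norm (y n - E n (y n))" for n
    have orbit: "y (Suc n) = step \<tau> n (y n)" for n unfolding y_def by (rule step_orbit[OF \<tau>(1)])
    show "x \<in> Ws"
    proof (rule ccontr)
      assume "x \<notin> Ws"
      then have w0: "0 < w 0" using mem_Ws_iff[OF \<tau>(1) E] by (auto simp: w_def y_def)
      \<comment> \<open>The aperture of the cone at the initial time; the cone estimate improves it to almost \<open>2 * \<kappa> * \<beta>\<close>.\<close>
      define c where "c = norm (p (y 0)) / w 0"
      have wpos: "0 < w n" for n
        using orbit_off_graph[OF orbit, of n] w0 unfolding w_def by (smt (verit) mult_pos_pos zero_less_power)
      have cone: "norm (p (y n)) \<le> ((1 / 4) ^ n * c + 2 * \<kappa> * \<beta>) * w n" for n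
        unfolding w_def by (rule orbit_cone[OF orbit]) (use w0 in \<open>auto simp: c_def w_def\<close>)
      have grid: "filterlim (\<lambda>n. \<tau> + real n * h) at_top sequentially"
        by (rule filterlim_tendsto_add_at_top[OF tendsto_const])
          (intro filterlim_at_top_mult_tendsto_pos[OF tendsto_const h] filterlim_real_sequentially)
      have "\<forall>\<^sub>F n in sequentially. \<delta> (X (\<tau> + real n * h) ` W) (range p) < 1 / (16 * \<kappa>)"
        using filterlim_compose[OF lim grid] \<kappa>(1) by (intro order_tendstoD) auto
      moreover have "(\<lambda>n. \<kappa> * ((1 / 4) ^ n * c)) \<longlonglongrightarrow> \<kappa> * (0 * c)"
        by (intro tendsto_mult tendsto_const LIMSEQ_realpow_zero) auto
      then have "\<forall>\<^sub>F n in sequentially. \<kappa> * ((1 / 4) ^ n * c) < 1 / 16"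
        by (intro order_tendstoD) auto
      ultimately have "\<forall>\<^sub>F n in sequentially. \<delta> (X (\<tau> + real n * h) ` W) (range p) < 1 / (16 * \<kappa>)
          \<and> \<kappa> * ((1 / 4) ^ n * c) < 1 / 16"
        by (rule eventually_conj)
      then obtain n where n: "\<delta> (X (\<tau> + real n * h) ` W) (range p) < 1 / (16 * \<kappa>)"
        "\<kappa> * ((1 / 4) ^ n * c) < 1 / 16"
        by (auto simp: eventually_sequentially)
      have "y n \<in> X (\<tau> + real n * h) ` W" using x by (simp add: y_def)
      moreover have "\<rho> (X (\<tau> + real n * h) ` W) (range p) < 1 / (16 * \<kappa>)"
        using n(1) by (simp add: \<delta>_def)
      ultimately obtain z where z: "z \<in> range p" "norm (y n - z) \<le> 1 / (16 * \<kappa>) * norm (y n)"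
        using rho_lessD[OF sub(1) subspace_range(1)] by blast
      have "q z = 0" using z(1) p_q_apply by auto
      then have "q (y n) = q (y n - z)" by (simp add: blinfun.diff_right)
      then have "norm (q (y n)) \<le> \<kappa> * (1 / (16 * \<kappa>) * norm (y n))"
        using norm_blinfun_apply_le[OF norm_q z(2)] by simp
      then have qy: "norm (q (y n)) \<le> norm (y n) / 16" using \<kappa>(1) by simp
      have "y n - E n (y n) = q (y n) - (E n - p) (y n)"
        using p_q_sum[of "y n"] by (simp add: blinfun.diff_left algebra_simps)
      then have "w n \<le> norm (q (y n)) + norm ((E n - p) (y n))" unfolding w_def by (metis norm_triangle_ineq4)
      also have "norm ((E n - p) (y n)) \<le> 1 / 16 * norm (y n)"
        using E_near[of n] \<kappa>\<beta>(3) by (intro norm_blinfun_apply_le) auto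
      finally have w1: "w n \<le> norm (y n) / 8" using qy by linarith
      have "norm (E n (p (y n))) \<le> 2 * \<kappa> * (((1 / 4) ^ n * c + 2 * \<kappa> * \<beta>) * w n)"
        by (rule norm_blinfun_apply_le[OF norm_E_le cone])
      also have "\<dots> = 2 * (\<kappa> * ((1 / 4) ^ n * c) + 2 * (\<kappa> * (\<kappa> * \<beta>))) * w n"
        by (simp add: algebra_simps)
      also have "\<dots> \<le> 2 * (1 / 16 + 2 * (1 / 16)) * w n"
        using n(2) \<kappa>\<beta>(2) wpos[of n] by (intro mult_right_mono mult_left_mono add_mono) auto
      finally have "norm (E n (p (y n))) \<le> w n" using wpos[of n] by simp
      moreover have "norm (y n) \<le> norm (E n (p (y n))) + w n"
        unfolding w_def E_p using norm_triangle_ineq[of "E n (y n)" "y n - E n (y n)"] by simp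
      ultimately have "norm (y n) \<le> 2 * w n" by simp
      then show False using w1 wpos[of n] by linarith
    qed
  qed
  have "\<forall>\<^sub>F t in at_top. \<delta> (X t ` W) (range p) < 1 / 8 \<and> \<delta> (X t ` Ws) (range p) < 1 / 8 \<and> 0 \<le> t"
    by (intro eventually_conj order_tendstoD(2)[OF lim] order_tendstoD(2)[OF Ws_tendsto] eventually_ge_at_top) auto
  then obtain t where t: "\<delta> (X t ` W) (range p) < 1 / 8" "\<delta> (X t ` Ws) (range p) < 1 / 8" "0 \<le> t"
    by (auto simp: eventually_at_top_linorder)
  have \<rho>: "\<rho> (X t ` Ws) (range p) < 1 / 8" "\<rho> (range p) (X t ` W) < 1 / 8"
    using t(1,2) by (simp_all add: \<delta>_def)
  have "X t ` Ws = X t ` W"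
  proof (rule near_subspace_eq[OF sub(2) sub(1) closed_image[OF W(2) t(3)]])
    show "X t ` W \<subseteq> X t ` Ws" using le by blast
    fix y assume "y \<in> X t ` Ws"
    then obtain z where z: "z \<in> range p" "norm (y - z) \<le> 1 / 8 * norm y"
      using rho_lessD[OF sub(2) subspace_range(1) \<rho>(1)] by blast
    obtain z' where z': "z' \<in> X t ` W" "norm (z - z') \<le> 1 / 8 * norm z"
      using rho_lessD[OF subspace_range(1) sub(1) \<rho>(2) z(1)] by blast
    have "norm z \<le> norm y + norm (y - z)" by norm
    moreover have "norm (y - z') \<le> norm (y - z) + norm (z - z')" by norm
    ultimately have "norm (y - z') \<le> norm y / 2" using z(2) z'(2) norm_ge_zero[of y] by linarith
    then show "\<exists>z\<in>X t ` W. norm (y - z) \<le> norm y / 2" using z'(1) by blast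
  qed
  then have "Y t ` X t ` Ws = Y t ` X t ` W" by simp
  then show ?thesis using t(3) by (simp add: image_image)
qed

lemma norm_XY_le:
  assumes "0 \<le> s" "s \<le> T"
  shows "norm (X s) \<le> 2 * exp (2 * a * T)" "norm (Y s) \<le> 2 * exp (2 * a * T)"
proof -
  have "2 * exp (2 * a * s) \<le> 2 * exp (2 * a * T)" using assms bound_pos by simp
  then show "norm (X s) \<le> 2 * exp (2 * a * T)" "norm (Y s) \<le> 2 * exp (2 * a * T)"
    using norm_X_le[OF assms(1)] norm_Y_le[OF assms(1)] by linarith+
qed

text \<open>An arbitrary late time is reached in steps of length \<open>h\<close> from a time of a fixed compact interval.\<close>

lemma base_time:
  assumes "0 \<le> \<tau>" "\<tau> \<le> t"
  obtains s n where "t = s + real n * h" "\<tau> \<le> s" "s \<le> \<tau> + h" "(1 / 2) ^ n \<le> 2 * exp (- (ln 2 / h) * (t - \<tau>))"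
proof -
  obtain n r where nr: "t = \<tau> + real n * h + r" "0 \<le> r" "r < h" using time_grid[OF assms(2)] .
  then show ?thesis using half_power_le[OF nr(1,3)] by (intro that[of "\<tau> + r" n]) auto
qed

text \<open>
  The vector \<open>X s v - E 0 (X s v)\<close>, transported back to time \<open>0\<close>, is the sum of \<open>v\<close> and an element of \<open>W\<^sup>s\<close>.
  The bound is uniform over the base times \<open>s\<close>.
\<close>

lemma off_graph_lower_bound:
  assumes s: "\<tau> \<le> s" "s \<le> \<tau> + h" "0 \<le> \<tau>" and E: "invariant_graphs p \<kappa> \<beta> E (step s)"
    and c: "0 \<le> c" "\<And>v w. v \<in> V \<Longrightarrow> w \<in> Ws \<Longrightarrow> norm v \<le> c * norm (v + w)" and v: "v \<in> V"
  shows "norm v \<le> c * (2 * exp (2 * a * (\<tau> + h))) * norm (X s v - E 0 (X s v))"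
proof -
  have s0: "0 \<le> s" using s by simp
  interpret invariant_graphs p \<kappa> \<beta> E "step s" by (rule E)
  have "Y s (E 0 (X s v)) \<in> Ws" using mem_Ws_iff[OF s0 E] s0 by (simp add: E_E)
  then have "- Y s (E 0 (X s v)) \<in> Ws" by (rule subspace_neg[OF subspace_Ws])
  from c(2)[OF v this] have "norm v \<le> c * norm (Y s (X s v - E 0 (X s v)))"
    using s0 by (simp add: blinfun.diff_right)
  also have "\<dots> \<le> c * (2 * exp (2 * a * (\<tau> + h)) * norm (X s v - E 0 (X s v)))"
    using s0 s(2) by (intro mult_left_mono norm_blinfun_apply_le norm_XY_le c(1) order_refl)
  finally show ?thesis by (simp add: mult.assoc)
qed

text \<open>
  An orbit starting in \<open>V\<close> is off the graphs, with a ratio \<open>r0\<close> that is uniform in \<open>V\<close> and in the base time. So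
  the cone estimate makes \<open>p y\<close> small relative to \<open>y\<close>, uniformly in \<open>y \<in> X(t) V\<close>, and \<open>q y\<close> is the point of
  \<open>E\<^sup>+\<close> close to \<open>y\<close>.
\<close>

lemma complement_tendsto:
  assumes V: "subspace V" and c: "0 < c" "\<And>v w. v \<in> V \<Longrightarrow> w \<in> Ws \<Longrightarrow> norm v \<le> c * norm (v + w)"
  shows "((\<lambda>t. \<rho> (X t ` V) (range q)) \<longlongrightarrow> 0) at_top"
proof (rule tendsto_0_of_small_perturbation[of "2 * ((1 + 2 * \<kappa>) * (1 + 2 * \<kappa>))"])
  show "0 < 2 * ((1 + 2 * \<kappa>) * (1 + 2 * \<kappa>))" using \<kappa>(1) by (intro mult_pos_pos) auto
  have z: "0 \<in> X t ` V" "0 \<in> range q" for t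
    using subspace_0[OF subspace_image[OF V]] subspace_0[OF subspace_range(2)] by auto
  show "0 \<le> \<rho> (X t ` V) (range q)" for t by (rule rho_nonneg[OF z])
  fix \<beta> :: real assume \<beta>: "0 < \<beta>" "\<kappa> * \<kappa> * \<beta> \<le> 1 / 16"
  obtain \<tau> where \<tau>: "0 \<le> \<tau>" "\<And>s. \<tau> \<le> s \<Longrightarrow> \<exists>E. invariant_graphs p \<kappa> \<beta> E (step s)"
    using graphs_exist[OF \<beta>] by metis
  define M where "M = 2 * exp (2 * a * (\<tau> + h))"
  define r0 where "r0 = \<kappa> * (M * (c * M))"
  have r0: "0 \<le> r0" using \<kappa>(1) c(1) by (auto simp: r0_def M_def)
  have "((\<lambda>t. exp (- (ln 2 / h) * (t - \<tau>))) \<longlongrightarrow> 0) at_top"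
    using h by real_asymp
  then have "((\<lambda>t. 2 * exp (- (ln 2 / h) * (t - \<tau>)) * r0) \<longlongrightarrow> 2 * 0 * r0) at_top"
    by (intro tendsto_mult tendsto_const)
  then have "\<forall>\<^sub>F t in at_top. 2 * exp (- (ln 2 / h) * (t - \<tau>)) * r0 < \<beta>"
    using \<beta>(1) by (intro order_tendstoD) auto
  then show "\<forall>\<^sub>F t in at_top. \<rho> (X t ` V) (range q) \<le> 2 * ((1 + 2 * \<kappa>) * (1 + 2 * \<kappa>)) * \<beta>"
    using eventually_ge_at_top[of \<tau>]
  proof eventually_elim
    case (elim t)
    obtain s n where sn: "t = s + real n * h" "\<tau> \<le> s" "s \<le> \<tau> + h"
      "(1 / 2) ^ n \<le> 2 * exp (- (ln 2 / h) * (t - \<tau>))"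
      using base_time[OF \<tau>(1) elim(2)] .
    have s0: "0 \<le> s" using sn \<tau>(1) by simp
    obtain E where E: "invariant_graphs p \<kappa> \<beta> E (step s)" using \<tau>(2)[OF sn(2)] by blast
    interpret invariant_graphs p \<kappa> \<beta> E "step s" by (rule E)
    have "(1 / 4 :: real) ^ n \<le> (1 / 2) ^ n" by (intro power_mono) auto
    then have "(1 / 4) ^ n * r0 \<le> 2 * exp (- (ln 2 / h) * (t - \<tau>)) * r0"
      using sn(4) r0 by (intro mult_right_mono) auto
    then have q4: "(1 / 4) ^ n * r0 \<le> \<beta>" using elim(1) by linarith
    have "\<rho> (X t ` V) (range q) \<le> 2 * ((1 + 2 * \<kappa>) * \<beta> * (1 + 2 * \<kappa>))"
    proof (rule rho_le[OF z(1) subspace_range(2)])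
      show "0 \<le> (1 + 2 * \<kappa>) * \<beta> * (1 + 2 * \<kappa>)" using \<kappa>(1) \<beta>(1) by auto
      fix y assume "y \<in> X t ` V"
      then obtain v where v: "v \<in> V" "y = X t v" by blast
      define x where "x m = X (s + real m * h) v" for m
      have orbit: "x (Suc m) = step s m (x m)" for m unfolding x_def by (rule step_orbit[OF s0])
      have "norm (p (x 0)) \<le> r0 * norm (x 0 - E 0 (x 0))"
      proof -
        have "norm v \<le> c * M * norm (x 0 - E 0 (x 0))"
          using off_graph_lower_bound[OF sn(2,3) \<tau>(1) E _ c(2) v(1)] c(1) by (simp add: x_def M_def)
        then have "norm (p (X s v)) \<le> \<kappa> * (M * (c * M * norm (x 0 - E 0 (x 0))))"
          using norm_XY_le(1)[OF s0 sn(3)] by (intro norm_blinfun_apply_le \<kappa>(2)) (simp_all add: M_def)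
        then show ?thesis by (simp add: x_def r0_def mult_ac)
      qed
      then have "norm (p (x n)) \<le> ((1 / 4) ^ n * r0 + 2 * \<kappa> * \<beta>) * norm (x n - E n (x n))"
        by (rule orbit_cone[OF orbit r0])
      also have "\<dots> \<le> (\<beta> + 2 * \<kappa> * \<beta>) * ((1 + 2 * \<kappa>) * norm (x n))"
        using q4 \<beta>(1) \<kappa>(1) by (intro mult_mono add_mono norm_complement_le order_refl) auto
      also have "x n = y" using sn(1) by (simp add: x_def v(2))
      finally have "norm (p y) \<le> (1 + 2 * \<kappa>) * \<beta> * (1 + 2 * \<kappa>) * norm y" by (simp add: algebra_simps)
      moreover have "p y = y - q y" using p_q_sum[of y] by (simp add: algebra_simps)
      ultimately show "\<exists>z\<in>range q. norm (y - z) \<le> (1 + 2 * \<kappa>) * \<beta> * (1 + 2 * \<kappa>) * norm y"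
        by (intro bexI[of _ "q y"]) auto
    qed
    then show ?case by (simp add: mult_ac)
  qed
qed

lemma complement_growth:
  assumes c: "0 < c" "\<And>v w. v \<in> V \<Longrightarrow> w \<in> Ws \<Longrightarrow> norm v \<le> c * norm (v + w)"
  obtains k \<mu> where "0 < k" "0 < \<mu>"
    "\<And>t v. 0 \<le> t \<Longrightarrow> v \<in> V \<Longrightarrow> k * exp (\<mu> * t) * norm v \<le> norm (X t v)"
proof -
  obtain \<tau> \<beta> where \<tau>: "0 \<le> \<tau>" "\<And>s. \<tau> \<le> s \<Longrightarrow> \<exists>E. invariant_graphs p \<kappa> \<beta> E (step s)"
    using base_graphs by metis
  define M where "M = 2 * exp (2 * a * (\<tau> + h))"
  define \<mu> where "\<mu> = ln 2 / h"
  define D where "D = (1 + 2 * \<kappa>) * (c * M) * 2 + M"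
  have M: "0 < M" by (simp add: M_def)
  have \<mu>: "0 < \<mu>" using h by (simp add: \<mu>_def)
  have D1: "M \<le> D" "(1 + 2 * \<kappa>) * (c * M) * 2 \<le> D" using c(1) M \<kappa>(1) by (simp_all add: D_def)
  then have D: "0 < D" using M by linarith
  have main: "exp (\<mu> * (t - \<tau>)) * norm v \<le> D * norm (X t v)" if t: "0 \<le> t" and v: "v \<in> V" for t v
  proof (cases "\<tau> \<le> t")
    case True
    obtain s n where sn: "t = s + real n * h" "\<tau> \<le> s" "s \<le> \<tau> + h"
      "(1 / 2) ^ n \<le> 2 * exp (- (ln 2 / h) * (t - \<tau>))"
      using base_time[OF \<tau>(1) True] .
    have s0: "0 \<le> s" using sn \<tau>(1) by simp
    obtain E where E: "invariant_graphs p \<kappa> \<beta> E (step s)" using \<tau>(2)[OF sn(2)] by blast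
    interpret invariant_graphs p \<kappa> \<beta> E "step s" by (rule E)
    have "norm v \<le> c * M * norm (X s v - E 0 (X s v))"
      using off_graph_lower_bound[OF sn(2,3) \<tau>(1) E _ c(2) v] c(1) by (simp add: M_def)
    also have "norm (X s v - E 0 (X s v)) = (1 / 2) ^ n * (2 ^ n * norm (X s v - E 0 (X s v)))"
      by (simp add: power_divide)
    also have "c * M * \<dots> \<le> c * M * (2 * exp (- \<mu> * (t - \<tau>)) * ((1 + 2 * \<kappa>) * norm (X t v)))"
    proof (rule mult_left_mono[OF mult_mono])
      show "2 ^ n * norm (X s v - E 0 (X s v)) \<le> (1 + 2 * \<kappa>) * norm (X t v)"
        using orbit_off_graph[where x = "\<lambda>n. X (s + real n * h) v", of n] step_orbit[OF s0]
          norm_complement_le[of "X t v" n] sn(1) by simp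
    qed (use sn(4) c(1) M in \<open>auto simp: \<mu>_def\<close>)
    finally have "exp (\<mu> * (t - \<tau>)) * norm v \<le> exp (\<mu> * (t - \<tau>))
        * (c * M * (2 * exp (- \<mu> * (t - \<tau>)) * ((1 + 2 * \<kappa>) * norm (X t v))))"
      by (intro mult_left_mono) auto
    also have "\<dots> = (exp (\<mu> * (t - \<tau>)) * exp (- \<mu> * (t - \<tau>))) * ((1 + 2 * \<kappa>) * (c * M) * 2) * norm (X t v)"
      by (simp only: mult_ac)
    also have "exp (\<mu> * (t - \<tau>)) * exp (- \<mu> * (t - \<tau>)) = 1" by (simp flip: exp_add)
    also have "1 * ((1 + 2 * \<kappa>) * (c * M) * 2) * norm (X t v) \<le> D * norm (X t v)"
      using D1 by (intro mult_right_mono) auto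
    finally show ?thesis .
  next
    case False
    have "norm v = norm (Y t (X t v))" using t by simp
    also have "\<dots> \<le> M * norm (X t v)"
      unfolding M_def using False t h by (intro norm_blinfun_apply_le norm_XY_le) auto
    finally have "norm v \<le> M * norm (X t v)" .
    moreover have "exp (\<mu> * (t - \<tau>)) * norm v \<le> 1 * norm v"
      using False \<mu> by (intro mult_right_mono) (auto simp: mult_le_0_iff)
    moreover have "M * norm (X t v) \<le> D * norm (X t v)" using D1 by (intro mult_right_mono) auto
    ultimately show ?thesis by linarith
  qed
  have "exp (- \<mu> * \<tau>) / D * exp (\<mu> * t) * norm v \<le> norm (X t v)" if "0 \<le> t" "v \<in> V" for t v
  proof -
    have "exp (- \<mu> * \<tau>) * exp (\<mu> * t) = exp (\<mu> * (t - \<tau>))" by (simp add: algebra_simps flip: exp_add)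
    then have "exp (- \<mu> * \<tau>) / D * exp (\<mu> * t) * norm v = exp (\<mu> * (t - \<tau>)) * norm v / D"
      by simp
    also have "\<dots> \<le> norm (X t v)" using main[OF that] D by (simp add: pos_divide_le_eq mult.commute)
    finally show ?thesis .
  qed
  then show ?thesis using that[of "exp (- \<mu> * \<tau>) / D" \<mu>] D \<mu> by simp
qed

text \<open>
  If \<open>\<xi>\<close> vanishes on \<open>W\<^sup>s\<close>, then \<open>\<xi> (Y t z)\<close> depends only on the component of \<open>X s (Y t z)\<close> off the graph at the base time
  \<open>s\<close>, and the expansion from \<open>s\<close> to \<open>t\<close> makes it exponentially small relative to \<open>z\<close>.
\<close>

lemma annihilator_Ws:
  fixes \<xi> :: "'a \<Rightarrow>\<^sub>L 'c::real_normed_vector"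
  shows "(\<forall>w\<in>Ws. \<xi> w = 0) \<longleftrightarrow> ((\<lambda>t. \<xi> o\<^sub>L Y t) \<longlongrightarrow> 0) at_top"
proof
  assume \<xi>: "\<forall>w\<in>Ws. \<xi> w = 0"
  obtain \<tau> \<beta> where \<tau>: "0 \<le> \<tau>" "\<And>s. \<tau> \<le> s \<Longrightarrow> \<exists>E. invariant_graphs p \<kappa> \<beta> E (step s)"
    using base_graphs by metis
  define M where "M = 2 * exp (2 * a * (\<tau> + h))"
  define C where "C = norm \<xi> * M * (1 + 2 * \<kappa>) * 2"
  have le: "norm (\<xi> o\<^sub>L Y t) \<le> C * exp (- (ln 2 / h) * (t - \<tau>))" if t: "\<tau> \<le> t" for t
  proof (rule norm_blinfun_bound)
    show "0 \<le> C * exp (- (ln 2 / h) * (t - \<tau>))" using \<kappa>(1) by (simp add: C_def M_def)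
    fix z
    obtain s n where sn: "t = s + real n * h" "\<tau> \<le> s" "s \<le> \<tau> + h"
      "(1 / 2) ^ n \<le> 2 * exp (- (ln 2 / h) * (t - \<tau>))"
      using base_time[OF \<tau>(1) t] .
    have s0: "0 \<le> s" using sn \<tau>(1) by simp
    have t0: "0 \<le> t" using t \<tau>(1) by simp
    obtain E where E: "invariant_graphs p \<kappa> \<beta> E (step s)" using \<tau>(2)[OF sn(2)] by blast
    interpret invariant_graphs p \<kappa> \<beta> E "step s" by (rule E)
    define x where "x m = X (s + real m * h) (Y t z)" for m
    have orbit: "x (Suc m) = step s m (x m)" for m unfolding x_def by (rule step_orbit[OF s0])
    have xn: "x n = z" using t0 sn(1) by (simp add: x_def)
    have "2 ^ n * norm (x 0 - E 0 (x 0)) \<le> norm (z - E n z)"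
      using orbit_off_graph[OF orbit, of n] xn by simp
    also have "\<dots> \<le> (1 + 2 * \<kappa>) * norm z" by (rule norm_complement_le)
    finally have "(1 / 2) ^ n * (2 ^ n * norm (x 0 - E 0 (x 0))) \<le> 2 * exp (- (ln 2 / h) * (t - \<tau>)) * ((1 + 2 * \<kappa>) * norm z)"
      by (rule mult_mono[OF sn(4)]) auto
    then have w: "norm (x 0 - E 0 (x 0)) \<le> 2 * exp (- (ln 2 / h) * (t - \<tau>)) * ((1 + 2 * \<kappa>) * norm z)"
      by (simp add: power_divide)
    have "Y s (E 0 (x 0)) \<in> Ws" using mem_Ws_iff[OF s0 E] s0 by (simp add: E_E)
    then have "\<xi> (Y s (E 0 (x 0))) = 0" using \<xi> by blast
    moreover have "Y t z = Y s (x 0)" using s0 by (simp add: x_def)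
    ultimately have "(\<xi> o\<^sub>L Y t) z = \<xi> (Y s (x 0 - E 0 (x 0)))" by (simp add: blinfun.diff_right)
    also have "norm \<dots> \<le> norm \<xi> * (M * (2 * exp (- (ln 2 / h) * (t - \<tau>)) * ((1 + 2 * \<kappa>) * norm z)))"
      unfolding M_def using s0 sn(3) by (intro norm_blinfun_apply_le norm_XY_le w order_refl)
    finally show "norm ((\<xi> o\<^sub>L Y t) z) \<le> C * exp (- (ln 2 / h) * (t - \<tau>)) * norm z"
      by (simp only: C_def mult_ac)
  qed
  have "((\<lambda>t. exp (- (ln 2 / h) * (t - \<tau>))) \<longlongrightarrow> 0) at_top"
    using h by real_asymp
  then have "((\<lambda>t. C * exp (- (ln 2 / h) * (t - \<tau>))) \<longlongrightarrow> C * 0) at_top"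
    by (intro tendsto_mult tendsto_const)
  then have "((\<lambda>t. C * exp (- (ln 2 / h) * (t - \<tau>))) \<longlongrightarrow> 0) at_top" by simp
  moreover have "\<forall>\<^sub>F t in at_top. norm (\<xi> o\<^sub>L Y t) \<le> C * exp (- (ln 2 / h) * (t - \<tau>))"
    using eventually_ge_at_top[of \<tau>] by eventually_elim (rule le)
  ultimately show "((\<lambda>t. \<xi> o\<^sub>L Y t) \<longlongrightarrow> 0) at_top" by (rule Lim_null_comparison[rotated])
next
  assume lim: "((\<lambda>t. \<xi> o\<^sub>L Y t) \<longlongrightarrow> 0) at_top"
  show "\<forall>w\<in>Ws. \<xi> w = 0"
  proof
    fix w assume "w \<in> Ws"
    then have "((\<lambda>t. X t w) \<longlongrightarrow> 0) at_top" by (simp add: mem_Ws)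
    then have "((\<lambda>t. (\<xi> o\<^sub>L Y t) (X t w)) \<longlongrightarrow> 0) at_top"
      by (rule bounded_bilinear.tendsto_zero[OF bounded_bilinear_blinfun_apply lim])
    moreover have "\<forall>\<^sub>F t in at_top. (\<xi> o\<^sub>L Y t) (X t w) = \<xi> w"
      using eventually_ge_at_top[of 0] by eventually_elim simp
    ultimately have "((\<lambda>t::real. \<xi> w) \<longlongrightarrow> 0) at_top" by (rule Lim_transform_eventually)
    then show "\<xi> w = 0" by (simp add: tendsto_const_iff)
  qed
qed

end

section \<open>Adjoints and scalars\<close>

lemma adjoint_apply: "adjoint_blinfun T \<xi> = \<xi> o\<^sub>L T"
  by transfer simp

lemma norm_adjoint_le:
  "norm (adjoint_blinfun T :: ('a::banach \<Rightarrow>\<^sub>L 'k::real_or_complex) \<Rightarrow>\<^sub>L ('a \<Rightarrow>\<^sub>L 'k)) \<le> norm T"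
proof (rule norm_blinfun_bound)
  fix \<xi> :: "'a \<Rightarrow>\<^sub>L 'k"
  show "norm (adjoint_blinfun T \<xi>) \<le> norm T * norm \<xi>"
    using norm_blinfun_compose[of \<xi> T] by (simp add: adjoint_apply mult.commute)
qed simp

lemma bounded_linear_adjoint:
  "bounded_linear (adjoint_blinfun :: ('a::banach \<Rightarrow>\<^sub>L 'a) \<Rightarrow> ('a \<Rightarrow>\<^sub>L 'k::real_or_complex) \<Rightarrow>\<^sub>L ('a \<Rightarrow>\<^sub>L 'k))"
  by (rule bounded_linear_intro[where K = 1])
    (auto intro!: blinfun_eqI simp: adjoint_apply blinfun.bilinear_simps norm_adjoint_le)

text \<open>
  Taking adjoints in \<open>Y' = - Y A\<close> reverses the order of the factors.
\<close>

lemma (in bounded_path) fundamental_solution_adjoint: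
  fixes \<xi> :: "'a \<Rightarrow>\<^sub>L 'k::real_or_complex"
  assumes "0 \<le> t"
  shows "fundamental_solution (\<lambda>t. - adjoint_blinfun (A t)) t \<xi> = \<xi> o\<^sub>L Y t"
proof -
  interpret dual: bounded_path "\<lambda>t. - adjoint_blinfun (A t) :: ('a \<Rightarrow>\<^sub>L 'k) \<Rightarrow>\<^sub>L ('a \<Rightarrow>\<^sub>L 'k)" a
  proof
    show "continuous_on {0..} (\<lambda>t. - adjoint_blinfun (A t) :: ('a \<Rightarrow>\<^sub>L 'k) \<Rightarrow>\<^sub>L ('a \<Rightarrow>\<^sub>L 'k))"
      by (intro continuous_intros bounded_linear.continuous_on[OF bounded_linear_adjoint] continuous_path)
    show "norm (- adjoint_blinfun (A t) :: ('a \<Rightarrow>\<^sub>L 'k) \<Rightarrow>\<^sub>L ('a \<Rightarrow>\<^sub>L 'k)) \<le> a" if "0 \<le> t" for t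
      unfolding norm_minus_cancel by (rule order_trans[OF norm_adjoint_le norm_path_le[OF that]])
  qed (rule bound_pos)
  have "dual.X t = adjoint_blinfun (Y t)"
  proof (rule dual.fundamental_solution_unique[OF _ _ assms])
    show "dual.solution (\<lambda>t. adjoint_blinfun (Y t))"
      unfolding dual.solution_def
    proof (intro allI impI)
      fix t :: real assume "0 \<le> t"
      from bounded_linear.has_vector_derivative[OF bounded_linear_adjoint Y_derivative[OF this]]
      have "((\<lambda>t. adjoint_blinfun (Y t) :: ('a \<Rightarrow>\<^sub>L 'k) \<Rightarrow>\<^sub>L ('a \<Rightarrow>\<^sub>L 'k)) has_vector_derivative adjoint_blinfun (- (Y t o\<^sub>L A t))) (at t within {0..})" .
      moreover have "adjoint_blinfun (- (Y t o\<^sub>L A t)) = - adjoint_blinfun (A t) o\<^sub>L (adjoint_blinfun (Y t) :: ('a \<Rightarrow>\<^sub>L 'k) \<Rightarrow>\<^sub>L ('a \<Rightarrow>\<^sub>L 'k))"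
        by (intro blinfun_eqI) (simp add: adjoint_apply blinfun.bilinear_simps)
      ultimately show "((\<lambda>t. adjoint_blinfun (Y t) :: ('a \<Rightarrow>\<^sub>L 'k) \<Rightarrow>\<^sub>L ('a \<Rightarrow>\<^sub>L 'k)) has_vector_derivative
          (- adjoint_blinfun (A t) o\<^sub>L adjoint_blinfun (Y t))) (at t within {0..})" by simp
    qed
    show "adjoint_blinfun (Y 0) = (id_blinfun :: ('a \<Rightarrow>\<^sub>L 'k) \<Rightarrow>\<^sub>L ('a \<Rightarrow>\<^sub>L 'k))"
      by (intro blinfun_eqI) (simp add: adjoint_apply Y_0)
  qed
  then show ?thesis by (simp add: adjoint_apply)
qed

lemma (in dichotomy) dual_stable_space_eq:
  "dual_stable_space smul A = annihilator smul Ws"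
proof -
  have "\<xi> \<in> stable_space (\<lambda>t. - adjoint_blinfun (A t)) \<longleftrightarrow> (\<forall>w\<in>Ws. \<xi> w = 0)" for \<xi>
  proof -
    have "\<forall>\<^sub>F t in at_top. fundamental_solution (\<lambda>t. - adjoint_blinfun (A t)) t \<xi> = \<xi> o\<^sub>L Y t"
      using eventually_ge_at_top[of 0] by eventually_elim (rule fundamental_solution_adjoint)
    then have "\<xi> \<in> stable_space (\<lambda>t. - adjoint_blinfun (A t)) \<longleftrightarrow> ((\<lambda>t. \<xi> o\<^sub>L Y t) \<longlongrightarrow> 0) at_top"
      by (simp add: stable_space_def tendsto_cong)
    then show ?thesis using annihilator_Ws by blast
  qed
  then show ?thesis unfolding dual_stable_space_def annihilator_def by auto
qed

lemma closed_subspace_iff: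
  assumes "banach_over smul"
  shows "closed_subspace smul W \<longleftrightarrow> subspace W \<and> closed W \<and> (\<forall>c. \<forall>x\<in>W. smul c x \<in> W)"
proof -
  interpret K: banach_over smul by (rule assms)
  have "c *\<^sub>R x \<in> W" if "\<forall>c. \<forall>x\<in>W. smul c x \<in> W" "x \<in> W" for c x
    using that by (metis K.smul_of_real)
  then show ?thesis
    unfolding closed_subspace_def K.subspace_def subspace_def by blast
qed

context banach_over
begin

lemma bounded_operators_commute:
  "T \<in> bounded_operators smul \<longleftrightarrow> (\<forall>c. T o\<^sub>L Blinfun (smul c) = Blinfun (smul c) o\<^sub>L T)"
proof -
  have "(T o\<^sub>L Blinfun (smul c) = Blinfun (smul c) o\<^sub>L T) \<longleftrightarrow> (\<forall>x. T (smul c x) = smul c (T x))" for c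
  proof -
    have ap: "(T o\<^sub>L Blinfun (smul c)) x = T (smul c x)" "(Blinfun (smul c) o\<^sub>L T) x = smul c (T x)" for x
      by (simp_all add: bounded_linear_Blinfun_apply[OF bounded_linear_smul])
    show ?thesis
    proof
      show "\<forall>x. T (smul c x) = smul c (T x)" if "T o\<^sub>L Blinfun (smul c) = Blinfun (smul c) o\<^sub>L T"
        using that ap by metis
      show "T o\<^sub>L Blinfun (smul c) = Blinfun (smul c) o\<^sub>L T" if "\<forall>x. T (smul c x) = smul c (T x)"
        by (rule blinfun_eqI) (simp only: ap that)
    qed
  qed
  then show ?thesis by (simp add: bounded_operators_def)
qed

lemma fundamental_solution_bounded_operators:
  assumes "bounded_path A a" "\<And>t. 0 \<le> t \<Longrightarrow> A t \<in> bounded_operators smul" "0 \<le> t"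
  shows "fundamental_solution A t \<in> bounded_operators smul"
  using bounded_path.fundamental_solution_commute[OF assms(1) _ assms(3)] assms(2)
  unfolding bounded_operators_commute by blast

lemma bounded_operators_limit:
  assumes "\<And>t::real. 0 \<le> t \<Longrightarrow> A t \<in> bounded_operators smul" "(A \<longlongrightarrow> A\<^sub>0) at_top"
  shows "A\<^sub>0 \<in> bounded_operators smul"
  unfolding bounded_operators_def
proof (intro CollectI allI)
  fix c x
  have l1: "((\<lambda>t. A t (smul c x)) \<longlongrightarrow> A\<^sub>0 (smul c x)) at_top"
    by (intro tendsto_intros assms)
  have l2: "((\<lambda>t. smul c (A t x)) \<longlongrightarrow> smul c (A\<^sub>0 x)) at_top"
    by (intro bounded_linear.tendsto[OF bounded_linear_smul] tendsto_intros assms)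
  have "\<forall>\<^sub>F t in at_top. smul c (A t x) = A t (smul c x)"
    using eventually_ge_at_top[of 0]
    by eventually_elim (use assms(1) in \<open>simp add: bounded_operators_def\<close>)
  with l2 have "((\<lambda>t. A t (smul c x)) \<longlongrightarrow> smul c (A\<^sub>0 x)) at_top" by (rule Lim_transform_eventually)
  with l1 show "A\<^sub>0 (smul c x) = smul c (A\<^sub>0 x)"
    by (rule tendsto_unique[OF trivial_limit_at_top_linorder])
qed

lemma stable_space_smul:
  assumes "\<And>t. 0 \<le> t \<Longrightarrow> fundamental_solution A t \<in> bounded_operators smul" "x \<in> stable_space A"
  shows "smul c x \<in> stable_space A"
proof -
  have "((\<lambda>t. smul c (fundamental_solution A t x)) \<longlongrightarrow> smul c 0) at_top"
    using assms(2) by (intro bounded_linear.tendsto[OF bounded_linear_smul]) (simp add: stable_space_def)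
  then have "((\<lambda>t. smul c (fundamental_solution A t x)) \<longlongrightarrow> 0) at_top" by simp
  moreover have "\<forall>\<^sub>F t in at_top. smul c (fundamental_solution A t x) = fundamental_solution A t (smul c x)"
    using eventually_ge_at_top[of 0]
    by eventually_elim (use assms(1) in \<open>simp add: bounded_operators_def\<close>)
  ultimately show ?thesis unfolding stable_space_def by (simp add: tendsto_cong)
qed

end

section \<open>Asymptotically hyperbolic paths\<close>

lemma convergent_path_bounded:
  fixes A :: "real \<Rightarrow> ('a::banach \<Rightarrow>\<^sub>L 'a)"
  assumes "continuous_on {0..} A" "(A \<longlongrightarrow> A\<^sub>0) at_top"
  obtains a where "bounded_path A a" "norm A\<^sub>0 \<le> a"
proof -
  obtain N where N: "\<And>t. N \<le> t \<Longrightarrow> dist (A t) A\<^sub>0 < 1"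
    using tendstoD[OF assms(2) zero_less_one] by (auto simp: eventually_at_top_linorder)
  have "bounded (A ` {0..N})"
    by (intro compact_imp_bounded compact_continuous_image continuous_on_subset[OF assms(1)]) auto
  then obtain b where b: "\<forall>t\<in>{0..N}. norm (A t) \<le> b" unfolding bounded_iff by blast
  have "norm (A t) \<le> max b (norm A\<^sub>0 + 1)" if "0 \<le> t" for t
  proof (cases "t \<le> N")
    case True
    then have "norm (A t) \<le> b" using b that by simp
    then show ?thesis by simp
  next
    case False
    have "norm (A t) \<le> norm A\<^sub>0 + dist (A t) A\<^sub>0" unfolding dist_norm by norm
    then show ?thesis using N[of t] False by simp
  qed
  moreover have "0 < norm A\<^sub>0 + 1" by (simp add: add_nonneg_pos)
  ultimately have "bounded_path A (max b (norm A\<^sub>0 + 1))"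
    using assms(1) by unfold_locales auto
  then show ?thesis using that by simp
qed

lemma norm_restricted_decay:
  fixes S T :: "'a::banach \<Rightarrow>\<^sub>L 'a"
  assumes "\<And>w. w \<in> W \<Longrightarrow> norm (S w) \<le> c * norm (T w)" "0 \<in> W" "0 \<le> c"
  shows "norm_restricted S W \<le> c * norm_restricted T W"
  unfolding norm_restricted_def
proof (rule cSUP_least)
  show "W \<inter> cball 0 1 \<noteq> {}" using assms(2) by auto
  fix w assume w: "w \<in> W \<inter> cball 0 1"
  have "bdd_above ((\<lambda>w. norm (T w)) ` (W \<inter> cball 0 1))"
  proof (rule bdd_aboveI2)
    fix x assume "x \<in> W \<inter> cball 0 1"
    then show "norm (T x) \<le> norm T * 1" by (intro norm_blinfun_apply_le) auto
  qed
  then have "norm (T w) \<le> (SUP w\<in>W \<inter> cball 0 1. norm (T w))" using w by (rule cSUP_upper[rotated])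
  then show "norm (S w) \<le> c * (SUP w\<in>W \<inter> cball 0 1. norm (T w))"
    using assms(1)[of w] w assms(3) mult_left_mono by fastforce
qed

theorem theorem4p1:
  fixes smul :: "'k::real_or_complex \<Rightarrow> 'a::banach \<Rightarrow> 'a"
    and A :: "real \<Rightarrow> ('a \<Rightarrow>\<^sub>L 'a)" and A\<^sub>0 :: "'a \<Rightarrow>\<^sub>L 'a"
  assumes "banach_over smul"
    and "asymptotically_hyperbolic smul A A\<^sub>0"
  defines "X \<equiv> fundamental_solution A"
    and "Ws \<equiv> stable_space A"
    and "Ep \<equiv> positive_subspace smul A\<^sub>0"
    and "Em \<equiv> negative_subspace smul A\<^sub>0"
  shows "closed_subspace smul Ws \<and> (\<exists>Z. complementary smul Z Ws) \<and>
    (\<forall>W. closed_subspace smul W \<longrightarrow>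
      (((\<lambda>t. \<delta> (X t ` W) Em) \<longlongrightarrow> 0) at_top \<longleftrightarrow> W = Ws)) \<and>
    (\<exists>c>0. \<exists>l>0. \<forall>s\<ge>0. \<forall>t\<ge>s.
      norm_restricted (X t) Ws \<le> c * exp (- l * (t - s)) * norm_restricted (X s) Ws) \<and>
    (\<forall>V. complementary smul V Ws \<longrightarrow> ((\<lambda>t. \<rho> (X t ` V) Ep) \<longlongrightarrow> 0) at_top) \<and>
    (\<forall>V. complementary smul V Ws \<longrightarrow>
      (\<exists>k>0. \<exists>\<mu>>0. \<forall>t\<ge>0.
        ereal (k * exp (\<mu> * t)) \<le> (INF v\<in>{v \<in> V. norm v = 1}. ereal (norm (X t v))))) \<and>
    dual_stable_space smul A = annihilator smul Ws"
proof -
  interpret K: banach_over smul by (rule assms(1))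
  have bo: "\<And>t. 0 \<le> t \<Longrightarrow> A t \<in> bounded_operators smul" and cont: "continuous_on {0..} A"
    and lim: "(A \<longlongrightarrow> A\<^sub>0) at_top" and hyp: "hyperbolic smul A\<^sub>0"
    using assms(2) by (auto simp: asymptotically_hyperbolic_def)
  obtain a where a: "bounded_path A a" "norm A\<^sub>0 \<le> a"
    using convergent_path_bounded[OF cont lim] .
  obtain p q K where pq: "p + q = id_blinfun" "A\<^sub>0 o\<^sub>L p = p o\<^sub>L A\<^sub>0"
    and decay: "\<And>t. 0 < t \<Longrightarrow> norm (op_exp A\<^sub>0 t o\<^sub>L p) \<le> K / t"
      "\<And>t. 0 < t \<Longrightarrow> norm (op_exp (- A\<^sub>0) t o\<^sub>L q) \<le> K / t"
    and pq_smul: "p \<in> bounded_operators smul" "q \<in> bounded_operators smul"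
    and ranges: "range p = Em" "range q = Ep"
    using K.hyperbolic_splitting[OF K.bounded_operators_limit[OF bo lim] hyp] unfolding Em_def Ep_def by metis
  \<comment> \<open>The bound \<open>K / t\<close> on the exponentials is at most \<open>1 / 4\<close> at \<open>t = h\<close>.\<close>
  define h where "h = 4 * \<bar>K\<bar> + 1"
  have h: "0 < h" by (simp add: h_def add_nonneg_pos)
  have "K / h \<le> 1 / 4" using h by (simp add: h_def pos_divide_le_eq)
  interpret dichotomy A a A\<^sub>0 p q "max 1 (max (norm p) (norm q))" h
  proof (intro dichotomy.intro a(1) dichotomy_axioms.intro lim a(2) pq h)
    show "p o\<^sub>L q = 0" "q o\<^sub>L p = 0" using splitting_orthogonal[OF pq decay] by auto
    show "norm (op_exp A\<^sub>0 h o\<^sub>L p) \<le> 1 / 4" "norm (op_exp (- A\<^sub>0) h o\<^sub>L q) \<le> 1 / 4"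
      using decay[OF h] \<open>K / h \<le> 1 / 4\<close> by linarith+
  qed auto
  have X_smul: "fundamental_solution A t \<in> bounded_operators smul" if "0 \<le> t" for t
    by (rule K.fundamental_solution_bounded_operators[OF a(1) bo that])
  have closed_subspace_Ws: "closed_subspace smul Ws"
    unfolding Ws_def closed_subspace_iff[OF assms(1)]
    using subspace_Ws closed_Ws K.stable_space_smul[OF X_smul] by blast
  have complement: "\<exists>Z. complementary smul Z Ws"
  proof -
    obtain \<tau> where \<tau>: "0 \<le> \<tau>" "Ws \<inter> {z. p (X \<tau> z) = 0} = {0}"
      "\<And>x. \<exists>z. p (X \<tau> z) = 0 \<and> (\<exists>w\<in>Ws. x = z + w)"
      using complement_Ws unfolding Ws_def X_def by metis
    have "closed_subspace smul {z. p (X \<tau> z) = 0}"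
      unfolding closed_subspace_iff[OF assms(1)]
    proof (intro conjI)
      show "subspace {z. p (X \<tau> z) = 0}"
        by (auto simp: subspace_def blinfun.bilinear_simps)
      show "closed {z. p (X \<tau> z) = 0}" by (intro closed_Collect_eq continuous_intros)
      show "\<forall>c. \<forall>x\<in>{z. p (X \<tau> z) = 0}. smul c x \<in> {z. p (X \<tau> z) = 0}"
        using pq_smul(1) X_smul[OF \<tau>(1)] by (auto simp: bounded_operators_def X_def)
    qed
    moreover have "{z. p (X \<tau> z) = 0} \<inter> Ws = {0}" using \<tau>(2) by (simp only: Int_commute)
    moreover have "{v + w |v w. v \<in> {z. p (X \<tau> z) = 0} \<and> w \<in> Ws} = UNIV" using \<tau>(3) by blast
    ultimately have "complementary smul {z. p (X \<tau> z) = 0} Ws"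
      unfolding complementary_def using closed_subspace_Ws by (intro conjI)
    then show ?thesis by blast
  qed
  have unique: "((\<lambda>t. \<delta> (X t ` W) Em) \<longlongrightarrow> 0) at_top \<longleftrightarrow> W = Ws" if "closed_subspace smul W" for W
    using Ws_unique[of W] Ws_tendsto that unfolding closed_subspace_iff[OF assms(1)] ranges X_def Ws_def by blast
  have decay_Ws: "\<exists>c>0. \<exists>l>0. \<forall>s\<ge>0. \<forall>t\<ge>s.
      norm_restricted (X t) Ws \<le> c * exp (- l * (t - s)) * norm_restricted (X s) Ws"
  proof -
    obtain c l where cl: "0 < c" "0 < l" and le: "\<And>s t x. 0 \<le> s \<Longrightarrow> s \<le> t \<Longrightarrow> x \<in> Ws \<Longrightarrow>
        norm (X t x) \<le> c * exp (- l * (t - s)) * norm (X s x)"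
      using stable_decay unfolding Ws_def X_def by metis
    have "norm_restricted (X t) Ws \<le> c * exp (- l * (t - s)) * norm_restricted (X s) Ws"
      if "0 \<le> s" "s \<le> t" for s t
      by (rule norm_restricted_decay)
        (use le that cl subspace_0[OF subspace_Ws] in \<open>auto simp: Ws_def\<close>)
    then show ?thesis using cl by blast
  qed
  have V_bound: "\<exists>c>0. \<forall>v\<in>V. \<forall>w\<in>Ws. norm v \<le> c * norm (v + w)"
    and V_subspace: "subspace V" if V: "complementary smul V Ws" for V
  proof -
    have V': "subspace V" "closed V" "subspace Ws" "closed Ws" "V \<inter> Ws = {0}"
      and sum: "{v + w |v w. v \<in> V \<and> w \<in> Ws} = UNIV"
      using V unfolding complementary_def closed_subspace_iff[OF assms(1)] by simp_all
    show "subspace V" by (rule V'(1))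
    have "\<exists>v\<in>V. \<exists>w\<in>Ws. z = v + w" for z
    proof -
      have "z \<in> {v + w |v w. v \<in> V \<and> w \<in> Ws}" unfolding sum by simp
      then show ?thesis by blast
    qed
    from complementary_projection_bounded[OF V' this]
    show "\<exists>c>0. \<forall>v\<in>V. \<forall>w\<in>Ws. norm v \<le> c * norm (v + w)" .
  qed
  have attract: "((\<lambda>t. \<rho> (X t ` V) Ep) \<longlongrightarrow> 0) at_top" if V: "complementary smul V Ws" for V
  proof -
    obtain c where "0 < c" "\<forall>v\<in>V. \<forall>w\<in>Ws. norm v \<le> c * norm (v + w)" using V_bound[OF V] by blast
    then show ?thesis
      using complement_tendsto[OF V_subspace[OF V], of c] unfolding ranges X_def Ws_def by blast
  qed
  have growth: "\<exists>k>0. \<exists>\<mu>>0. \<forall>t\<ge>0.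
        ereal (k * exp (\<mu> * t)) \<le> (INF v\<in>{v \<in> V. norm v = 1}. ereal (norm (X t v)))"
    if V: "complementary smul V Ws" for V
  proof -
    obtain c where "0 < c" "\<forall>v\<in>V. \<forall>w\<in>Ws. norm v \<le> c * norm (v + w)" using V_bound[OF V] by blast
    then obtain k \<mu> where k: "0 < k" "0 < \<mu>"
      "\<And>t v. 0 \<le> t \<Longrightarrow> v \<in> V \<Longrightarrow> k * exp (\<mu> * t) * norm v \<le> norm (X t v)"
      using complement_growth[of c V] unfolding X_def Ws_def by metis
    have "ereal (k * exp (\<mu> * t)) \<le> (INF v\<in>{v \<in> V. norm v = 1}. ereal (norm (X t v)))" if "0 \<le> t" for t
      using k(3)[OF that] by (intro INF_greatest) (force simp: ereal_less_eq(3))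
    then show ?thesis using k(1,2) by blast
  qed
  have "dual_stable_space smul A = annihilator smul Ws"
    unfolding Ws_def by (rule dual_stable_space_eq)
  with closed_subspace_Ws complement unique decay_Ws attract growth show ?thesis by blast
qed

end
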